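(* Let $d\ge2$ and let $\mathbf p=(\mathbf p_1,\dots,\mathbf p_n)$ be a generic configuration of $n\ge d+2$ points in $\mathbb R^d$. Let $\mathbf v=\langle G,\mathbf p\rangle^2$, where $G=(G_1,\dots,G_k)$ is an edge measurement ensemble that allows for trilateration. Suppose there is a configuration $\mathbf q=(\mathbf q_1,\dots,\mathbf q_n)$, also of $n$ points in $\mathbb R^d$, along with an edge measurement ensemble $H=(H_1,\dots,H_k)$, such that $\mathbf v=\langle H,\mathbf q\rangle^2$. Then there is a vertex relabeling of $\mathbf q$ such that, up to congruence, $\mathbf q=\mathbf p$; moreover, under this vertex relabeling, $G=H$. That is, there is a permutation $\sigma$ of $\{1,\dots,n\}$ such that $(\mathbf q_{\sigma(1)},\dots,\mathbf q_{\sigma(n)})$ is congruent to $\mathbf p$ and, for each $t$, if $G_t=\{i,j\}$ then $H_t=\{\sigma(i),\sigma(j)\}$.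
   Context: A configuration of $n$ points in $\mathbb R^d$ is a sequence $\mathbf p=(\mathbf p_1,\dots,\mathbf p_n)$ with $\mathbf p_i\in\mathbb R^d$; it is generic if its $dn$ coordinates satisfy no non-trivial polynomial equation with coefficients in $\mathbb Q$. Two configurations are congruent if a Euclidean isometry of $\mathbb R^d$ maps one to the other point by point, in order. An edge is an unordered pair $\{i,j\}$ of distinct vertices in $\{1,\dots,n\}$. An edge measurement ensemble is a finite sequence $G=(G_1,\dots,G_k)$ of edges (an ordered graph on $\{1,\dots,n\}$). $\langle G,\mathbf p\rangle^2$ denotes the sequence of squared Euclidean edge lengths, i.e. its $t$-th entry is $|\mathbf p_i-\mathbf p_j|^2$ when $G_t=\{i,j\}$. An edge measurement ensemble allows for trilateration if, after some reordering of the vertices, (i) it contains all edges of the complete graph on $\{1,\dots,d+2\}$, and (ii) for each $j$ with $d+2<j\le n$ it contains the edges $\{i_1,j\},\dots,\{i_{d+1},j\}$ for some distinct $i_1,\dots,i_{d+1}<j$. It may contain further edges. *)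

theory Defs
  imports "HOL-Analysis.Analysis" "HOL-Library.Poly_Mapping"
begin

text \<open>
  A configuration of \<open>n\<close> points in \<open>\<real>\<^sup>d\<close> is a function \<open>nat \<Rightarrow> real ^ 'd\<close> with \<open>CARD('d) = d\<close>, of which
  only the values at the indices in \<open>{1..n}\<close> are meaningful.  No definition below depends on the
  other values.
\<close>

type_synonym 'd configuration = "nat \<Rightarrow> real ^ 'd"

text \<open>
  Multivariate polynomials with rational coefficients: a finitely supported map from monomials to
  coefficients, where a monomial is a finitely supported map from variables to exponents.
\<close>

type_synonym 'v rat_mpoly = "('v \<Rightarrow>\<^sub>0 nat) \<Rightarrow>\<^sub>0 rat"

definition mpoly_vars :: "'v rat_mpoly \<Rightarrow> 'v set" where
  "mpoly_vars P = (\<Union>m \<in> Poly_Mapping.keys P. Poly_Mapping.keys m)"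

definition mpoly_value :: "('v \<Rightarrow> real) \<Rightarrow> 'v rat_mpoly \<Rightarrow> real" where
  "mpoly_value x P =
     (\<Sum>m \<in> Poly_Mapping.keys P. of_rat (Poly_Mapping.lookup P m) *
        (\<Prod>v \<in> Poly_Mapping.keys m. x v ^ Poly_Mapping.lookup m v))"

text \<open>The variable \<open>(i, c)\<close> stands for the \<open>c\<close>-th coordinate of the \<open>i\<close>-th point.\<close>

definition generic :: "nat \<Rightarrow> 'd::finite configuration \<Rightarrow> bool" where
  "generic n p \<longleftrightarrow>
     (\<forall>P :: (nat \<times> 'd) rat_mpoly. P \<noteq> 0 \<and> mpoly_vars P \<subseteq> {1..n} \<times> UNIV \<longrightarrow>
        mpoly_value (\<lambda>(i, c). p i $ c) P \<noteq> 0)"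

definition congruent_configurations ::
  "nat \<Rightarrow> 'd::finite configuration \<Rightarrow> 'd configuration \<Rightarrow> bool" where
  "congruent_configurations n p q \<longleftrightarrow>
     (\<exists>f :: real ^ 'd \<Rightarrow> real ^ 'd.
        (\<forall>x y. dist (f x) (f y) = dist x y) \<and> (\<forall>i \<in> {1..n}. f (p i) = q i))"

definition edges_on :: "nat \<Rightarrow> nat set set" where
  "edges_on n = {{i, j} | i j. i \<in> {1..n} \<and> j \<in> {1..n} \<and> i \<noteq> j}"

definition edge_ensemble :: "nat \<Rightarrow> nat set list \<Rightarrow> bool" where
  "edge_ensemble n G \<longleftrightarrow> set G \<subseteq> edges_on n"

definition edge_sqlength :: "'d::finite configuration \<Rightarrow> nat set \<Rightarrow> real" where
  "edge_sqlength p e = (THE r. \<exists>i j. e = {i, j} \<and> r = (norm (p i - p j))\<^sup>2)"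

lemma edge_sqlength_doubleton: "edge_sqlength p {i, j} = (norm (p i - p j))\<^sup>2"
  unfolding edge_sqlength_def
  by (rule the_equality) (auto simp: doubleton_eq_iff norm_minus_commute)

definition sq_measurements :: "nat set list \<Rightarrow> 'd::finite configuration \<Rightarrow> real list" where
  "sq_measurements G p = map (edge_sqlength p) G"

text \<open>
  The permutation \<open>\<pi>\<close> is the reordering of the vertices: \<open>\<pi> i\<close> is the vertex in position \<open>i\<close>.
  The dimension \<open>d\<close> is a plain number here.
\<close>

definition allows_trilateration :: "nat \<Rightarrow> nat \<Rightarrow> nat set list \<Rightarrow> bool" where
  "allows_trilateration d n G \<longleftrightarrow>
     (\<exists>\<pi>. \<pi> permutes {1..n} \<and>
        (\<forall>i \<in> {1..d + 2}. \<forall>j \<in> {1..d + 2}. i \<noteq> j \<longrightarrow> {\<pi> i, \<pi> j} \<in> set G) \<and>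
        (\<forall>j \<in> {d + 2<..n}. \<exists>I \<subseteq> {1..<j}. card I = d + 1 \<and> (\<forall>i \<in> I. {\<pi> i, \<pi> j} \<in> set G)))"

end

theory Submission
  imports Defs "HOL-Computational_Algebra.Polynomial"
begin

text \<open>
  The argument replaces dimension counts in algebraic geometry by derivations of the field of real
  numbers.  Since \<open>p\<close> is generic, its coordinates are algebraically independent over the
  rationals, and a derivation \<open>\<delta>\<close> of \<open>\<real>\<close> may be prescribed on them at will
  (\<open>generic_imp_freely_movable\<close>).  Such a \<open>\<delta>\<close> is an infinitesimal motion of everything at
  once: it moves \<open>p\<close> with any desired velocity, it moves \<open>q\<close>, whose coordinates are real numbers
  like any others, and it moves the measured values \<open>v\<close> in a way that can be read off from \<open>p\<close>
  and from \<open>q\<close>.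

  The framework \<open>(G, p)\<close> is infinitesimally rigid: a motion that fixes \<open>v\<close> is trivial on \<open>p\<close>.
  Place \<open>q\<close> by an isometry so that a triangular array of its coordinates vanishes, as many as the
  dimension of the isometry group, and let only those \<open>\<delta>\<close> act that leave the corresponding
  coordinates of \<open>p\<close> at rest.  The passage from the velocity of \<open>p\<close> to the velocity of \<open>q\<close> is
  then an injective linear endomorphism of a finite-dimensional space, hence surjective: \<open>q\<close> can be
  moved arbitrarily up to congruence (\<open>freedom_transfers\<close>).  So any \<open>d + 1\<close> points of \<open>q\<close> are
  affinely independent, and a linear relation between the derivatives of edge lengths of \<open>q\<close>
  that all \<open>\<delta>\<close> respect is an equilibrium stress at every vertex of \<open>q\<close>.

  Now let a bijection carry the edges of a simplex on \<open>d + 2\<close> vertices of \<open>p\<close> to edges of \<open>q\<close>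
  with the same lengths.  With \<open>l\<close> the affine relation of the \<open>d + 2\<close> points, the products
  \<open>l i * l j\<close> form a stress of the simplex, which therefore is also a stress of its image.  A vertex
  of the image has at least \<open>d + 1\<close> edges, because fewer edge vectors are linearly independent;
  counting edges, the image is again a complete graph on \<open>d + 2\<close> vertices (\<open>simplex_image\<close>).
  There the stress has the same product form, so that the product of its values over two opposite
  edges of a quadrangle is the same for each pair of opposite edges.  In \<open>p\<close> such an identity
  between monomials in the \<open>l i\<close> can only hold formally, hence disjoint edges come from disjoint
  edges, and the edges at a vertex go to the edges at a vertex, or for \<open>d = 2\<close> possibly to a
  triangle.  The latter would mean that the reciprocals of the \<open>l i\<close> sum to zero, which fails for
  generic points.  So the edge map is induced by a vertex map (\<open>simplex_vertex_map\<close>).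

  Finally the vertices are placed one at a time.  A new vertex forms with the \<open>d + 1\<close> vertices to
  which it is attached a simplex all of whose lengths are known, and the vertex map of that simplex
  agrees with the earlier one because \<open>d + 1 \<ge> 3\<close>; distances to \<open>d + 1\<close> affinely independent
  points determine where the new point lies.
\<close>

section \<open>Evaluation of rational polynomials\<close>

definition monomial_value :: "('v \<Rightarrow> real) \<Rightarrow> ('v \<Rightarrow>\<^sub>0 nat) \<Rightarrow> real" where
  "monomial_value x m = (\<Prod>v \<in> Poly_Mapping.keys m. x v ^ Poly_Mapping.lookup m v)"

lemma monomial_value_superset:
  assumes "finite K" "Poly_Mapping.keys m \<subseteq> K"
  shows "monomial_value x m = (\<Prod>v \<in> K. x v ^ Poly_Mapping.lookup m v)"
  unfolding monomial_value_def
  by (rule prod.mono_neutral_left) (use assms in \<open>auto simp: in_keys_iff\<close>)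

lemma monomial_value_add: "monomial_value x (m + m') = monomial_value x m * monomial_value x m'"
proof -
  let ?K = "Poly_Mapping.keys m \<union> Poly_Mapping.keys m'"
  have "Poly_Mapping.keys (m + m') \<subseteq> ?K"
    by (auto simp: in_keys_iff lookup_add)
  then show ?thesis
    by (simp add: monomial_value_superset[of ?K] lookup_add power_add prod.distrib)
qed

lemma mpoly_value_superset:
  assumes "finite K" "Poly_Mapping.keys P \<subseteq> K"
  shows "mpoly_value x P = (\<Sum>m \<in> K. of_rat (Poly_Mapping.lookup P m) * monomial_value x m)"
  unfolding mpoly_value_def monomial_value_def
  by (rule sum.mono_neutral_left) (use assms in \<open>auto simp: in_keys_iff\<close>)

lemma mpoly_value_zero [simp]: "mpoly_value x 0 = 0"
  by (simp add: mpoly_value_def)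

lemma mpoly_value_add: "mpoly_value x (P + Q) = mpoly_value x P + mpoly_value x Q"
proof -
  let ?K = "Poly_Mapping.keys P \<union> Poly_Mapping.keys Q"
  have "Poly_Mapping.keys (P + Q) \<subseteq> ?K"
    by (auto simp: in_keys_iff lookup_add)
  then show ?thesis
    by (simp add: mpoly_value_superset[of ?K] lookup_add of_rat_add distrib_right sum.distrib)
qed

lemma mpoly_value_uminus: "mpoly_value x (- P) = - mpoly_value x P"
  using mpoly_value_add[of x P "- P"] by simp

lemma mpoly_value_single: "mpoly_value x (Poly_Mapping.single m c) = of_rat c * monomial_value x m"
  by (subst mpoly_value_superset[of "{m}"]) auto

lemma mpoly_value_sum: "finite A \<Longrightarrow> mpoly_value x (\<Sum>a\<in>A. f a) = (\<Sum>a\<in>A. mpoly_value x (f a))"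
  by (induction A rule: finite_induct) (auto simp: mpoly_value_add)

lemma poly_mapping_eq_sum_singles:
  "P = (\<Sum>m \<in> Poly_Mapping.keys P. Poly_Mapping.single m (Poly_Mapping.lookup P m))"
  by (rule poly_mapping_eqI)
     (auto simp: lookup_sum lookup_single when_def in_keys_iff)

lemma mpoly_value_mult: "mpoly_value x (P * Q) = mpoly_value x P * mpoly_value x Q"
proof -
  let ?s = "\<lambda>P m. Poly_Mapping.single m (Poly_Mapping.lookup P m)"
  have "P * Q = (\<Sum>m \<in> Poly_Mapping.keys P. ?s P m) * (\<Sum>m \<in> Poly_Mapping.keys Q. ?s Q m)"
    using poly_mapping_eq_sum_singles[of P] poly_mapping_eq_sum_singles[of Q] by metis
  also have "\<dots> = (\<Sum>m \<in> Poly_Mapping.keys P. \<Sum>m' \<in> Poly_Mapping.keys Q. ?s P m * ?s Q m')"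
    by (rule sum_product)
  finally have "mpoly_value x (P * Q) = (\<Sum>m \<in> Poly_Mapping.keys P. \<Sum>m' \<in> Poly_Mapping.keys Q.
      (of_rat (Poly_Mapping.lookup P m) * monomial_value x m)
       * (of_rat (Poly_Mapping.lookup Q m') * monomial_value x m'))"
    by (simp add: mpoly_value_sum mult_single mpoly_value_single monomial_value_add of_rat_mult mult_ac)
  also have "\<dots> = mpoly_value x P * mpoly_value x Q"
    by (simp add: mpoly_value_def monomial_value_def sum_product)
  finally show ?thesis .
qed

lemma mpoly_vars_add: "mpoly_vars (P + Q) \<subseteq> mpoly_vars P \<union> mpoly_vars Q"
  using keys_add[of P Q] by (auto simp: mpoly_vars_def)

lemma mpoly_vars_uminus: "mpoly_vars (- P) = mpoly_vars P"
  by (auto simp: mpoly_vars_def in_keys_iff)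

lemma mpoly_vars_mult: "mpoly_vars (P * Q) \<subseteq> mpoly_vars P \<union> mpoly_vars Q"
proof
  fix v assume "v \<in> mpoly_vars (P * Q)"
  then obtain m m' where "m \<in> Poly_Mapping.keys P" "m' \<in> Poly_Mapping.keys Q"
      "v \<in> Poly_Mapping.keys (m + m')"
    using keys_mult[of P Q] by (fastforce simp: mpoly_vars_def)
  then show "v \<in> mpoly_vars P \<union> mpoly_vars Q"
    using keys_add[of m m'] by (auto simp: mpoly_vars_def)
qed

section \<open>Derivations of the real field\<close>

definition derivation :: "(real \<Rightarrow> real) \<Rightarrow> bool" where
  "derivation \<delta> \<longleftrightarrow> (\<forall>x y. \<delta> (x + y) = \<delta> x + \<delta> y) \<and> (\<forall>x y. \<delta> (x * y) = x * \<delta> y + y * \<delta> x)"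

text \<open>
  A derivation on a subring of \<open>\<real>\<close> is encoded by its graph \<open>\<Gamma>\<close>, with \<open>(x, a)\<close> standing for the dual
  number \<open>x + a \<epsilon>\<close>, where \<open>\<epsilon>\<^sup>2 = 0\<close>: additivity and the Leibniz rule say that \<open>\<Gamma>\<close> is a subring of
  the dual numbers, and the last clause says that it is the graph of a function.  Graphs are ordered
  by inclusion, which suits Zorn's lemma.
\<close>

definition dual_subring :: "(real \<times> real) set \<Rightarrow> bool" where
  "dual_subring \<Gamma> \<longleftrightarrow>
     (1, 0) \<in> \<Gamma> \<and>
     (\<forall>x a. (x, a) \<in> \<Gamma> \<longrightarrow> (- x, - a) \<in> \<Gamma>) \<and>
     (\<forall>x a y b. (x, a) \<in> \<Gamma> \<and> (y, b) \<in> \<Gamma> \<longrightarrow> (x + y, a + b) \<in> \<Gamma> \<and> (x * y, x * b + y * a) \<in> \<Gamma>) \<and>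
     (\<forall>b. (0, b) \<in> \<Gamma> \<longrightarrow> b = 0)"

lemma dual_subringD:
  assumes "dual_subring \<Gamma>"
  shows dual_one: "(1, 0) \<in> \<Gamma>"
    and dual_uminus: "(x, a) \<in> \<Gamma> \<Longrightarrow> (- x, - a) \<in> \<Gamma>"
    and dual_add: "(x, a) \<in> \<Gamma> \<Longrightarrow> (y, b) \<in> \<Gamma> \<Longrightarrow> (x + y, a + b) \<in> \<Gamma>"
    and dual_mult: "(x, a) \<in> \<Gamma> \<Longrightarrow> (y, b) \<in> \<Gamma> \<Longrightarrow> (x * y, x * b + y * a) \<in> \<Gamma>"
    and dual_zero_unique: "(0, b) \<in> \<Gamma> \<Longrightarrow> b = 0"
  using assms unfolding dual_subring_def by blast+

lemma dual_zero: "dual_subring \<Gamma> \<Longrightarrow> (0, 0) \<in> \<Gamma>"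
  using dual_add[of \<Gamma> 1 0 "-1" 0] dual_uminus[of \<Gamma> 1 0] dual_one[of \<Gamma>] by simp

lemma dual_diff:
  "dual_subring \<Gamma> \<Longrightarrow> (x, a) \<in> \<Gamma> \<Longrightarrow> (y, b) \<in> \<Gamma> \<Longrightarrow> (x - y, a - b) \<in> \<Gamma>"
  using dual_add[of \<Gamma> x a "-y" "-b"] dual_uminus[of \<Gamma> y b] by simp

lemma dual_unique: "dual_subring \<Gamma> \<Longrightarrow> (x, a) \<in> \<Gamma> \<Longrightarrow> (x, b) \<in> \<Gamma> \<Longrightarrow> a = b"
  using dual_diff[of \<Gamma> x a x b] dual_zero_unique[of \<Gamma> "a - b"] by simp

lemma dual_sum:
  assumes "dual_subring \<Gamma>" "\<And>i. i \<in> A \<Longrightarrow> (f i, g i) \<in> \<Gamma>"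
  shows "(sum f A, sum g A) \<in> \<Gamma>"
  using assms(2)
  by (induction A rule: infinite_finite_induct)
     (auto intro: dual_zero[OF assms(1)] dual_add[OF assms(1)])

lemma dual_of_nat_mult:
  assumes "dual_subring \<Gamma>" "(x, a) \<in> \<Gamma>"
  shows "(of_nat k * x, of_nat k * a) \<in> \<Gamma>"
proof (induction k)
  case 0
  show ?case using dual_zero[OF assms(1)] by simp
next
  case (Suc k)
  show ?case using dual_add[OF assms(1) Suc assms(2)] by (simp add: algebra_simps)
qed

text \<open>
  A polynomial over the subring, together with the polynomial of the derivatives of its coefficients.
\<close>

definition dual_polys :: "(real \<times> real) set \<Rightarrow> (real poly \<times> real poly) set" where
  "dual_polys \<Gamma> = {(P, Q). \<forall>i. (coeff P i, coeff Q i) \<in> \<Gamma>}"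

lemma dual_polys_mult:
  assumes "dual_subring \<Gamma>" "(P, Q) \<in> dual_polys \<Gamma>" "(P', Q') \<in> dual_polys \<Gamma>"
  shows "(P * P', P * Q' + P' * Q) \<in> dual_polys \<Gamma>"
proof -
  have "(coeff (P * P') i, coeff (P * Q' + P' * Q) i) \<in> \<Gamma>" for i
  proof -
    have *: "(\<Sum>j\<le>i. coeff P j * coeff P' (i - j),
           \<Sum>j\<le>i. coeff P j * coeff Q' (i - j) + coeff P' (i - j) * coeff Q j) \<in> \<Gamma>"
      by (rule dual_sum[OF assms(1)], rule dual_mult[OF assms(1)])
         (use assms(2,3) in \<open>auto simp: dual_polys_def\<close>)
    have "coeff (P * Q' + P' * Q) i = coeff (P * Q' + Q * P') i"
      by (simp add: mult.commute)
    also have "\<dots> = (\<Sum>j\<le>i. coeff P j * coeff Q' (i - j) + coeff P' (i - j) * coeff Q j)"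
      unfolding coeff_add coeff_mult sum.distrib by (simp add: mult.commute)
    finally show ?thesis using * by (simp add: coeff_mult)
  qed
  then show ?thesis by (simp add: dual_polys_def)
qed

lemma dual_polys_diff:
  assumes "dual_subring \<Gamma>" "(P, Q) \<in> dual_polys \<Gamma>" "(P', Q') \<in> dual_polys \<Gamma>"
  shows "(P - P', Q - Q') \<in> dual_polys \<Gamma>"
  using assms dual_diff[OF assms(1)] by (auto simp: dual_polys_def)

lemma dual_polys_add:
  assumes "dual_subring \<Gamma>" "(P, Q) \<in> dual_polys \<Gamma>" "(P', Q') \<in> dual_polys \<Gamma>"
  shows "(P + P', Q + Q') \<in> dual_polys \<Gamma>"
  using assms dual_add[OF assms(1)] by (auto simp: dual_polys_def)

lemma dual_polys_monom:
  assumes "dual_subring \<Gamma>" "(x, a) \<in> \<Gamma>"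
  shows "(monom x k, monom a k) \<in> dual_polys \<Gamma>"
  using assms dual_zero[OF assms(1)] by (auto simp: dual_polys_def)

lemma dual_polys_pderiv:
  assumes "dual_subring \<Gamma>" "(P, Q) \<in> dual_polys \<Gamma>"
  shows "(pderiv P, pderiv Q) \<in> dual_polys \<Gamma>"
proof -
  have "(of_nat (Suc i) * coeff P (Suc i), of_nat (Suc i) * coeff Q (Suc i)) \<in> \<Gamma>" for i
    by (rule dual_of_nat_mult[OF assms(1)]) (use assms(2) in \<open>auto simp: dual_polys_def\<close>)
  then show ?thesis by (simp add: dual_polys_def coeff_pderiv)
qed

lemma dual_polys_zero_unique:
  assumes "dual_subring \<Gamma>" "(0, Q) \<in> dual_polys \<Gamma>"
  shows "Q = 0"
  using assms dual_zero_unique[OF assms(1)] by (auto simp: dual_polys_def poly_eq_iff)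

text \<open>
  The derivative that the value of \<open>P\<close> at \<open>x\<close> must have if \<open>Q\<close> collects the derivatives of the
  coefficients of \<open>P\<close> and \<open>x\<close> is given the derivative \<open>u\<close>.
\<close>

definition dual_value :: "real \<Rightarrow> real \<Rightarrow> real poly \<Rightarrow> real poly \<Rightarrow> real" where
  "dual_value x u P Q = poly Q x + u * poly (pderiv P) x"

lemma dual_value_mult:
  "dual_value x u (P * P') (P * Q' + P' * Q)
     = poly P x * dual_value x u P' Q' + poly P' x * dual_value x u P Q"
  by (simp add: dual_value_def pderiv_mult algebra_simps)

lemma dual_value_diff:
  "dual_value x u (P - P') (Q - Q') = dual_value x u P Q - dual_value x u P' Q'"
  by (simp add: dual_value_def pderiv_diff algebra_simps)

lemma dual_value_add:
  "dual_value x u (P + P') (Q + Q') = dual_value x u P Q + dual_value x u P' Q'"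
  by (simp add: dual_value_def pderiv_add algebra_simps)

text \<open>
  A derivation extends to one more element \<open>x\<close> provided its value \<open>u\<close> there is compatible with every
  polynomial equation that \<open>x\<close> satisfies over the subring.  If there is none, any \<open>u\<close> will do.
  Otherwise an equation \<open>P\<close> of minimal degree determines \<open>u\<close>, since \<open>x\<close> is a simple root of \<open>P\<close> in
  characteristic zero, and every other equation is compatible because some constant multiple of it is
  a multiple of \<open>P\<close>.
\<close>

lemma dual_extension_slope:
  assumes \<Gamma>: "dual_subring \<Gamma>"
  shows "\<exists>u. \<forall>(P, Q) \<in> dual_polys \<Gamma>. poly P x = 0 \<longrightarrow> dual_value x u P Q = 0"
proof (cases "\<exists>P Q. (P, Q) \<in> dual_polys \<Gamma> \<and> P \<noteq> 0 \<and> poly P x = 0")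
  case False
  then show ?thesis
    using dual_polys_zero_unique[OF \<Gamma>] by (intro exI[of _ 0]) (auto simp: dual_value_def)
next
  case True
  define good where "good = (\<lambda>(P, Q). (P, Q) \<in> dual_polys \<Gamma> \<and> P \<noteq> 0 \<and> poly P x = 0)"
  obtain PQ0 where "good PQ0" using True by (auto simp: good_def)
  from ex_has_least_nat[of good, OF this, of "\<lambda>PQ. degree (fst PQ)"]
  obtain P Q where "good (P, Q)"
    and least: "\<And>P' Q'. good (P', Q') \<Longrightarrow> degree P \<le> degree P'"
    by force
  then have PQ: "(P, Q) \<in> dual_polys \<Gamma>" "P \<noteq> 0" "poly P x = 0"
    by (auto simp: good_def)
  have deg: "degree P \<noteq> 0"
  proof
    assume "degree P = 0"
    then obtain c where "P = [:c:]" by (rule degree_eq_zeroE)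
    with PQ(2,3) show False by simp
  qed
  have "pderiv P \<noteq> 0" using deg by (simp add: pderiv_eq_0_iff)
  moreover have "degree (pderiv P) < degree P" using deg by (simp add: degree_pderiv)
  ultimately have nz: "poly (pderiv P) x \<noteq> 0"
    using least[of "pderiv P" "pderiv Q"] dual_polys_pderiv[OF \<Gamma> PQ(1)] by (auto simp: good_def)
  define u where "u = - poly Q x / poly (pderiv P) x"
  have u: "dual_value x u P Q = 0" using nz by (simp add: dual_value_def u_def)
  have "dual_value x u P1 Q1 = 0" if "(P1, Q1) \<in> dual_polys \<Gamma>" "poly P1 x = 0" for P1 Q1
    using that
  proof (induction "degree P1" arbitrary: P1 Q1 rule: less_induct)
    case less
    show ?case
    proof (cases "P1 = 0")
      case True
      then show ?thesis using dual_polys_zero_unique[OF \<Gamma>, of Q1] less.prems by (auto simp: dual_value_def)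
    next
      case False
      then have le: "degree P \<le> degree P1" using least[of P1 Q1] less.prems by (auto simp: good_def)
      define k where "k = degree P1 - degree P"
      \<comment> \<open>One step of pseudo-division of \<open>P1\<close> by \<open>P\<close>, performed on both components.\<close>
      define C C' where "C = monom (lead_coeff P) 0" and "C' = monom (coeff Q (degree P)) 0"
      define M M' where "M = monom (lead_coeff P1) k" and "M' = monom (coeff Q1 (degree P1)) k"
      have C: "(C, C') \<in> dual_polys \<Gamma>"
        unfolding C_def C'_def
        by (rule dual_polys_monom[OF \<Gamma>]) (use PQ(1) in \<open>auto simp: dual_polys_def\<close>)
      have M: "(M, M') \<in> dual_polys \<Gamma>"
        unfolding M_def M'_def
        by (rule dual_polys_monom[OF \<Gamma>]) (use less.prems in \<open>auto simp: dual_polys_def\<close>)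
      let ?P = "C * P1 - M * P" and ?Q = "(C * Q1 + P1 * C') - (M * Q + P * M')"
      have mem: "(?P, ?Q) \<in> dual_polys \<Gamma>"
        by (intro dual_polys_diff dual_polys_mult \<Gamma> C M PQ less.prems)
      have root: "poly ?P x = 0" using PQ less.prems by simp
      have "?P = 0 \<or> degree ?P < degree P1"
      proof -
        have "degree ?P \<le> degree P1"
        proof (rule degree_diff_le)
          show "degree (C * P1) \<le> degree P1"
            using degree_mult_le[of C P1] by (simp add: C_def degree_monom_eq PQ)
          have "degree M \<le> k" by (simp add: M_def degree_monom_le)
          then show "degree (M * P) \<le> degree P1"
            using degree_mult_le[of M P] le by (simp add: k_def)
        qed
        moreover have "coeff ?P (degree P1) = 0"
          using le by (simp add: C_def M_def coeff_monom_mult k_def)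
        ultimately show ?thesis
          by (metis eq_zero_or_degree_less)
      qed
      then have "dual_value x u ?P ?Q = 0"
        using less.hyps[OF _ mem root] dual_polys_zero_unique[OF \<Gamma>] mem
        by (metis (no_types, lifting) dual_value_def mult_zero_right add_0 pderiv_0 poly_0)
      then have "poly C x * dual_value x u P1 Q1 = 0"
        unfolding dual_value_diff dual_value_mult using u PQ less.prems by simp
      then show ?thesis using PQ by (simp add: C_def poly_monom)
    qed
  qed
  then show ?thesis by auto
qed

lemma dual_subring_extend:
  assumes \<Gamma>: "dual_subring \<Gamma>"
  shows "\<exists>\<Gamma>' u. dual_subring \<Gamma>' \<and> \<Gamma> \<subseteq> \<Gamma>' \<and> (x, u) \<in> \<Gamma>'"
proof -
  obtain u where u: "\<And>P Q. (P, Q) \<in> dual_polys \<Gamma> \<Longrightarrow> poly P x = 0 \<Longrightarrow> dual_value x u P Q = 0"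
    using dual_extension_slope[OF \<Gamma>, of x] by fast
  define \<Gamma>' where "\<Gamma>' = {(poly P x, dual_value x u P Q) | P Q. (P, Q) \<in> dual_polys \<Gamma>}"
  have \<Gamma>'I: "(y, b) \<in> \<Gamma>'" if "(P, Q) \<in> dual_polys \<Gamma>" "y = poly P x" "b = dual_value x u P Q" for y b P Q
    using that by (auto simp: \<Gamma>'_def)
  have const: "(y, b) \<in> \<Gamma>'" if "(y, b) \<in> \<Gamma>" for y b
    by (rule \<Gamma>'I[OF dual_polys_monom[OF \<Gamma> that, of 0]])
       (auto simp: dual_value_def poly_monom pderiv_monom)
  have "dual_subring \<Gamma>'"
    unfolding dual_subring_def
  proof (intro conjI allI impI)
    show "(1, 0) \<in> \<Gamma>'" using const dual_one[OF \<Gamma>] by blast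
  next
    fix y b assume "(y, b) \<in> \<Gamma>'"
    then obtain P Q where PQ: "(P, Q) \<in> dual_polys \<Gamma>" "y = poly P x" "b = dual_value x u P Q"
      by (auto simp: \<Gamma>'_def)
    have zero: "(0, 0) \<in> dual_polys \<Gamma>" using dual_zero[OF \<Gamma>] by (simp add: dual_polys_def)
    show "(- y, - b) \<in> \<Gamma>'"
      by (rule \<Gamma>'I[OF dual_polys_diff[OF \<Gamma> zero PQ(1)]])
         (use PQ in \<open>auto simp: dual_value_def pderiv_minus\<close>)
  next
    fix y b z c assume "(y, b) \<in> \<Gamma>' \<and> (z, c) \<in> \<Gamma>'"
    then obtain P Q P' Q' where PQ: "(P, Q) \<in> dual_polys \<Gamma>" "y = poly P x" "b = dual_value x u P Q"
       and PQ': "(P', Q') \<in> dual_polys \<Gamma>" "z = poly P' x" "c = dual_value x u P' Q'"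
      by (auto simp: \<Gamma>'_def)
    show "(y + z, b + c) \<in> \<Gamma>'"
      by (rule \<Gamma>'I[OF dual_polys_add[OF \<Gamma> PQ(1) PQ'(1)]]) (use PQ PQ' in \<open>auto simp: dual_value_add\<close>)
    show "(y * z, y * c + z * b) \<in> \<Gamma>'"
      by (rule \<Gamma>'I[OF dual_polys_mult[OF \<Gamma> PQ(1) PQ'(1)]]) (use PQ PQ' in \<open>auto simp: dual_value_mult\<close>)
  next
    fix b assume "(0, b) \<in> \<Gamma>'"
    then obtain P Q where PQ: "(P, Q) \<in> dual_polys \<Gamma>" "0 = poly P x" "b = dual_value x u P Q"
      by (auto simp: \<Gamma>'_def)
    then show "b = 0" using u by auto
  qed
  moreover have "\<Gamma> \<subseteq> \<Gamma>'" using const by auto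
  moreover have "(x, u) \<in> \<Gamma>'"
    by (rule \<Gamma>'I[OF dual_polys_monom[OF \<Gamma> dual_one[OF \<Gamma>], of 1]])
       (auto simp: dual_value_def poly_monom pderiv_monom)
  ultimately show ?thesis by blast
qed

text \<open>
  A maximal graph is defined on all of \<open>\<real>\<close>, because any element outside its domain could be adjoined.
\<close>

theorem derivation_extending:
  assumes "dual_subring \<Gamma>"
  shows "\<exists>\<delta>. derivation \<delta> \<and> (\<forall>(x, a) \<in> \<Gamma>. \<delta> x = a)"
proof -
  let ?A = "{\<Delta>. dual_subring \<Delta> \<and> \<Gamma> \<subseteq> \<Delta>}"
  have "\<exists>M\<in>?A. \<forall>X\<in>?A. M \<subseteq> X \<longrightarrow> X = M"
  proof (rule subset_Zorn_nonempty)
    show "?A \<noteq> {}" using assms by blast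
  next
    fix \<C> assume ne: "\<C> \<noteq> {}" and ch: "subset.chain ?A \<C>"
    have mem: "dual_subring X \<and> \<Gamma> \<subseteq> X" if "X \<in> \<C>" for X
      using ch that by (auto simp: subset.chain_def)
    have two: "\<exists>X\<in>\<C>. z \<in> X \<and> z' \<in> X" if "z \<in> \<Union>\<C>" "z' \<in> \<Union>\<C>" for z z'
      using ch that unfolding subset.chain_def by blast
    have "dual_subring (\<Union>\<C>)"
      unfolding dual_subring_def
    proof (intro conjI allI impI)
      show "(1, 0) \<in> \<Union>\<C>" using ne mem dual_one by blast
    next
      fix x a assume "(x, a) \<in> \<Union>\<C>"
      then show "(- x, - a) \<in> \<Union>\<C>" using mem dual_uminus by blast
    next
      fix x a y b assume "(x, a) \<in> \<Union>\<C> \<and> (y, b) \<in> \<Union>\<C>"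
      then obtain X where "X \<in> \<C>" "(x, a) \<in> X" "(y, b) \<in> X" using two by blast
      then show "(x + y, a + b) \<in> \<Union>\<C>" "(x * y, x * b + y * a) \<in> \<Union>\<C>"
        using mem dual_add dual_mult by blast+
    next
      fix b assume "(0, b) \<in> \<Union>\<C>"
      then show "b = 0" using mem dual_zero_unique by blast
    qed
    then show "\<Union>\<C> \<in> ?A" using ne mem by blast
  qed
  then obtain M where M: "dual_subring M" "\<Gamma> \<subseteq> M"
      and max: "\<And>X. dual_subring X \<Longrightarrow> M \<subseteq> X \<Longrightarrow> X = M"
    by (smt (verit, ccfv_SIG) mem_Collect_eq subset_trans)
  have "\<exists>a. (x, a) \<in> M" for x
    using dual_subring_extend[OF M(1), of x] max by blast
  then obtain \<delta> where \<delta>: "\<And>x. (x, \<delta> x) \<in> M" by metis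
  have eq: "\<delta> x = a" if "(x, a) \<in> M" for x a
    using dual_unique[OF M(1) \<delta> that] .
  have "derivation \<delta>"
    unfolding derivation_def
    using eq dual_add[OF M(1) \<delta> \<delta>] dual_mult[OF M(1) \<delta> \<delta>] by blast
  then show ?thesis using eq M(2) by auto
qed

text \<open>
  The only form in which genericity enters the geometry.
\<close>

definition freely_movable :: "nat \<Rightarrow> 'd::finite configuration \<Rightarrow> bool" where
  "freely_movable n p \<longleftrightarrow>
     (\<forall>w. \<exists>\<delta>. derivation \<delta> \<and> (\<forall>i\<in>{1..n}. \<forall>c. \<delta> (p i $ c) = w i $ c))"

text \<open>
  On the ring generated by the coordinates the derivation is differentiation along the line
  \<open>t \<mapsto> p + t w\<close> at \<open>t = 0\<close>.  It is well defined since, by genericity, only the zero polynomial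
  vanishes at \<open>p\<close>.
\<close>

theorem generic_imp_freely_movable:
  fixes p :: "'d::finite configuration"
  assumes "generic n p"
  shows "freely_movable n p"
  unfolding freely_movable_def
proof
  fix w :: "'d configuration"
  define X where "X = (\<lambda>t (i, c). p i $ c + t * w i $ c)"
  let ?V = "{1..n} \<times> (UNIV :: 'd set)"
  define \<Gamma> where "\<Gamma> = {(mpoly_value (X 0) P, b) | P b. mpoly_vars P \<subseteq> ?V \<and>
      ((\<lambda>t. mpoly_value (X t) P) has_real_derivative b) (at 0)}"
  have X0: "X 0 = (\<lambda>(i, c). p i $ c)" by (auto simp: X_def)
  have \<Gamma>I: "(y, b) \<in> \<Gamma>" if "mpoly_vars P \<subseteq> ?V" "y = mpoly_value (X 0) P"
      "((\<lambda>t. mpoly_value (X t) P) has_real_derivative b) (at 0)" for y b P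
    using that by (auto simp: \<Gamma>_def)
  have "dual_subring \<Gamma>"
    unfolding dual_subring_def
  proof (intro conjI allI impI)
    have one: "mpoly_value (X t) 1 = 1" for t
      using mpoly_value_single[of "X t" 0 1] by (simp add: monomial_value_def)
    show "(1, 0) \<in> \<Gamma>"
      by (rule \<Gamma>I[of 1]) (auto simp: one mpoly_vars_def)
  next
    fix y b assume "(y, b) \<in> \<Gamma>"
    then obtain P where P: "mpoly_vars P \<subseteq> ?V" "y = mpoly_value (X 0) P"
        "((\<lambda>t. mpoly_value (X t) P) has_real_derivative b) (at 0)"
      by (auto simp: \<Gamma>_def)
    show "(- y, - b) \<in> \<Gamma>"
      by (rule \<Gamma>I[of "- P"])
         (use P in \<open>auto simp: mpoly_vars_uminus mpoly_value_uminus intro!: DERIV_minus\<close>)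
  next
    fix y b z c assume "(y, b) \<in> \<Gamma> \<and> (z, c) \<in> \<Gamma>"
    then obtain P Q where P: "mpoly_vars P \<subseteq> ?V" "y = mpoly_value (X 0) P"
        "((\<lambda>t. mpoly_value (X t) P) has_real_derivative b) (at 0)"
      and Q: "mpoly_vars Q \<subseteq> ?V" "z = mpoly_value (X 0) Q"
        "((\<lambda>t. mpoly_value (X t) Q) has_real_derivative c) (at 0)"
      by (auto simp: \<Gamma>_def)
    show "(y + z, b + c) \<in> \<Gamma>"
      by (rule \<Gamma>I[of "P + Q"])
         (use P Q mpoly_vars_add[of P Q] in \<open>auto simp: mpoly_value_add intro!: DERIV_add\<close>)
    show "(y * z, y * c + z * b) \<in> \<Gamma>"
      by (rule \<Gamma>I[of "P * Q"])
         (use P Q mpoly_vars_mult[of P Q] DERIV_mult[OF P(3) Q(3)] in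
           \<open>auto simp: mpoly_value_mult algebra_simps\<close>)
  next
    fix b assume "(0, b) \<in> \<Gamma>"
    then obtain P where P: "mpoly_vars P \<subseteq> ?V" "0 = mpoly_value (X 0) P"
        "((\<lambda>t. mpoly_value (X t) P) has_real_derivative b) (at 0)"
      by (auto simp: \<Gamma>_def)
    then have "P = 0" using assms by (auto simp: generic_def X0)
    then show "b = 0" using P(3) by (auto intro: DERIV_unique)
  qed
  from derivation_extending[OF this] obtain \<delta> where \<delta>: "derivation \<delta>" "\<And>x a. (x, a) \<in> \<Gamma> \<Longrightarrow> \<delta> x = a"
    by fast
  have "\<delta> (p i $ c) = w i $ c" if i: "i \<in> {1..n}" for i c
  proof (rule \<delta>(2), rule \<Gamma>I)
    let ?P = "Poly_Mapping.single (Poly_Mapping.single (i, c) 1) 1 :: (nat \<times> 'd) rat_mpoly"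
    show "mpoly_vars ?P \<subseteq> ?V" using i by (auto simp: mpoly_vars_def)
    have val: "mpoly_value (X t) ?P = p i $ c + t * w i $ c" for t
      by (simp add: mpoly_value_single monomial_value_def X_def)
    show "p i $ c = mpoly_value (X 0) ?P" by (subst val) simp
    show "((\<lambda>t. mpoly_value (X t) ?P) has_real_derivative w i $ c) (at 0)"
      unfolding val by (auto intro!: derivative_eq_intros)
  qed
  then show "\<exists>\<delta>. derivation \<delta> \<and> (\<forall>i\<in>{1..n}. \<forall>c. \<delta> (p i $ c) = w i $ c)"
    using \<delta>(1) by blast
qed

section \<open>Underdetermined linear systems\<close>

lemma underdetermined_system:
  fixes a :: "'e \<Rightarrow> 'v \<Rightarrow> real"
  assumes "finite E" "finite V" "card E < card V"
  shows "\<exists>x. (\<exists>v\<in>V. x v \<noteq> 0) \<and> (\<forall>e\<in>E. (\<Sum>v\<in>V. a e v * x v) = 0)"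
  using assms
proof (induction E arbitrary: V a rule: finite_induct)
  case empty
  then show ?case by (intro exI[of _ "\<lambda>_. 1"]) (auto simp: card_gt_0_iff)
next
  case (insert e0 E)
  show ?case
  proof (cases "\<exists>v\<in>V. a e0 v \<noteq> 0")
    case False
    from insert have "card E < card V" by simp
    from insert.IH[OF insert.prems(1) this, of a] False show ?thesis by auto
  next
    case True
    then obtain v0 where v0: "v0 \<in> V" "a e0 v0 \<noteq> 0" by blast
    \<comment> \<open>Eliminate the unknown \<open>v0\<close> with the equation \<open>e0\<close>.\<close>
    define b where "b = (\<lambda>e v. a e v - a e v0 * a e0 v / a e0 v0)"
    have "card E < card (V - {v0})" using insert v0 by simp
    from insert.IH[OF _ this, of b] insert.prems obtain x
      where x: "\<exists>v\<in>V - {v0}. x v \<noteq> 0" "\<forall>e\<in>E. (\<Sum>v\<in>V - {v0}. b e v * x v) = 0" by auto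
    define s where "s = (\<Sum>v\<in>V - {v0}. a e0 v * x v)"
    define y where "y = x(v0 := - s / a e0 v0)"
    have split: "(\<Sum>v\<in>V. a e v * y v) = (\<Sum>v\<in>V - {v0}. a e v * x v) - a e v0 * s / a e0 v0" for e
    proof -
      have "(\<Sum>v\<in>V. a e v * y v) = a e v0 * y v0 + (\<Sum>v\<in>V - {v0}. a e v * y v)"
        using v0 insert.prems by (simp add: sum.remove)
      also have "(\<Sum>v\<in>V - {v0}. a e v * y v) = (\<Sum>v\<in>V - {v0}. a e v * x v)"
        by (rule sum.cong) (auto simp: y_def)
      finally show ?thesis by (simp add: y_def)
    qed
    have "(\<Sum>v\<in>V. a e v * y v) = 0" if "e \<in> E" for e
    proof -
      have "0 = (\<Sum>v\<in>V - {v0}. b e v * x v)" using x(2) that by auto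
      also have "\<dots> = (\<Sum>v\<in>V - {v0}. a e v * x v - (a e v0 / a e0 v0) * (a e0 v * x v))"
        by (rule sum.cong) (auto simp: b_def algebra_simps)
      also have "\<dots> = (\<Sum>v\<in>V - {v0}. a e v * x v) - (a e v0 / a e0 v0) * s"
        by (simp add: sum_subtractf s_def sum_distrib_left)
      finally show ?thesis by (simp add: split)
    qed
    moreover have "(\<Sum>v\<in>V. a e0 v * y v) = 0"
      using v0 by (simp add: split s_def)
    moreover have "\<exists>v\<in>V. y v \<noteq> 0" using x(1) by (auto simp: y_def)
    ultimately show ?thesis by blast
  qed
qed

lemma square_system_surj:
  fixes a :: "'v \<Rightarrow> 'v \<Rightarrow> real"
  assumes "finite V"
    and inj: "\<And>x. (\<forall>e\<in>V. (\<Sum>v\<in>V. a e v * x v) = 0) \<Longrightarrow> (\<forall>v\<in>V. x v = 0)"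
  shows "\<exists>x. \<forall>e\<in>V. (\<Sum>v\<in>V. a e v * x v) = y e"
proof -
  \<comment> \<open>The right-hand side is a further column, with unknown \<open>None\<close>.\<close>
  define a' where "a' = (\<lambda>e v. case v of None \<Rightarrow> - y e | Some v \<Rightarrow> a e v)"
  let ?V = "insert None (Some ` V)"
  have card: "card V < card ?V"
    using assms(1) by (simp add: card_image)
  have fin: "finite ?V" using assms(1) by simp
  obtain x where x: "\<exists>v\<in>?V. x v \<noteq> 0" "\<forall>e\<in>V. (\<Sum>v\<in>?V. a' e v * x v) = 0"
    using underdetermined_system[OF assms(1) fin card, of a'] by blast
  have eq: "(\<Sum>v\<in>V. a e v * x (Some v)) = y e * x None" if "e \<in> V" for e
    using x(2) that assms(1) by (simp add: a'_def sum.reindex)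
  have "x None \<noteq> 0"
  proof
    assume "x None = 0"
    then have "\<forall>v\<in>V. x (Some v) = 0" using inj[of "\<lambda>v. x (Some v)"] eq by simp
    then show False using x(1) \<open>x None = 0\<close> by auto
  qed
  then have "\<forall>e\<in>V. (\<Sum>v\<in>V. a e v * (x (Some v) / x None)) = y e"
    using eq by (simp add: sum_divide_distrib[symmetric])
  then show ?thesis by (rule exI[of _ "\<lambda>v. x (Some v) / x None"])
qed

section \<open>Derivations acting on vectors\<close>

lemma derivationD:
  assumes "derivation \<delta>"
  shows derivation_add: "\<delta> (x + y) = \<delta> x + \<delta> y"
    and derivation_mult: "\<delta> (x * y) = x * \<delta> y + y * \<delta> x"
  using assms by (auto simp: derivation_def)

lemma derivation_0: "derivation \<delta> \<Longrightarrow> \<delta> 0 = 0"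
  using derivation_add[of \<delta> 0 0] by simp

lemma derivation_1: "derivation \<delta> \<Longrightarrow> \<delta> 1 = 0"
  using derivation_mult[of \<delta> 1 1] by simp

lemma derivation_minus: "derivation \<delta> \<Longrightarrow> \<delta> (- x) = - \<delta> x"
  using derivation_add[of \<delta> x "-x"] derivation_0[of \<delta>] by simp

lemma derivation_diff: "derivation \<delta> \<Longrightarrow> \<delta> (x - y) = \<delta> x - \<delta> y"
  using derivation_add[of \<delta> x "-y"] derivation_minus[of \<delta> y] by simp

lemma derivation_sum: "derivation \<delta> \<Longrightarrow> \<delta> (sum f A) = (\<Sum>a\<in>A. \<delta> (f a))"
  by (induction A rule: infinite_finite_induct) (auto simp: derivation_0 derivation_add)

lemma derivation_linear_combination:
  assumes "\<And>j. j \<in> J \<Longrightarrow> derivation (D j)"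
  shows "derivation (\<lambda>r. \<Sum>j\<in>J. x j * D j r)"
  unfolding derivation_def
proof (intro conjI allI)
  fix r s
  show "(\<Sum>j\<in>J. x j * D j (r + s)) = (\<Sum>j\<in>J. x j * D j r) + (\<Sum>j\<in>J. x j * D j s)"
    unfolding sum.distrib[symmetric]
    by (rule sum.cong) (auto simp: derivation_add[OF assms] algebra_simps)
  show "(\<Sum>j\<in>J. x j * D j (r * s)) = r * (\<Sum>j\<in>J. x j * D j s) + s * (\<Sum>j\<in>J. x j * D j r)"
    unfolding sum.distrib[symmetric] sum_distrib_left
    by (rule sum.cong) (auto simp: derivation_mult[OF assms] algebra_simps)
qed

definition dvec :: "(real \<Rightarrow> real) \<Rightarrow> real ^ 'd \<Rightarrow> real ^ 'd::finite" where
  "dvec \<delta> x = (\<chi> c. \<delta> (x $ c))"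

lemma dvec_nth [simp]: "dvec \<delta> x $ c = \<delta> (x $ c)"
  by (simp add: dvec_def)

lemma dvec_0: "derivation \<delta> \<Longrightarrow> dvec \<delta> 0 = 0"
  by (simp add: vec_eq_iff derivation_0)

lemma dvec_diff: "derivation \<delta> \<Longrightarrow> dvec \<delta> (x - y) = dvec \<delta> x - dvec \<delta> y"
  by (simp add: vec_eq_iff derivation_diff)

lemma dvec_scaleR: "derivation \<delta> \<Longrightarrow> dvec \<delta> (c *\<^sub>R x) = c *\<^sub>R dvec \<delta> x + \<delta> c *\<^sub>R x"
  by (simp add: vec_eq_iff derivation_mult mult.commute)

lemma dvec_sum: "derivation \<delta> \<Longrightarrow> dvec \<delta> (sum f A) = (\<Sum>a\<in>A. dvec \<delta> (f a))"
  by (simp add: vec_eq_iff derivation_sum sum_component)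

lemma derivation_inner: "derivation \<delta> \<Longrightarrow> \<delta> (x \<bullet> y) = x \<bullet> dvec \<delta> y + y \<bullet> dvec \<delta> x"
  by (simp add: inner_vec_def derivation_sum derivation_mult sum.distrib)

lemma derivation_sq_norm: "derivation \<delta> \<Longrightarrow> \<delta> ((norm x)\<^sup>2) = 2 * (x \<bullet> dvec \<delta> x)"
  by (simp add: power2_norm_eq_inner derivation_inner)

lemma freely_movable_obtain:
  fixes p :: "'d::finite configuration"
  assumes "freely_movable n p"
  obtains \<delta> where "derivation \<delta>" "\<And>i. i \<in> {1..n} \<Longrightarrow> dvec \<delta> (p i) = w i"
proof -
  obtain \<delta> where "derivation \<delta>" "\<forall>i\<in>{1..n}. \<forall>c. \<delta> (p i $ c) = w i $ c"
    using assms unfolding freely_movable_def by blast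
  then show ?thesis using that by (simp add: vec_eq_iff)
qed

section \<open>Affine independence\<close>

definition affinely_free :: "nat set \<Rightarrow> 'd::finite configuration \<Rightarrow> bool" where
  "affinely_free I p \<longleftrightarrow>
     (\<forall>c. (\<Sum>i\<in>I. c i *\<^sub>R p i) = 0 \<and> (\<Sum>i\<in>I. c i) = 0 \<longrightarrow> (\<forall>i\<in>I. c i = 0))"

lemma affinely_freeD:
  "affinely_free I p \<Longrightarrow> (\<Sum>i\<in>I. c i *\<^sub>R p i) = 0 \<Longrightarrow> (\<Sum>i\<in>I. c i) = 0 \<Longrightarrow> i \<in> I \<Longrightarrow> c i = 0"
  unfolding affinely_free_def by blast

text \<open>
  An affine relation is a solution of \<open>d + 1\<close> linear equations: one for each coordinate (\<open>Some c\<close>) and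
  one for the sum of the coefficients (\<open>None\<close>).
\<close>

lemma affine_relation_exists:
  fixes p :: "'d::finite configuration"
  assumes "finite S" "card S > CARD('d) + 1"
  shows "\<exists>c. (\<exists>i\<in>S. c i \<noteq> 0) \<and> (\<Sum>i\<in>S. c i *\<^sub>R p i) = 0 \<and> (\<Sum>i\<in>S. c i) = 0"
proof -
  define a where "a = (\<lambda>e i. case e of None \<Rightarrow> 1 | Some c \<Rightarrow> p i $ c)"
  have "card (UNIV :: 'd option set) < card S" using assms by (simp add: card_UNIV_option)
  from underdetermined_system[OF _ assms(1) this, of a]
  obtain x where x: "\<exists>i\<in>S. x i \<noteq> 0" "\<And>e. (\<Sum>i\<in>S. a e i * x i) = 0" by auto
  have "(\<Sum>i\<in>S. x i *\<^sub>R p i) = 0"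
    unfolding vec_eq_iff using x(2)[of "Some _"] by (simp add: a_def sum_component mult.commute)
  moreover have "(\<Sum>i\<in>S. x i) = 0" using x(2)[of None] by (simp add: a_def)
  ultimately show ?thesis using x(1) by blast
qed

lemma affine_coordinates:
  fixes p :: "'d::finite configuration"
  assumes "affinely_free I p" "finite I" "card I = CARD('d) + 1"
  shows "\<exists>c. (\<Sum>i\<in>I. c i *\<^sub>R p i) = x \<and> (\<Sum>i\<in>I. c i) = 1"
proof -
  obtain k :: nat where k: "k \<notin> I" using assms(2) ex_new_if_finite infinite_UNIV_nat by blast
  define p' where "p' = p(k := x)"
  have "card (insert k I) > CARD('d) + 1" using assms k by simp
  from affine_relation_exists[OF _ this, of p'] obtain c
    where c: "\<exists>i\<in>insert k I. c i \<noteq> 0" "(\<Sum>i\<in>insert k I. c i *\<^sub>R p' i) = 0"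
      "(\<Sum>i\<in>insert k I. c i) = 0"
    using assms(2) by auto
  have "(\<Sum>i\<in>I. c i *\<^sub>R p' i) = (\<Sum>i\<in>I. c i *\<^sub>R p i)"
    using k by (intro sum.cong) (auto simp: p'_def)
  then have eq: "c k *\<^sub>R x + (\<Sum>i\<in>I. c i *\<^sub>R p i) = 0" "c k + (\<Sum>i\<in>I. c i) = 0"
    using c(2,3) k assms(2) by (auto simp: p'_def)
  have ck: "c k \<noteq> 0"
  proof
    assume "c k = 0"
    then have "\<forall>i\<in>I. c i = 0" using affinely_freeD[OF assms(1), of c] eq by simp
    then show False using c(1) \<open>c k = 0\<close> by auto
  qed
  let ?c = "\<lambda>i. - c i / c k"
  have "(\<Sum>i\<in>I. ?c i *\<^sub>R p i) = (- 1 / c k) *\<^sub>R (\<Sum>i\<in>I. c i *\<^sub>R p i)"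
    by (simp add: scaleR_sum_right)
  also have "(\<Sum>i\<in>I. c i *\<^sub>R p i) = - (c k *\<^sub>R x)"
    using eq(1) by (simp add: eq_neg_iff_add_eq_0 add.commute)
  finally have "(\<Sum>i\<in>I. ?c i *\<^sub>R p i) = x" using ck by simp
  moreover have "(\<Sum>i\<in>I. ?c i) = 1"
    using eq(2) ck by (simp add: sum_negf sum_divide_distrib[symmetric] field_simps)
  ultimately show ?thesis by (intro exI[of _ ?c]) blast
qed

lemma affinely_free_orthogonal_zero:
  fixes p :: "'d::finite configuration"
  assumes "affinely_free I p" "finite I" "card I = CARD('d) + 1"
    and "\<And>i j. i \<in> I \<Longrightarrow> j \<in> I \<Longrightarrow> (p i - p j) \<bullet> y = 0"
  shows "y = 0"
proof -
  obtain k where k: "k \<in> I" using assms(3) by fastforce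
  obtain c where c: "(\<Sum>i\<in>I. c i *\<^sub>R p i) = y + p k" "(\<Sum>i\<in>I. c i) = 1"
    using affine_coordinates[OF assms(1-3)] by blast
  have "y = (\<Sum>i\<in>I. c i *\<^sub>R p i) - (\<Sum>i\<in>I. c i) *\<^sub>R p k" using c by simp
  also have "\<dots> = (\<Sum>i\<in>I. c i *\<^sub>R (p i - p k))"
    by (simp add: scaleR_sum_left sum_subtractf scaleR_diff_right)
  finally have y: "y = (\<Sum>i\<in>I. c i *\<^sub>R (p i - p k))" .
  have "y \<bullet> y = (\<Sum>i\<in>I. c i *\<^sub>R (p i - p k)) \<bullet> y" using y by simp
  also have "\<dots> = 0" using assms(4) k by (simp add: inner_sum_left)
  finally show ?thesis by simp
qed

section \<open>Independence in a freely movable configuration\<close>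

text \<open>
  Differentiating an affine relation between the points of \<open>I\<close> and pairing it with an affine function
  \<open>x \<mapsto> x \<bullet> y + s\<close> that vanishes on \<open>I\<close> removes the unknown derivatives of the coefficients, and leaves
  a condition on the velocities, which are arbitrary.  Such an affine function exists: it has to vanish
  on \<open>I - {k}\<close> only, which is an underdetermined system, and then the relation makes it vanish at \<open>k\<close>.
\<close>

lemma freely_movable_affinely_free:
  fixes p :: "'d::finite configuration"
  assumes p: "freely_movable n p" and I: "I \<subseteq> {1..n}" "card I \<le> CARD('d) + 1"
  shows "affinely_free I p"
  unfolding affinely_free_def
proof (intro allI impI ballI, elim conjE, rule ccontr)
  fix c k assume c: "(\<Sum>i\<in>I. c i *\<^sub>R p i) = 0" "(\<Sum>i\<in>I. c i) = 0" and k: "k \<in> I" "c k \<noteq> 0"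
  have fin: "finite I" using I(1) finite_subset by blast
  define a where "a = (\<lambda>i e. case e of None \<Rightarrow> 1 | Some u \<Rightarrow> p i $ u)"
  have lt: "card (I - {k}) < card (UNIV :: 'd option set)"
    using I(2) k(1) fin by (simp add: card_UNIV_option card_Diff_singleton less_Suc_eq_le) 
  have fo: "finite (I - {k})" "finite (UNIV :: 'd option set)" using fin by auto
  obtain x where x: "\<exists>e. x e \<noteq> 0" "\<And>i. i \<in> I - {k} \<Longrightarrow> (\<Sum>e\<in>UNIV. a i e * x e) = 0"
    using underdetermined_system[OF fo lt, of a] by blast
  define y :: "real ^ 'd" where "y = (\<chi> u. x (Some u))"
  define s where "s = x None"
  have ae: "(\<Sum>e\<in>UNIV. a i e * x e) = p i \<bullet> y + s" for i
    by (simp add: UNIV_option_conv sum.reindex a_def y_def s_def inner_vec_def)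
  have hyp: "p i \<bullet> y + s = 0" if "i \<in> I" for i
  proof (cases "i = k")
    case False
    then show ?thesis using x(2)[of i] ae that by simp
  next
    case True
    have "0 = (\<Sum>i\<in>I. c i *\<^sub>R p i) \<bullet> y + (\<Sum>i\<in>I. c i) * s" using c by simp
    also have "\<dots> = (\<Sum>i\<in>I. c i * (p i \<bullet> y + s))"
      by (simp add: inner_sum_left sum_distrib_right distrib_left sum.distrib)
    also have "\<dots> = c k * (p k \<bullet> y + s)"
      using k(1) fin x(2) by (subst sum.remove[of _ k]) (auto simp: ae)
    finally show ?thesis using True k(2) by simp
  qed
  have ynz: "y \<noteq> 0"
  proof
    assume "y = 0"
    moreover from this have "s = 0" using hyp[OF k(1)] by simp
    ultimately have "x e = 0" for e
      by (cases e) (auto simp: y_def s_def vec_eq_iff)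
    then show False using x(1) by simp
  qed
  obtain \<delta> where \<delta>: "derivation \<delta>" "\<And>i. i \<in> {1..n} \<Longrightarrow> dvec \<delta> (p i) = (if i = k then y else 0)"
    using freely_movable_obtain[OF p, of "\<lambda>i. if i = k then y else 0"] by metis
  have d1: "(\<Sum>i\<in>I. c i *\<^sub>R dvec \<delta> (p i)) + (\<Sum>i\<in>I. \<delta> (c i) *\<^sub>R p i) = 0"
  proof -
    have "0 = dvec \<delta> (\<Sum>i\<in>I. c i *\<^sub>R p i)" using c \<delta>(1) by (simp add: dvec_0)
    then show ?thesis using \<delta>(1) by (simp add: dvec_sum dvec_scaleR sum.distrib)
  qed
  have d2: "(\<Sum>i\<in>I. \<delta> (c i)) = 0"
    using derivation_sum[OF \<delta>(1), of c I] c(2) derivation_0[OF \<delta>(1)] by simp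
  have "(\<Sum>i\<in>I. c i *\<^sub>R dvec \<delta> (p i)) = (\<Sum>i\<in>I. if i = k then c i *\<^sub>R y else 0)"
    using \<delta>(2) I(1) by (intro sum.cong) auto
  then have "(\<Sum>i\<in>I. c i *\<^sub>R dvec \<delta> (p i)) = c k *\<^sub>R y"
    using k fin by simp
  then have "0 = c k * (y \<bullet> y) + (\<Sum>i\<in>I. \<delta> (c i) *\<^sub>R p i) \<bullet> y"
    using arg_cong[OF d1, of "\<lambda>z. z \<bullet> y"] by (simp add: inner_add_left)
  also have "(\<Sum>i\<in>I. \<delta> (c i) *\<^sub>R p i) \<bullet> y = (\<Sum>i\<in>I. \<delta> (c i) * (- s))"
    unfolding inner_sum_left
  proof (rule sum.cong[OF refl])
    fix i assume "i \<in> I"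
    then have "p i \<bullet> y = - s" using hyp[of i] by simp
    then show "\<delta> (c i) *\<^sub>R p i \<bullet> y = \<delta> (c i) * (- s)" by simp
  qed
  also have "\<dots> = 0" unfolding sum_distrib_right[symmetric] using d2 by simp
  finally show False using k(2) ynz by simp
qed

text \<open>
  The coordinates from \<open>U\<close> of the vectors \<open>p k - p i\<close> form a matrix with at least as many rows as
  columns.  If \<open>w \<noteq> 0\<close> were in its kernel, a vector \<open>c \<noteq> 0\<close> would be in the kernel of the transpose;
  differentiating the equations for \<open>c\<close> along a motion of the coordinate \<open>u0\<close> of \<open>p i0\<close> and pairing with
  \<open>w\<close> gives \<open>c i0 * w u0 = 0\<close>, where both factors can be chosen nonzero.  With \<open>U = UNIV\<close> this says
  that \<open>d\<close> edge vectors at \<open>k\<close> span the space; smaller \<open>U\<close> serve for vertices that may move in some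
  coordinate directions only.
\<close>

lemma freely_movable_pinned_zero:
  fixes p :: "'d::finite configuration"
  assumes p: "freely_movable n p" and I: "I \<subseteq> {1..n}" "k \<in> {1..n}" "k \<notin> I"
    and U: "card U \<le> card I" "\<And>c. c \<notin> U \<Longrightarrow> w $ c = 0"
    and orth: "\<And>i. i \<in> I \<Longrightarrow> (p k - p i) \<bullet> w = 0"
  shows "w = 0"
proof (rule ccontr)
  assume "w \<noteq> 0"
  then obtain u0 where u0: "w $ u0 \<noteq> 0" by (auto simp: vec_eq_iff)
  have fin: "finite I" using I(1) finite_subset by blast
  have u0U: "u0 \<in> U" using u0 U(2) by blast
  have lt: "card (U - {u0}) < card I"
    using U(1) u0U by (metis card_Diff1_less finite_class.finite less_le_trans)
  obtain c where c: "\<exists>i\<in>I. c i \<noteq> 0"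
      "\<And>u. u \<in> U - {u0} \<Longrightarrow> (\<Sum>i\<in>I. (p k - p i) $ u * c i) = 0"
    using underdetermined_system[OF _ fin lt, of "\<lambda>u i. (p k - p i) $ u"] by auto
  obtain i0 where i0: "i0 \<in> I" "c i0 \<noteq> 0" using c(1) by blast
  have wU: "x \<bullet> w = (\<Sum>u\<in>U. x $ u * w $ u)" for x
    unfolding inner_vec_def inner_real_def
    by (rule sum.mono_neutral_right) (use U(2) in auto)
  let ?r = "\<lambda>u. \<Sum>i\<in>I. (p k - p i) $ u * c i"
  have r: "?r u = 0" if "u \<in> U" for u
  proof (cases "u = u0")
    case True
    have "0 = (\<Sum>i\<in>I. c i * ((p k - p i) \<bullet> w))" using orth by simp
    also have "\<dots> = (\<Sum>u\<in>U. ?r u * w $ u)"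
      unfolding wU sum_distrib_left sum_distrib_right
      by (subst sum.swap) (simp add: mult_ac)
    also have "\<dots> = ?r u0 * w $ u0"
      using u0U c(2) by (subst sum.remove[of _ u0]) auto
    finally show ?thesis using True u0 by simp
  qed (use c(2) that in auto)
  obtain \<delta> where \<delta>: "derivation \<delta>"
      "\<And>i. i \<in> {1..n} \<Longrightarrow> dvec \<delta> (p i) = (if i = i0 then axis u0 1 else 0)"
    using freely_movable_obtain[OF p, of "\<lambda>i. if i = i0 then axis u0 1 else 0"] by metis
  have dp: "\<delta> ((p k - p i) $ u) = (if i = i0 \<and> u = u0 then - 1 else 0)" if "i \<in> I" for i u
  proof -
    have "i \<in> {1..n}" "k \<noteq> i0" using that I i0 by auto
    then have "dvec \<delta> (p k - p i) = - (if i = i0 then axis u0 1 else 0)"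
      using \<delta> I by (simp add: dvec_diff)
    from arg_cong[OF this, of "\<lambda>z. z $ u"] show ?thesis by (simp add: axis_def)
  qed
  have dr: "(\<Sum>i\<in>I. (p k - p i) $ u * \<delta> (c i)) = (if u = u0 then c i0 else 0)" if "u \<in> U" for u
  proof -
    have "0 = \<delta> (?r u)" using r[OF that] derivation_0[OF \<delta>(1)] by simp
    also have "\<dots> = (\<Sum>i\<in>I. (p k - p i) $ u * \<delta> (c i)) + (\<Sum>i\<in>I. c i * \<delta> ((p k - p i) $ u))"
      by (simp only: derivation_sum[OF \<delta>(1)] derivation_mult[OF \<delta>(1)] sum.distrib)
    also have "(\<Sum>i\<in>I. c i * \<delta> ((p k - p i) $ u)) = (\<Sum>i\<in>I. if i = i0 then (if u = u0 then - c i else 0) else 0)"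
      using dp by (intro sum.cong) auto
    also have "\<dots> = (if u = u0 then - c i0 else 0)" using i0 fin by simp
    finally show ?thesis by (auto split: if_splits)
  qed
  have "0 = (\<Sum>i\<in>I. \<delta> (c i) * ((p k - p i) \<bullet> w))" using orth by simp
  also have "\<dots> = (\<Sum>u\<in>U. (\<Sum>i\<in>I. (p k - p i) $ u * \<delta> (c i)) * w $ u)"
    unfolding wU sum_distrib_left sum_distrib_right
    by (subst sum.swap) (simp add: mult_ac)
  also have "\<dots> = (\<Sum>u\<in>U. if u = u0 then c i0 * w $ u else 0)"
    using dr by (intro sum.cong) auto
  also have "\<dots> = c i0 * w $ u0" using u0U by (simp add: sum.delta finite_subset)
  finally show False using i0(2) u0 by simp
qed

lemma freely_movable_distinct:
  assumes "freely_movable n p" "i \<in> {1..n}" "j \<in> {1..n}" "i \<noteq> j"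
  shows "p i \<noteq> p j"
proof
  assume eq: "p i = p j"
  obtain \<delta> where \<delta>: "derivation \<delta>" "\<And>l. l \<in> {1..n} \<Longrightarrow> dvec \<delta> (p l) = (if l = i then vec 1 else 0)"
    using freely_movable_obtain[OF assms(1), of "\<lambda>l. if l = i then vec 1 else 0"] by metis
  have "(vec 1 :: real ^ 'a) = 0"
    using \<delta>(2)[OF assms(2)] \<delta>(2)[OF assms(3)] assms(4) by (simp add: eq)
  then show False by (simp add: vec_eq_iff)
qed

lemma edge_sqlength_derivation:
  assumes "derivation \<delta>"
  shows "\<delta> (edge_sqlength q {i, j}) = 2 * ((q i - q j) \<bullet> (dvec \<delta> (q i) - dvec \<delta> (q j)))"
  using assms by (simp add: edge_sqlength_doubleton derivation_sq_norm dvec_diff)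

lemma edges_onE:
  assumes "e \<in> edges_on n"
  obtains i j where "e = {i, j}" "i \<in> {1..n}" "j \<in> {1..n}" "i \<noteq> j"
  using assms by (auto simp: edges_on_def)

text \<open>
  If two edges differ, one of them has an endpoint outside the other; moving just this endpoint
  changes one length and not the other.
\<close>

lemma edge_sqlength_inj:
  assumes p: "freely_movable n p" and e: "e \<in> edges_on n" "e' \<in> edges_on n"
    and eq: "edge_sqlength p e = edge_sqlength p e'"
  shows "e = e'"
proof (rule ccontr)
  assume ne: "e \<noteq> e'"
  obtain a b where ab: "e = {a, b}" "a \<in> {1..n}" "b \<in> {1..n}" "a \<noteq> b" using e(1) by (rule edges_onE)
  obtain a' b' where ab': "e' = {a', b'}" "a' \<in> {1..n}" "b' \<in> {1..n}" "a' \<noteq> b'"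
    using e(2) by (rule edges_onE)
  have "\<exists>x y. e = {x, y} \<and> x \<in> {1..n} \<and> y \<in> {1..n} \<and> x \<noteq> y \<and> x \<notin> e'"
  proof (cases "a \<in> e'")
    case True
    then have "b \<notin> e'" using ne ab ab' by auto
    then show ?thesis using ab by (intro exI[of _ b] exI[of _ a]) auto
  qed (use ab in blast)
  then obtain x y where x: "e = {x, y}" "x \<in> {1..n}" "y \<in> {1..n}" "x \<noteq> y" "x \<notin> e'" by blast
  obtain \<delta> where \<delta>: "derivation \<delta>" "\<And>l. l \<in> {1..n} \<Longrightarrow> dvec \<delta> (p l) = (if l = x then p x - p y else 0)"
    using freely_movable_obtain[OF p, of "\<lambda>l. if l = x then p x - p y else 0"] by metis
  have "\<delta> (edge_sqlength p e) = 2 * ((p x - p y) \<bullet> (p x - p y))"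
    using x \<delta> by (simp add: edge_sqlength_derivation)
  moreover have "\<delta> (edge_sqlength p e') = 0"
    using ab' x \<delta> by (auto simp: edge_sqlength_derivation)
  ultimately have "p x = p y" using eq by simp
  then show False using freely_movable_distinct[OF p x(2,3,4)] by simp
qed

section \<open>Reflections\<close>

definition reflection :: "real ^ 'd \<Rightarrow> real ^ 'd \<Rightarrow> real ^ 'd::finite" where
  "reflection h x = x - (2 * (x \<bullet> h) / (h \<bullet> h)) *\<^sub>R h"

lemma orthogonal_transformation_reflection: "orthogonal_transformation (reflection h)"
  unfolding orthogonal_transformation
proof
  show "linear (reflection h)"
    by (rule linearI) (simp_all add: reflection_def inner_add_left algebra_simps add_divide_distrib)
  show "\<forall>x. norm (reflection h x) = norm x"
  proof
    fix x
    have "reflection h x \<bullet> reflection h x = x \<bullet> x"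
      by (cases "h = 0")
         (simp_all add: reflection_def inner_diff_left inner_diff_right inner_commute[of h x] field_simps)
    then show "norm (reflection h x) = norm x" by (simp add: norm_eq_sqrt_inner)
  qed
qed

lemma reflection_fixes: "x \<bullet> h = 0 \<Longrightarrow> reflection h x = x"
  by (simp add: reflection_def)

lemma reflection_swaps:
  assumes "norm x = norm y"
  shows "reflection (x - y) x = y"
proof (cases "x = y")
  case False
  have "(x - y) \<bullet> (x - y) = 2 * (x \<bullet> (x - y))"
    using assms by (simp add: norm_eq inner_diff_left inner_diff_right inner_commute)
  moreover have "(x - y) \<bullet> (x - y) \<noteq> 0" using False by simp
  ultimately have "2 * (x \<bullet> (x - y)) / ((x - y) \<bullet> (x - y)) = 1" by (metis divide_self)
  then have "reflection (x - y) x = x - 1 *\<^sub>R (x - y)" unfolding reflection_def by (simp only:)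
  then show ?thesis by simp
qed (simp add: reflection_def)

text \<open>
  This is the QR decomposition of the matrix with columns \<open>z i\<close> by Householder reflections; \<open>b\<close>
  numbers the coordinates.
\<close>

lemma triangular_position:
  fixes z :: "nat \<Rightarrow> real ^ 'd::finite"
  assumes b: "bij_betw b {1..CARD('d)} (UNIV :: 'd set)" and "m \<le> CARD('d)"
  shows "\<exists>R :: real ^ 'd \<Rightarrow> real ^ 'd. orthogonal_transformation R \<and>
     (\<forall>i\<in>{1..m}. \<forall>c\<in>{1..CARD('d)}. i < c \<longrightarrow> R (z i) $ b c = 0)"
  using assms(2)
proof (induction m)
  case 0
  show ?case by (intro exI[of _ "\<lambda>x. x"]) (auto simp: orthogonal_transformation linear_ident)
next
  case (Suc m)
  then have "\<exists>R :: real ^ 'd \<Rightarrow> real ^ 'd. orthogonal_transformation R \<and>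
      (\<forall>i\<in>{1..m}. \<forall>c\<in>{1..CARD('d)}. i < c \<longrightarrow> R (z i) $ b c = 0)"
    by simp
  then obtain R :: "real ^ 'd \<Rightarrow> real ^ 'd" where R: "orthogonal_transformation R"
    "\<And>i c. i \<in> {1..m} \<Longrightarrow> c \<in> {1..CARD('d)} \<Longrightarrow> i < c \<Longrightarrow> R (z i) $ b c = 0"
    by blast
  define B where "B = b ` {1..m}"
  define x where "x = R (z (Suc m))"
  \<comment> \<open>The part of \<open>x\<close> in the coordinates beyond \<open>m\<close> is reflected onto the axis \<open>b (Suc m)\<close>;
    the mirror contains the first \<open>m\<close> axes, so the earlier vectors stay where they are.\<close>
  define x' where "x' = (\<chi> u. if u \<in> B then 0 else x $ u)"
  define e where "e = norm x' *\<^sub>R axis (b (Suc m)) (1::real)"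
  define T where "T = reflection (x' - e)"
  have bB: "b c \<in> B \<longleftrightarrow> c \<le> m" if "c \<in> {1..CARD('d)}" for c
  proof
    assume "b c \<in> B"
    then obtain c' where c': "b c = b c'" "c' \<in> {1..m}" by (auto simp: B_def)
    moreover from c'(2) Suc.prems have "c' \<in> {1..CARD('d)}" by auto
    ultimately have "c = c'" using b that unfolding bij_betw_def inj_on_def by blast
    then show "c \<le> m" using c'(2) by simp
  qed (use that in \<open>auto simp: B_def\<close>)
  have hB: "(x' - e) $ u = 0" if "u \<in> B" for u
    using that bB[of "Suc m"] Suc.prems by (auto simp: x'_def e_def axis_def)
  have fix_y: "T y = y" if "\<And>u. u \<notin> B \<Longrightarrow> y $ u = 0" for y
    unfolding T_def
  proof (rule reflection_fixes)
    have "y $ u * (x' - e) $ u = 0" for u using that[of u] hB[of u] by (cases "u \<in> B") auto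
    then show "y \<bullet> (x' - e) = 0" unfolding inner_vec_def inner_real_def by (intro sum.neutral) auto
  qed
  have T: "orthogonal_transformation T" unfolding T_def by (rule orthogonal_transformation_reflection)
  have Tx': "T x' = e" unfolding T_def by (rule reflection_swaps) (simp add: e_def)
  have "T x = T (x - x') + T x'"
    using orthogonal_transformation_linear[OF T] by (simp add: linear_diff)
  also have "T (x - x') = x - x'" by (rule fix_y) (simp add: x'_def)
  finally have Tx: "T x = x - x' + e" using Tx' by simp
  show ?case
  proof (intro exI[of _ "T \<circ> R"] conjI ballI impI)
    show "orthogonal_transformation (T \<circ> R)" using R(1) T by (rule orthogonal_transformation_compose[rotated])
  next
    fix i c assume i: "i \<in> {1..Suc m}" "c \<in> {1..CARD('d)}" "i < c"
    show "(T \<circ> R) (z i) $ b c = 0"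
    proof (cases "i = Suc m")
      case True
      have "Suc m \<in> {1..CARD('d)}" using Suc.prems by simp
      then have "b c \<noteq> b (Suc m)"
        using inj_onD[OF bij_betw_imp_inj_on[OF b], of c "Suc m"] i True by auto
      moreover have "b c \<notin> B" using bB[of c] i True by auto
      ultimately have "T x $ b c = 0" by (simp add: Tx x'_def e_def axis_def)
      then show ?thesis using True by (simp add: x_def)
    next
      case False
      then have im: "i \<in> {1..m}" using i by auto
      have "R (z i) $ u = 0" if "u \<notin> B" for u
      proof -
        obtain c' where "u = b c'" "c' \<in> {1..CARD('d)}" using b unfolding bij_betw_def by (metis UNIV_I imageE)
        then show ?thesis using that R(2)[OF im, of c'] bB[of c'] im by auto
      qed
      then have "T (R (z i)) = R (z i)" by (rule fix_y)
      then show ?thesis using R(2)[OF im] i by simp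
    qed
  qed
qed

text \<open>
  Points are matched one at a time: those matched so far are equidistant from \<open>f (x k)\<close> and \<open>y k\<close>,
  hence lie in the mirror of the reflection that exchanges these two.
\<close>

lemma equal_distances_isometry:
  fixes x y :: "nat \<Rightarrow> real ^ 'd::finite"
  assumes "finite A" "\<And>i j. i \<in> A \<Longrightarrow> j \<in> A \<Longrightarrow> dist (x i) (x j) = dist (y i) (y j)"
  shows "\<exists>f :: real ^ 'd \<Rightarrow> real ^ 'd. (\<forall>a b. dist (f a) (f b) = dist a b) \<and> (\<forall>i\<in>A. f (x i) = y i)"
  using assms
proof (induction A rule: finite_induct)
  case empty
  show ?case by (intro exI[of _ id]) auto
next
  case (insert k A)
  then have "\<exists>f :: real ^ 'd \<Rightarrow> real ^ 'd. (\<forall>a b. dist (f a) (f b) = dist a b) \<and> (\<forall>i\<in>A. f (x i) = y i)"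
    by simp
  then obtain f :: "real ^ 'd \<Rightarrow> real ^ 'd"
    where f: "\<And>a b. dist (f a) (f b) = dist a b" "\<And>i. i \<in> A \<Longrightarrow> f (x i) = y i"
    by blast
  define h where "h = f (x k) - y k"
  define mid where "mid = (1/2) *\<^sub>R (f (x k) + y k)"
  define g where "g = (\<lambda>a. mid + reflection h (f a - mid))"
  have lin: "linear (reflection h)" and nrm: "\<And>a. norm (reflection h a) = norm a"
    using orthogonal_transformation_reflection[of h] by (auto simp: orthogonal_transformation)
  have "dist (g a) (g b) = dist a b" for a b
  proof -
    have "g a - g b = reflection h (f a - f b)"
      by (simp add: g_def linear_diff[OF lin])
    then show ?thesis using nrm f(1)[of a b] by (simp add: dist_norm)
  qed
  moreover have "g (x i) = y i" if "i \<in> A" for i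
  proof -
    have "dist (y i) (f (x k)) = dist (y i) (y k)"
      using insert.prems[of i k] f that by (metis insertCI)
    then have "(y i - mid) \<bullet> h = 0"
      unfolding dist_norm norm_eq h_def mid_def
      by (simp add: algebra_simps inner_commute)
    then show ?thesis using f(2)[OF that] by (simp add: g_def reflection_fixes)
  qed
  moreover have "g (x k) = y k"
  proof -
    have "f (x k) - mid = (1/2) *\<^sub>R h" "y k - mid = - (1/2) *\<^sub>R h"
      by (simp_all add: h_def mid_def vec_eq_iff field_simps)
    moreover have "reflection h h = - h" by (cases "h = 0") (auto simp: reflection_def scaleR_2)
    ultimately have "g (x k) = mid + (1/2) *\<^sub>R (- h)" 
      by (simp add: g_def linear_scale[OF lin])
    also have "\<dots> = y k" by (simp add: h_def mid_def vec_eq_iff field_simps)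
    finally show ?thesis .
  qed
  ultimately show ?case by (intro exI[of _ g]) auto
qed

lemma equidistant_imp_eq:
  fixes p :: "'d::finite configuration"
  assumes "affinely_free I p" "finite I" "card I = CARD('d) + 1"
    and "\<And>i. i \<in> I \<Longrightarrow> dist x (p i) = dist y (p i)"
  shows "x = y"
proof -
  have eq: "(x - p i) \<bullet> (x - p i) = (y - p i) \<bullet> (y - p i)" if "i \<in> I" for i
    using assms(4)[OF that] by (simp add: dist_norm norm_eq)
  have "(p i - p j) \<bullet> (x - y) = 0" if "i \<in> I" "j \<in> I" for i j
    using eq[OF that(1)] eq[OF that(2)] by (simp add: algebra_simps inner_commute)
  then have "x - y = 0" by (rule affinely_free_orthogonal_zero[OF assms(1-3)])
  then show ?thesis by simp
qed

section \<open>Infinitesimal rigidity\<close>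

text \<open>
  The derivative of the squared distance of \<open>i\<close> and \<open>j\<close> vanishes when \<open>p\<close> moves with velocity \<open>w\<close>.
\<close>

definition stationary :: "'d::finite configuration \<Rightarrow> 'd configuration \<Rightarrow> nat \<Rightarrow> nat \<Rightarrow> bool" where
  "stationary p w i j \<longleftrightarrow> (p i - p j) \<bullet> (w i - w j) = 0"

lemma stationary_commute: "stationary p w i j \<longleftrightarrow> stationary p w j i"
  by (simp add: stationary_def inner_diff_left inner_diff_right) linarith

lemma stationary_refl: "stationary p w i i"
  by (simp add: stationary_def)

text \<open>
  In a frame that moves with one vertex of \<open>I\<close>, the condition \<open>stationary p w i j\<close> becomes
  \<open>P i \<bullet> W j + P j \<bullet> W i = 0\<close>, which is bilinear.  Both \<open>j\<close> and \<open>k\<close> are affine combinations of the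
  vertices of \<open>I\<close>, with velocities combined accordingly, and so the condition passes from \<open>I\<close> to the
  pair \<open>j\<close>, \<open>k\<close>.
\<close>

lemma stationary_propagate:
  fixes p :: "'d::finite configuration"
  assumes I: "affinely_free I p" "finite I" "card I = CARD('d) + 1"
    and II: "\<And>i i'. i \<in> I \<Longrightarrow> i' \<in> I \<Longrightarrow> stationary p w i i'"
    and Ij: "\<And>i. i \<in> I \<Longrightarrow> stationary p w i j"
    and Ik: "\<And>i. i \<in> I \<Longrightarrow> stationary p w i k"
  shows "stationary p w j k"
proof -
  obtain o' where o: "o' \<in> I" using I(3) by fastforce
  define P where "P = (\<lambda>i. p i - p o')"
  define W where "W = (\<lambda>i. w i - w o')"
  have PW: "P i \<bullet> W j + P j \<bullet> W i = 0"
    if "stationary p w i j" "stationary p w o' i" "stationary p w o' j" for i j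
    using that by (simp add: stationary_def P_def W_def algebra_simps inner_commute)
  \<comment> \<open>A velocity is the same affine combination of the velocities of \<open>I\<close> as its point is of
    the points of \<open>I\<close>.\<close>
  have combo: "\<exists>c. P l = (\<Sum>i\<in>I. c i *\<^sub>R P i) \<and> W l = (\<Sum>i\<in>I. c i *\<^sub>R W i)"
    if l: "\<And>i. i \<in> I \<Longrightarrow> stationary p w i l" for l
  proof -
    obtain c where c: "(\<Sum>i\<in>I. c i *\<^sub>R p i) = p l" "(\<Sum>i\<in>I. c i) = 1"
      using affine_coordinates[OF I] by blast
    have "(\<Sum>i\<in>I. c i *\<^sub>R P i) = (\<Sum>i\<in>I. c i *\<^sub>R p i) - (\<Sum>i\<in>I. c i) *\<^sub>R p o'"
      by (simp add: P_def scaleR_diff_right sum_subtractf scaleR_sum_left)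
    then have P: "P l = (\<Sum>i\<in>I. c i *\<^sub>R P i)" using c by (simp add: P_def)
    have orth: "P i \<bullet> (W l - (\<Sum>i\<in>I. c i *\<^sub>R W i)) = 0" if i: "i \<in> I" for i
    proof -
      have "P i \<bullet> (\<Sum>i\<in>I. c i *\<^sub>R W i) = (\<Sum>j\<in>I. c j * (P i \<bullet> W j))"
        by (simp add: inner_sum_right)
      also have "\<dots> = (\<Sum>j\<in>I. - (c j * (P j \<bullet> W i)))"
      proof (rule sum.cong[OF refl])
        fix j assume "j \<in> I"
        then have "P i \<bullet> W j = - (P j \<bullet> W i)"
          using PW[of i j] II i o by (simp add: eq_neg_iff_add_eq_0)
        then show "c j * (P i \<bullet> W j) = - (c j * (P j \<bullet> W i))" by simp
      qed
      also have "\<dots> = - ((\<Sum>i\<in>I. c i *\<^sub>R P i) \<bullet> W i)" by (simp add: inner_sum_left sum_negf)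
      also have "\<dots> = P i \<bullet> W l"
        using PW[of i l] l i o II P by simp
      finally show ?thesis by (simp add: inner_diff_right)
    qed
    have "W l - (\<Sum>i\<in>I. c i *\<^sub>R W i) = 0"
    proof (rule affinely_free_orthogonal_zero[OF I])
      fix i j assume "i \<in> I" "j \<in> I"
      then show "(p i - p j) \<bullet> (W l - (\<Sum>i\<in>I. c i *\<^sub>R W i)) = 0"
        using orth[of i] orth[of j] by (simp add: P_def inner_diff_left)
    qed
    then show ?thesis using P by auto
  qed
  obtain c where c: "P j = (\<Sum>i\<in>I. c i *\<^sub>R P i)" "W j = (\<Sum>i\<in>I. c i *\<^sub>R W i)"
    using combo[OF Ij] by blast
  have "P j \<bullet> W k + P k \<bullet> W j = (\<Sum>i\<in>I. c i * (P i \<bullet> W k + P k \<bullet> W i))"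
    by (simp add: c inner_sum_left inner_sum_right distrib_left sum.distrib)
  also have "\<dots> = 0" using PW Ik o II by (intro sum.neutral) auto
  finally have "P j \<bullet> W k + P k \<bullet> W j = 0" .
  moreover have "P j \<bullet> W j = 0" "P k \<bullet> W k = 0"
    using PW[of j j] PW[of k k] Ij[OF o] Ik[OF o] by (auto simp: stationary_refl)
  moreover have "(p j - p k) \<bullet> (w j - w k) = (P j - P k) \<bullet> (W j - W k)"
    by (simp add: P_def W_def)
  ultimately show ?thesis
    by (simp add: stationary_def inner_diff_left inner_diff_right inner_commute)
qed

definition infinitesimally_rigid :: "nat \<Rightarrow> nat set set \<Rightarrow> 'd::finite configuration \<Rightarrow> bool" where
  "infinitesimally_rigid n E p \<longleftrightarrow>
     (\<forall>w. (\<forall>i j. {i, j} \<in> E \<longrightarrow> stationary p w i j) \<longrightarrow>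
        (\<forall>i\<in>{1..n}. \<forall>j\<in>{1..n}. stationary p w i j))"

text \<open>
  The vertices of the initial simplex are pairwise stationary by assumption, and \<open>stationary_propagate\<close>
  extends this to each attached vertex.
\<close>

lemma trilateration_infinitesimally_rigid:
  fixes p :: "'d::finite configuration"
  assumes p: "freely_movable n p" and n: "n \<ge> CARD('d) + 2"
    and G: "allows_trilateration CARD('d) n G"
  shows "infinitesimally_rigid n (set G) p"
  unfolding infinitesimally_rigid_def
proof (intro allI impI)
  fix w :: "'d configuration"
  assume E: "\<forall>i j. {i, j} \<in> set G \<longrightarrow> stationary p w i j"
  from G obtain \<pi> where \<pi>: "\<pi> permutes {1..n}"
    and simplex: "\<And>i j. i \<in> {1..CARD('d) + 2} \<Longrightarrow> j \<in> {1..CARD('d) + 2} \<Longrightarrow> i \<noteq> j \<Longrightarrow> {\<pi> i, \<pi> j} \<in> set G"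
    and attached: "\<And>j. j \<in> {CARD('d) + 2<..n} \<Longrightarrow>
        \<exists>I\<subseteq>{1..<j}. card I = CARD('d) + 1 \<and> (\<forall>i\<in>I. {\<pi> i, \<pi> j} \<in> set G)"
    unfolding allows_trilateration_def by blast
  have "\<forall>i\<in>{1..m}. \<forall>j\<in>{1..m}. stationary p w (\<pi> i) (\<pi> j)" if "CARD('d) + 2 \<le> m" "m \<le> n" for m
    using that
  proof (induction m rule: dec_induct)
    case base
    then show ?case using E simplex by (metis stationary_refl)
  next
    case (step m)
    then have IH: "\<And>i j. i \<in> {1..m} \<Longrightarrow> j \<in> {1..m} \<Longrightarrow> stationary p w (\<pi> i) (\<pi> j)" by simp
    obtain I where I: "I \<subseteq> {1..<Suc m}" "card I = CARD('d) + 1" "\<forall>i\<in>I. {\<pi> i, \<pi> (Suc m)} \<in> set G"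
      using attached[of "Suc m"] step by auto
    have inj: "inj_on \<pi> I" using \<pi> by (meson inj_on_subset permutes_inj subset_UNIV)
    have "affinely_free (\<pi> ` I) p"
    proof (rule freely_movable_affinely_free[OF p])
      have "I \<subseteq> {1..n}" using I(1) step by force
      then show "\<pi> ` I \<subseteq> {1..n}" using permutes_image[OF \<pi>] by blast
      show "card (\<pi> ` I) \<le> CARD('d) + 1" using I inj by (simp add: card_image)
    qed
    moreover have "finite (\<pi> ` I)" using I(1) finite_subset by blast
    moreover have "card (\<pi> ` I) = CARD('d) + 1" using I inj by (simp add: card_image)
    moreover have "stationary p w i i'" if ii': "i \<in> \<pi> ` I" "i' \<in> \<pi> ` I" for i i'
    proof -
      obtain j j' where "i = \<pi> j" "i' = \<pi> j'" "j \<in> I" "j' \<in> I" using ii' by blast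
      then show ?thesis using IH[of j j'] I(1) by fastforce
    qed
    moreover have "stationary p w i (\<pi> (Suc m))" if "i \<in> \<pi> ` I" for i
      using that I(3) E by blast
    moreover have "stationary p w i (\<pi> l)" if il: "i \<in> \<pi> ` I" "l \<in> {1..m}" for i l
    proof -
      obtain j where "i = \<pi> j" "j \<in> I" using il(1) by blast
      then show ?thesis using IH[of j l] I(1) il(2) by fastforce
    qed
    ultimately have new: "stationary p w (\<pi> (Suc m)) (\<pi> l)" if "l \<in> {1..m}" for l
      using that by (intro stationary_propagate[of "\<pi> ` I" p w "\<pi> (Suc m)" "\<pi> l"])
    have "{1..Suc m} = insert (Suc m) {1..m}" by auto
    then show ?case
      using IH new stationary_commute[of p w "\<pi> (Suc m)"] by (auto simp: stationary_refl)
  qed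
  from this[of n] have all: "\<forall>i\<in>{1..n}. \<forall>j\<in>{1..n}. stationary p w (\<pi> i) (\<pi> j)" using n by simp
  show "\<forall>i\<in>{1..n}. \<forall>j\<in>{1..n}. stationary p w i j"
  proof (intro ballI)
    fix i j assume "i \<in> {1..n}" "j \<in> {1..n}"
    then obtain i' j' where "i = \<pi> i'" "j = \<pi> j'" "i' \<in> {1..n}" "j' \<in> {1..n}"
      using permutes_image[OF \<pi>] by blast
    then show "stationary p w i j" using all by blast
  qed
qed

section \<open>Transfer of freedom to the second configuration\<close>

text \<open>
  Any velocities can be prescribed for a congruent copy of \<open>q\<close> in triangular position, subject only to
  the vanishing of the pinned coordinates.  The vertices \<open>s 0, ..., s d\<close> that are put in triangular
  position may be chosen freely; \<open>s i\<close> keeps its first \<open>i\<close> coordinates in the numbering \<open>b\<close>, so that \<open>s 0\<close>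
  is at the origin and \<open>s d\<close> is not pinned at all.
\<close>

definition free_modulo_congruence :: "nat \<Rightarrow> 'd::finite configuration \<Rightarrow> bool" where
  "free_modulo_congruence n q \<longleftrightarrow>
     (\<forall>s. inj_on s {0..CARD('d)} \<and> s ` {0..CARD('d)} \<subseteq> {1..n} \<longrightarrow>
       (\<exists>b (R :: real ^ 'd \<Rightarrow> real ^ 'd).
          bij_betw b {1..CARD('d)} (UNIV :: 'd set) \<and> orthogonal_transformation R \<and>
          (\<forall>i\<le>CARD('d). \<forall>c\<in>{1..CARD('d)}. i < c \<longrightarrow> R (q (s i) - q (s 0)) $ b c = 0) \<and>
          (\<forall>y. (\<forall>i\<le>CARD('d). \<forall>c\<in>{1..CARD('d)}. i < c \<longrightarrow> y (s i) $ b c = 0) \<longrightarrow>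
             (\<exists>\<delta>. derivation \<delta> \<and> (\<forall>i\<in>{1..n}. dvec \<delta> (R (q i - q (s 0))) = y i)))))"

lemma edge_sqlength_isometry:
  assumes "orthogonal_transformation R"
  shows "edge_sqlength q {i, j} = (norm (R (q i - x) - R (q j - x)))\<^sup>2"
proof -
  have lin: "linear R" using assms by (rule orthogonal_transformation_linear)
  have "R (q i - x) - R (q j - x) = R (q i - q j)"
    by (simp add: linear_diff[OF lin])
  then show ?thesis
    using orthogonal_transformation_norm[OF assms] by (simp add: edge_sqlength_doubleton)
qed

text \<open>
  Let \<open>q'\<close> be \<open>q\<close> in triangular position and \<open>J\<close> the set of unpinned coordinates.  Let \<open>D v\<close> move only
  the coordinate \<open>v \<in> J\<close> of \<open>p\<close>.  The matrix \<open>M\<close> of the derivatives \<open>D v\<close> of the coordinates of \<open>q'\<close> is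
  square.  A vector in its kernel gives a derivation that fixes \<open>q'\<close>, hence all measured lengths, and so
  moves \<open>p\<close> trivially by rigidity; as it also leaves the pinned coordinates of \<open>p\<close> at rest, it does not
  move \<open>p\<close> at all.  So \<open>M\<close> is invertible.
\<close>

theorem freedom_transfers:
  fixes p q :: "'d::finite configuration"
  assumes p: "freely_movable n p"
    and E: "E \<subseteq> edges_on n" "infinitesimally_rigid n E p"
    and \<phi>: "\<And>e. e \<in> E \<Longrightarrow> \<phi> e \<in> edges_on n \<and> edge_sqlength p e = edge_sqlength q (\<phi> e)"
  shows "free_modulo_congruence n q"
  unfolding free_modulo_congruence_def
proof (intro allI impI, elim conjE)
  fix s assume s: "inj_on s {0..CARD('d)}" "s ` {0..CARD('d)} \<subseteq> {1..n}"
  obtain b where b: "bij_betw b {1..CARD('d)} (UNIV :: 'd set)"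
    using ex_bij_betw_nat_finite_1[of "UNIV :: 'd set"] by auto
  obtain R :: "real ^ 'd \<Rightarrow> real ^ 'd" where R: "orthogonal_transformation R"
      and R0: "\<forall>i\<in>{1..CARD('d)}. \<forall>c\<in>{1..CARD('d)}. i < c \<longrightarrow> R (q (s i) - q (s 0)) $ b c = 0"
    using triangular_position[OF b order_refl, of "\<lambda>i. q (s i) - q (s 0)"] by blast
  define q' where "q' = (\<lambda>i. R (q i - q (s 0)))"
  have q'0: "q' (s i) $ b c = 0" if "i \<le> CARD('d)" "c \<in> {1..CARD('d)}" "i < c" for i c
  proof (cases "i = 0")
    case True
    then show ?thesis using linear_0[OF orthogonal_transformation_linear[OF R]] by (simp add: q'_def)
  qed (use R0 that in \<open>auto simp: q'_def\<close>)
  define pinned where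
    "pinned = {(s i, b c) | i c. i \<le> CARD('d) \<and> c \<in> {1..CARD('d)} \<and> i < c}"
  define J where "J = {1..n} \<times> UNIV - pinned"
  have finJ: "finite J" by (simp add: J_def)
  have "\<exists>\<delta>. derivation \<delta> \<and> (\<forall>i\<in>{1..n}. dvec \<delta> (p i) = (if i = fst v then axis (snd v) 1 else 0))" for v
    using freely_movable_obtain[OF p, of "\<lambda>i. if i = fst v then axis (snd v) 1 else 0"] by metis
  then obtain D where D: "\<And>v. derivation (D v)"
      "\<And>v i. i \<in> {1..n} \<Longrightarrow> dvec (D v) (p i) = (if i = fst v then axis (snd v) 1 else 0)"
    by metis
  define M where "M = (\<lambda>e v. D v (q' (fst e) $ snd e))"
  have combo: "derivation (\<lambda>r. \<Sum>v\<in>J. x v * D v r)" for x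
    by (rule derivation_linear_combination) (rule D)
  have surj: "\<exists>x. \<forall>e\<in>J. (\<Sum>v\<in>J. M e v * x v) = y e" for y
  proof (rule square_system_surj[OF finJ])
    fix x assume x: "\<forall>e\<in>J. (\<Sum>v\<in>J. M e v * x v) = 0"
    define \<delta> where "\<delta> = (\<lambda>r. \<Sum>v\<in>J. x v * D v r)"
    have \<delta>: "derivation \<delta>" unfolding \<delta>_def by (rule combo)
    have q'_const: "dvec \<delta> (q' i) = 0" if "i \<in> {1..n}" for i
      unfolding vec_eq_iff
    proof
      fix u
      show "dvec \<delta> (q' i) $ u = 0 $ u"
      proof (cases "(i, u) \<in> J")
        case True
        then show ?thesis using x by (auto simp: \<delta>_def M_def mult.commute)
      next
        case False
        then have "q' i $ u = 0" using that q'0 by (auto simp: J_def pinned_def)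
        then show ?thesis using derivation_0[OF \<delta>] by simp
      qed
    qed
    define w where "w = (\<lambda>i. dvec \<delta> (p i))"
    have w: "w i $ u = (if (i, u) \<in> J then x (i, u) else 0)" if "i \<in> {1..n}" for i u
    proof -
      have "w i $ u = (\<Sum>v\<in>J. x v * dvec (D v) (p i) $ u)" by (simp add: w_def \<delta>_def)
      also have "\<dots> = (\<Sum>v\<in>J. if v = (i, u) then x v else 0)"
        using D(2)[OF that] by (intro sum.cong) (auto simp: axis_def)
      also have "\<dots> = (if (i, u) \<in> J then x (i, u) else 0)" using finJ by simp
      finally show ?thesis .
    qed
    have "stationary p w i j" if ij: "{i, j} \<in> E" for i j
    proof -
      obtain i' j' where ij': "\<phi> {i, j} = {i', j'}" "i' \<in> {1..n}" "j' \<in> {1..n}"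
        using \<phi>[OF ij] by (auto elim: edges_onE)
      have "\<delta> (edge_sqlength p {i, j}) = \<delta> ((norm (q' i' - q' j'))\<^sup>2)"
        using \<phi>[OF ij] ij' edge_sqlength_isometry[OF R, of q i' j'] by (simp add: q'_def)
      also have "\<dots> = 0"
        using q'_const ij' by (simp add: derivation_sq_norm[OF \<delta>] dvec_diff[OF \<delta>])
      finally show ?thesis
        by (simp add: edge_sqlength_derivation[OF \<delta>] stationary_def w_def)
    qed
    then have stat: "stationary p w i j" if "i \<in> {1..n}" "j \<in> {1..n}" for i j
      using E(2) that unfolding infinitesimally_rigid_def by blast
    \<comment> \<open>The pinned vertices come to rest one after the other: the velocity of \<open>s i\<close> has only its first
      \<open>i\<close> coordinates free, and is orthogonal to the edges to the \<open>i\<close> vertices that are already at rest.\<close>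
    have ws: "w (s i) = 0" if "i \<le> CARD('d)" for i
      using that
    proof (induction i rule: less_induct)
      case (less i)
      have sub: "{0..<i} \<subseteq> {0..CARD('d)}" using less.prems by auto
      show ?case
      proof (rule freely_movable_pinned_zero[OF p, of "s ` {0..<i}" "s i" "b ` {1..i}"])
        show "s ` {0..<i} \<subseteq> {1..n}" using s(2) sub by blast
        show "s i \<in> {1..n}" using s(2) less.prems by (simp add: image_subset_iff)
        show "s i \<notin> s ` {0..<i}"
          using inj_onD[OF s(1), of i] less.prems by force
        have "card (s ` {0..<i}) = i" using card_image[OF inj_on_subset[OF s(1) sub]] by simp
        then show "card (b ` {1..i}) \<le> card (s ` {0..<i})"
          using card_image_le[of "{1..i}" b] by simp
        fix u assume u: "u \<notin> b ` {1..i}"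
        obtain c where c: "u = b c" "c \<in> {1..CARD('d)}" using b unfolding bij_betw_def by (metis UNIV_I imageE)
        with u have "i < c" by (metis atLeastAtMost_iff image_eqI not_le)
        then have "(s i, u) \<in> pinned" unfolding pinned_def using c less.prems by blast
        then have "(s i, u) \<notin> J" by (simp add: J_def)
        then show "w (s i) $ u = 0" using w s(2) less.prems by (simp add: image_subset_iff)
      next
        fix k assume "k \<in> s ` {0..<i}"
        then obtain j where j: "k = s j" "j < i" by auto
        have "stationary p w (s i) (s j)" using stat s(2) less.prems j by (simp add: image_subset_iff)
        then show "(p (s i) - p k) \<bullet> w (s i) = 0"
          using less.IH[of j] j less.prems by (simp add: stationary_def)
      qed
    qed
    have w0: "w k = 0" if k: "k \<in> {1..n}" for k
    proof (cases "k \<in> s ` {0..CARD('d)}")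
      case True
      then show ?thesis using ws by auto
    next
      case False
      show ?thesis
      proof (rule freely_movable_pinned_zero[OF p, of "s ` {0..CARD('d)}" k UNIV])
        show "card (UNIV :: 'd set) \<le> card (s ` {0..CARD('d)})" using card_image[OF s(1)] by simp
        fix i assume i: "i \<in> s ` {0..CARD('d)}"
        then have "w i = 0" using ws by auto
        then show "(p k - p i) \<bullet> w k = 0" using stat[OF k, of i] i s(2) by (auto simp: stationary_def)
      qed (use s k False in auto)
    qed
    show "\<forall>v\<in>J. x v = 0"
    proof
      fix v assume v: "v \<in> J"
      then have "fst v \<in> {1..n}" by (auto simp: J_def)
      then show "x v = 0" using w0[of "fst v"] w[of "fst v" "snd v"] v by simp
    qed
  qed
  show "\<exists>b R. bij_betw b {1..CARD('d)} (UNIV :: 'd set) \<and> orthogonal_transformation R \<and>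
          (\<forall>i\<le>CARD('d). \<forall>c\<in>{1..CARD('d)}. i < c \<longrightarrow> R (q (s i) - q (s 0)) $ b c = 0) \<and>
          (\<forall>y. (\<forall>i\<le>CARD('d). \<forall>c\<in>{1..CARD('d)}. i < c \<longrightarrow> y (s i) $ b c = 0) \<longrightarrow>
             (\<exists>\<delta>. derivation \<delta> \<and> (\<forall>i\<in>{1..n}. dvec \<delta> (R (q i - q (s 0))) = y i)))"
  proof (intro exI[of _ b] exI[of _ R] conjI b R)
    show "\<forall>i\<le>CARD('d). \<forall>c\<in>{1..CARD('d)}. i < c \<longrightarrow> R (q (s i) - q (s 0)) $ b c = 0"
      using q'0 by (simp add: q'_def)
    show "\<forall>y. (\<forall>i\<le>CARD('d). \<forall>c\<in>{1..CARD('d)}. i < c \<longrightarrow> y (s i) $ b c = 0) \<longrightarrow>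
             (\<exists>\<delta>. derivation \<delta> \<and> (\<forall>i\<in>{1..n}. dvec \<delta> (R (q i - q (s 0))) = y i))"
    proof (intro allI impI)
      fix y :: "'d configuration"
      assume y: "\<forall>i\<le>CARD('d). \<forall>c\<in>{1..CARD('d)}. i < c \<longrightarrow> y (s i) $ b c = 0"
      obtain x where x: "\<And>e. e \<in> J \<Longrightarrow> (\<Sum>v\<in>J. M e v * x v) = y (fst e) $ snd e"
        using surj[of "\<lambda>e. y (fst e) $ snd e"] by blast
      define \<delta> where "\<delta> = (\<lambda>r. \<Sum>v\<in>J. x v * D v r)"
      have \<delta>: "derivation \<delta>" unfolding \<delta>_def by (rule combo)
      have "\<delta> (q' i $ u) = y i $ u" if "i \<in> {1..n}" for i u
      proof (cases "(i, u) \<in> J")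
        case True
        then show ?thesis using x[OF True] by (simp add: \<delta>_def M_def mult.commute)
      next
        case False
        then have "q' i $ u = 0" "y i $ u = 0" using that q'0 y by (auto simp: J_def pinned_def)
        then show ?thesis using derivation_0[OF \<delta>] by simp
      qed
      then have "\<forall>i\<in>{1..n}. dvec \<delta> (R (q i - q (s 0))) = y i"
        by (simp add: vec_eq_iff q'_def)
      then show "\<exists>\<delta>. derivation \<delta> \<and> (\<forall>i\<in>{1..n}. dvec \<delta> (R (q i - q (s 0))) = y i)"
        using \<delta> by blast
    qed
  qed
qed

text \<open>
  Put the points in triangular position.  The diagonal entries are not zero, because they can be given
  the derivative \<open>1\<close>, while the derivative of zero is zero.  A triangular system with nonzero diagonal
  has full rank.
\<close>

lemma free_modulo_congruence_affinely_free:
  fixes q :: "'d::finite configuration"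
  assumes q: "free_modulo_congruence n q" and I: "I \<subseteq> {1..n}" "card I = CARD('d) + 1"
  shows "affinely_free I q"
  unfolding affinely_free_def
proof (intro allI impI, elim conjE, rule ccontr)
  fix c assume c: "(\<Sum>i\<in>I. c i *\<^sub>R q i) = 0" "(\<Sum>i\<in>I. c i) = 0" and nz: "\<not> (\<forall>i\<in>I. c i = 0)"
  have "finite I" using I(1) finite_subset by blast
  from ex_bij_betw_nat_finite[OF this] obtain s where "bij_betw s {0..<card I} I" by blast
  then have s: "bij_betw s {0..CARD('d)} I" using I(2) by (simp add: atLeastLessThanSuc_atLeastAtMost)
  then have "inj_on s {0..CARD('d)} \<and> s ` {0..CARD('d)} \<subseteq> {1..n}"
    using I(1) by (auto simp: bij_betw_def)
  with q obtain b and R :: "real ^ 'd \<Rightarrow> real ^ 'd"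
    where R: "orthogonal_transformation R"
      and b: "bij_betw b {1..CARD('d)} (UNIV :: 'd set)"
      and tri: "\<And>i c. i \<le> CARD('d) \<Longrightarrow> c \<in> {1..CARD('d)} \<Longrightarrow> i < c \<Longrightarrow> R (q (s i) - q (s 0)) $ b c = 0"
      and move: "\<And>y. (\<forall>i\<le>CARD('d). \<forall>c\<in>{1..CARD('d)}. i < c \<longrightarrow> y (s i) $ b c = 0) \<Longrightarrow>
             (\<exists>\<delta>. derivation \<delta> \<and> (\<forall>i\<in>{1..n}. dvec \<delta> (R (q i - q (s 0))) = y i))"
    unfolding free_modulo_congruence_def by metis
  define c' where "c' = (\<lambda>j. c (s j))"
  have lin: "linear R" using R by (rule orthogonal_transformation_linear)
  have sum0: "(\<Sum>j\<in>{0..CARD('d)}. c' j) = 0"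
    using c(2) sum.reindex_bij_betw[OF s, of c] by (simp add: c'_def)
  have "(\<Sum>i\<in>I. c i *\<^sub>R (q i - q (s 0))) = (\<Sum>i\<in>I. c i *\<^sub>R q i) - (\<Sum>i\<in>I. c i) *\<^sub>R q (s 0)"
    by (simp add: scaleR_diff_right sum_subtractf scaleR_sum_left)
  also have "\<dots> = 0" using c by simp
  finally have "R (\<Sum>i\<in>I. c i *\<^sub>R (q i - q (s 0))) = 0" using linear_0[OF lin] by simp
  then have "(\<Sum>i\<in>I. c i *\<^sub>R R (q i - q (s 0))) = 0"
    by (simp add: linear_sum[OF lin] linear_scale[OF lin])
  then have Rsum: "(\<Sum>j\<in>{0..CARD('d)}. c' j *\<^sub>R R (q (s j) - q (s 0))) = 0"
    using sum.reindex_bij_betw[OF s, of "\<lambda>i. c i *\<^sub>R R (q i - q (s 0))"] by (simp add: c'_def)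
  define K where "K = {j \<in> {0..CARD('d)}. c' j \<noteq> 0}"
  have K: "finite K" "K \<noteq> {}"
    using nz s by (auto simp: K_def c'_def bij_betw_def)
  define m where "m = Max K"
  have m: "m \<le> CARD('d)" "c' m \<noteq> 0" using Max_in[OF K] by (auto simp: m_def K_def)
  have above: "c' j = 0" if "j \<le> CARD('d)" "m < j" for j
  proof (rule ccontr)
    assume "c' j \<noteq> 0"
    then have "j \<in> K" using that by (simp add: K_def)
    then show False using Max_ge[OF K(1), of j] that by (simp add: m_def)
  qed
  have m1: "m \<noteq> 0"
  proof
    assume "m = 0"
    then have "(\<Sum>j\<in>{0..CARD('d)}. c' j) = (\<Sum>j\<in>{0}. c' j)"
      using above by (intro sum.mono_neutral_right) auto
    then show False using sum0 m \<open>m = 0\<close> by simp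
  qed
  \<comment> \<open>In coordinate \<open>b m\<close> only the vertex \<open>s m\<close> contributes to the dependency.\<close>
  have "0 = (\<Sum>j\<in>{0..CARD('d)}. c' j * R (q (s j) - q (s 0)) $ b m)"
    using arg_cong[OF Rsum, of "\<lambda>z. z $ b m"] by (simp add: sum_component)
  also have "\<dots> = (\<Sum>j\<in>{m}. c' j * R (q (s j) - q (s 0)) $ b m)"
  proof (rule sum.mono_neutral_right)
    show "\<forall>j\<in>{0..CARD('d)} - {m}. c' j * R (q (s j) - q (s 0)) $ b m = 0"
    proof
      fix j assume j: "j \<in> {0..CARD('d)} - {m}"
      then consider "j < m" | "m < j" by fastforce
      then show "c' j * R (q (s j) - q (s 0)) $ b m = 0"
      proof cases
        case 1
        then show ?thesis using tri[of j m] j m by simp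
      next
        case 2
        then show ?thesis using above[of j] j by simp
      qed
    qed
  qed (use m in auto)
  finally have diag: "R (q (s m) - q (s 0)) $ b m = 0" using m(2) by simp
  define y where "y = (\<lambda>i. if i = s m then axis (b m) (1::real) else 0)"
  have "\<forall>i\<le>CARD('d). \<forall>c\<in>{1..CARD('d)}. i < c \<longrightarrow> y (s i) $ b c = 0"
  proof (intro allI impI ballI)
    fix i c assume ic: "i \<le> CARD('d)" "c \<in> {1..CARD('d)}" "i < c"
    have "i = m" if "s i = s m"
      using inj_onD[OF bij_betw_imp_inj_on[OF s] that] ic m by simp
    moreover have "b c \<noteq> b m" if "i = m"
      using inj_onD[OF bij_betw_imp_inj_on[OF b], of c m] ic m m1 that by auto
    ultimately show "y (s i) $ b c = 0" by (auto simp: y_def axis_def)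
  qed
  from move[OF this] obtain \<delta> where \<delta>: "derivation \<delta>" "\<And>i. i \<in> {1..n} \<Longrightarrow> dvec \<delta> (R (q i - q (s 0))) = y i"
    by blast
  have "s m \<in> {1..n}" using bij_betwE[OF s] m(1) I(1) by fastforce
  from \<delta>(2)[OF this] have "\<delta> (R (q (s m) - q (s 0)) $ b m) = 1"
    by (simp add: vec_eq_iff y_def axis_def)
  then show False using diag derivation_0[OF \<delta>(1)] by simp
qed

lemma edges_on_finite: "finite (edges_on n)"
proof -
  have "edges_on n \<subseteq> (\<lambda>(i, j). {i, j}) ` ({1..n} \<times> {1..n})" by (auto simp: edges_on_def)
  then show ?thesis by (rule finite_subset) auto
qed

text \<open>
  Applied to a derivation that moves \<open>x\<close> alone, the hypothesis on \<open>\<omega>\<close> is the component of the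
  equilibrium condition at \<open>x\<close> in the direction of the motion.
\<close>

lemma free_modulo_congruence_equilibrium:
  fixes q :: "'d::finite configuration"
  assumes q: "free_modulo_congruence n q" and n: "n \<ge> CARD('d) + 1"
    and F: "F \<subseteq> edges_on n"
    and \<omega>: "\<And>\<delta>. derivation \<delta> \<Longrightarrow> (\<Sum>f\<in>F. \<omega> f * \<delta> (edge_sqlength q f)) = 0"
    and x: "x \<in> {1..n}"
  shows "(\<Sum>y | {x, y} \<in> F. \<omega> {x, y} *\<^sub>R (q x - q y)) = 0"
proof -
  have "CARD('d) \<le> card ({1..n} - {x})" using n x by simp
  then obtain I where I: "I \<subseteq> {1..n} - {x}" "card I = CARD('d)" "finite I"
    by (metis obtain_subset_with_card_n)
  obtain s0 where s0: "bij_betw s0 {0..<CARD('d)} I"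
    using ex_bij_betw_nat_finite[OF I(3)] I(2) by auto
  define s where "s = s0(CARD('d) := x)"
  have sI: "s i = s0 i" if "i < CARD('d)" for i using that by (simp add: s_def)
  have sI': "s i \<in> I" if "i < CARD('d)" for i using that s0 sI[OF that] by (auto simp: bij_betw_def)
  have sx: "s CARD('d) = x" by (simp add: s_def)
  have set: "{0..CARD('d)} = insert CARD('d) {0..<CARD('d)}" by auto
  have "inj_on s {0..CARD('d)}"
  proof -
    have "inj_on s {0..<CARD('d)}"
      using s0 sI unfolding bij_betw_def by (metis (no_types, lifting) atLeastLessThan_iff inj_on_cong)
    moreover have "x \<notin> s ` {0..<CARD('d)}" using sI' I(1) by fastforce
    ultimately show ?thesis unfolding set inj_on_insert using sx by auto
  qed
  moreover have "s ` {0..CARD('d)} \<subseteq> {1..n}"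
    unfolding set using sx sI' I(1) x by fastforce
  ultimately obtain b and R :: "real ^ 'd \<Rightarrow> real ^ 'd"
    where R: "orthogonal_transformation R"
      and b: "bij_betw b {1..CARD('d)} (UNIV :: 'd set)"
      and move: "\<And>y. (\<forall>i\<le>CARD('d). \<forall>c\<in>{1..CARD('d)}. i < c \<longrightarrow> y (s i) $ b c = 0) \<Longrightarrow>
             (\<exists>\<delta>. derivation \<delta> \<and> (\<forall>i\<in>{1..n}. dvec \<delta> (R (q i - q (s 0))) = y i))"
    using q unfolding free_modulo_congruence_def by metis
  have lin: "linear R" using R by (rule orthogonal_transformation_linear)
  define t where "t = (\<Sum>y | {x, y} \<in> F. \<omega> {x, y} *\<^sub>R (q x - q y))"
  let ?Y = "{y. {x, y} \<in> F}"
  \<comment> \<open>\<open>x\<close> is in the last, unpinned position, so it may move alone, and in the direction \<open>R t\<close>.\<close>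
  have "\<forall>i\<le>CARD('d). \<forall>c\<in>{1..CARD('d)}. i < c \<longrightarrow> (if s i = x then R t else 0) $ b c = 0"
  proof (intro allI impI ballI)
    fix i c assume ic: "i \<le> CARD('d)" "c \<in> {1..CARD('d)}" "i < c"
    then have "s i \<noteq> x" using sI'[of i] I(1) by auto
    then show "(if s i = x then R t else 0) $ b c = 0" by simp
  qed
  from move[OF this] obtain \<delta> where \<delta>: "derivation \<delta>"
    "\<And>i. i \<in> {1..n} \<Longrightarrow> dvec \<delta> (R (q i - q (s 0))) = (if i = x then R t else 0)" by blast
  have len: "\<delta> (edge_sqlength q {i, j})
      = 2 * (R (q i - q j) \<bullet> ((if i = x then R t else 0) - (if j = x then R t else 0)))"
    if "i \<in> {1..n}" "j \<in> {1..n}" for i j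
  proof -
    have "R (q i - q (s 0)) - R (q j - q (s 0)) = R (q i - q j)" by (simp add: linear_diff[OF lin])
    moreover from this have "dvec \<delta> (R (q i - q j)) = (if i = x then R t else 0) - (if j = x then R t else 0)"
      using dvec_diff[OF \<delta>(1), of "R (q i - q (s 0))" "R (q j - q (s 0))"]
        \<delta>(2)[OF that(1)] \<delta>(2)[OF that(2)] by simp
    ultimately show ?thesis
      using edge_sqlength_isometry[OF R, of q i j "q (s 0)"]
        derivation_sq_norm[OF \<delta>(1), of "R (q i - q j)"] by simp
  qed
  have nx: "{x, y} \<in> F \<Longrightarrow> y \<in> {1..n} \<and> y \<noteq> x" for y
    using F by (auto simp: edges_on_def doubleton_eq_iff)
  have "0 = (\<Sum>f\<in>F. \<omega> f * \<delta> (edge_sqlength q f))" using \<omega>[OF \<delta>(1)] by simp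
  also have "\<dots> = (\<Sum>f\<in>{f \<in> F. x \<in> f}. \<omega> f * \<delta> (edge_sqlength q f))"
  proof (rule sum.mono_neutral_right)
    show "finite F" using F edges_on_finite finite_subset by blast
    show "\<forall>f\<in>F - {f \<in> F. x \<in> f}. \<omega> f * \<delta> (edge_sqlength q f) = 0"
    proof
      fix f assume f: "f \<in> F - {f \<in> F. x \<in> f}"
      then have "f \<in> edges_on n" using F by blast
      then obtain i j where "f = {i, j}" "i \<in> {1..n}" "j \<in> {1..n}" by (rule edges_onE)
      then show "\<omega> f * \<delta> (edge_sqlength q f) = 0" using f len by auto
    qed
  qed auto
  also have "\<dots> = (\<Sum>y\<in>?Y. \<omega> {x, y} * \<delta> (edge_sqlength q {x, y}))"
  proof (rule sum.reindex_cong[where l = "\<lambda>y. {x, y}"])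
    show "inj_on (\<lambda>y. {x, y}) ?Y" by (auto simp: inj_on_def doubleton_eq_iff)
    show "{f \<in> F. x \<in> f} = (\<lambda>y. {x, y}) ` ?Y"
    proof
      show "{f \<in> F. x \<in> f} \<subseteq> (\<lambda>y. {x, y}) ` ?Y"
      proof
        fix f assume f: "f \<in> {f \<in> F. x \<in> f}"
        then have "f \<in> edges_on n" using F by blast
        then obtain i j where "f = {i, j}" by (rule edges_onE)
        then have "\<exists>y. f = {x, y}" using f by auto
        then show "f \<in> (\<lambda>y. {x, y}) ` ?Y" using f by auto
      qed
    qed auto
  qed auto
  also have "\<dots> = (\<Sum>y\<in>?Y. 2 * ((\<omega> {x, y} *\<^sub>R R (q x - q y)) \<bullet> R t))"
    using len x nx by (intro sum.cong) auto
  also have "\<dots> = 2 * (R t \<bullet> R t)"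
    by (simp add: t_def linear_sum[OF lin] linear_scale[OF lin] inner_sum_left sum_distrib_left)
  finally have "norm (R t) = 0" by simp
  then show ?thesis using orthogonal_transformation_norm[OF R, of t] by (simp add: t_def)
qed

section \<open>Complete graphs\<close>

definition complete_edges :: "nat set \<Rightarrow> nat set set" where
  "complete_edges S = {{i, j} | i j. i \<in> S \<and> j \<in> S \<and> i \<noteq> j}"

lemma edges_on_eq_complete: "edges_on n = complete_edges {1..n}"
  by (simp add: edges_on_def complete_edges_def)

lemma complete_edges_alt: "complete_edges S = {e. e \<subseteq> S \<and> card e = 2}"
  unfolding complete_edges_def card_2_iff by blast

lemma complete_edgesI: "i \<in> S \<Longrightarrow> j \<in> S \<Longrightarrow> i \<noteq> j \<Longrightarrow> {i, j} \<in> complete_edges S"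
  by (auto simp: complete_edges_def)

lemma complete_edgesE:
  assumes "e \<in> complete_edges S"
  obtains i j where "e = {i, j}" "i \<in> S" "j \<in> S" "i \<noteq> j"
  using assms by (auto simp: complete_edges_def)

lemma pair_in_complete_edges [simp]:
  "{i, j} \<in> complete_edges S \<longleftrightarrow> i \<in> S \<and> j \<in> S \<and> i \<noteq> j"
  by (auto simp: complete_edges_def doubleton_eq_iff)

lemma complete_edges_eqI:
  assumes "e \<in> complete_edges S" "i \<in> e" "j \<in> e" "i \<noteq> j"
  shows "e = {i, j}"
  using assms by (auto elim!: complete_edgesE)

lemma complete_edges_mono: "S \<subseteq> T \<Longrightarrow> complete_edges S \<subseteq> complete_edges T"
  by (auto simp: complete_edges_def)

lemma finite_complete_edges: "finite S \<Longrightarrow> finite (complete_edges S)"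
  by (simp add: complete_edges_alt)

lemma card_complete_edges: "finite S \<Longrightarrow> card (complete_edges S) = card S choose 2"
  by (simp add: complete_edges_alt n_subsets)

lemma sum_complete_edges:
  fixes g :: "nat set \<Rightarrow> real"
  assumes "finite S"
  shows "(\<Sum>i\<in>S. \<Sum>j\<in>S - {i}. g {i, j}) = 2 * (\<Sum>e\<in>complete_edges S. g e)"
  using assms
proof (induction S rule: finite_induct)
  case empty
  show ?case by (simp add: complete_edges_def)
next
  case (insert x S)
  have "(\<Sum>i\<in>S. \<Sum>j\<in>insert x S - {i}. g {i, j}) = (\<Sum>i\<in>S. g {x, i} + (\<Sum>j\<in>S - {i}. g {i, j}))"
  proof (rule sum.cong[OF refl])
    fix i assume "i \<in> S"
    then have "insert x S - {i} = insert x (S - {i})" using insert by auto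
    then show "(\<Sum>j\<in>insert x S - {i}. g {i, j}) = g {x, i} + (\<Sum>j\<in>S - {i}. g {i, j})"
      using insert by (simp add: insert_commute)
  qed
  moreover have "insert x S - {x} = S" using insert by auto
  ultimately have lhs: "(\<Sum>i\<in>insert x S. \<Sum>j\<in>insert x S - {i}. g {i, j})
      = 2 * (\<Sum>j\<in>S. g {x, j}) + 2 * (\<Sum>e\<in>complete_edges S. g e)"
    using insert by (simp add: sum.distrib)
  have "complete_edges (insert x S) = complete_edges S \<union> (\<lambda>j. {x, j}) ` S"
    using insert(2) by (auto simp: complete_edges_def)
  moreover have "complete_edges S \<inter> (\<lambda>j. {x, j}) ` S = {}"
    using insert(2) by (auto simp: complete_edges_alt)
  moreover have "inj_on (\<lambda>j. {x, j}) S" by (auto simp: inj_on_def doubleton_eq_iff)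
  ultimately have "(\<Sum>e\<in>complete_edges (insert x S). g e)
      = (\<Sum>e\<in>complete_edges S. g e) + (\<Sum>j\<in>S. g {x, j})"
    using insert(1) by (simp add: sum.union_disjoint finite_complete_edges sum.reindex)
  then show ?case using lhs by simp
qed

text \<open>
  The degree bound gives \<open>m * card V \<le> 2 * card F = (m + 1) * m\<close>, so there are at most \<open>m + 1\<close> vertices,
  and on so few vertices only the complete graph has enough edges.
\<close>

lemma complete_graph_if_large_degree:
  assumes F: "finite F" "\<And>f. f \<in> F \<Longrightarrow> card f = 2" "card F = (m + 1) choose 2"
    and deg: "\<And>x. x \<in> \<Union>F \<Longrightarrow> card {f \<in> F. x \<in> f} \<ge> m" and m: "m > 0"
  shows "card (\<Union>F) = m + 1 \<and> F = complete_edges (\<Union>F)"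
proof -
  let ?V = "\<Union>F"
  have fin: "finite f" if "f \<in> F" for f using F(2)[OF that] by (metis card.infinite zero_neq_numeral)
  have finV: "finite ?V" using F(1) fin by blast
  have "(\<Sum>x\<in>?V. card {f \<in> F. x \<in> f}) = 2 * card F"
  proof (rule sum_multicount[OF finV F(1)], rule ballI)
    fix f assume "f \<in> F"
    then have "{x \<in> ?V. x \<in> f} = f" by auto
    then show "card {x \<in> ?V. x \<in> f} = 2" using F(2) \<open>f \<in> F\<close> by simp
  qed
  moreover have "(\<Sum>x\<in>?V. card {f \<in> F. x \<in> f}) \<ge> (\<Sum>x\<in>?V. m)"
    using deg by (rule sum_mono)
  moreover have "2 * ((m + 1) choose 2) = (m + 1) * m"
    by (simp add: choose_two)
  ultimately have "card ?V * m \<le> (m + 1) * m" using F(3) by simp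
  then have le: "card ?V \<le> m + 1" using m by (metis mult_le_cancel2)
  have sub: "F \<subseteq> complete_edges ?V" using F(2) by (auto simp: complete_edges_alt)
  then have "card F \<le> card ?V choose 2"
    using card_mono[OF finite_complete_edges[OF finV] sub] card_complete_edges[OF finV] by simp
  then have ge: "card ?V \<ge> m + 1"
  proof (rule contrapos_pp)
    assume "\<not> m + 1 \<le> card ?V"
    then have "card ?V \<le> m" by simp
    then have "card ?V choose 2 \<le> m choose 2" by (rule binomial_right_mono)
    also have "\<dots> < (m + 1) choose 2" using m by (simp add: choose_two numeral_2_eq_2)
    finally show "\<not> card F \<le> card ?V choose 2" using F(3) by simp
  qed
  then have V: "card ?V = m + 1" using le by simp
  then have "card F = card (complete_edges ?V)" using F(3) card_complete_edges[OF finV] by simp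
  then have "F = complete_edges ?V"
    using card_subset_eq[OF finite_complete_edges[OF finV] sub] by simp
  then show ?thesis using V by simp
qed

text \<open>
  A family of pairwise intersecting edges is a star or a triangle.
\<close>

lemma intersecting_pairs:
  assumes X: "X \<subseteq> complete_edges V" "card X \<ge> 3"
    and int: "\<And>e f. e \<in> X \<Longrightarrow> f \<in> X \<Longrightarrow> e \<inter> f \<noteq> {}"
  shows "(\<exists>a. \<forall>e\<in>X. a \<in> e) \<or>
    (\<exists>a b c. a \<noteq> b \<and> a \<noteq> c \<and> b \<noteq> c \<and> X = {{a, b}, {a, c}, {b, c}})"
proof -
  have "\<not> (\<exists>e. X \<subseteq> {e})"
  proof
    assume "\<exists>e. X \<subseteq> {e}"
    then obtain e where "X \<subseteq> {e}" by blast
    then have "card X \<le> card {e}" by (intro card_mono) auto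
    then show False using X(2) by simp
  qed
  then obtain e f where ef: "e \<in> X" "f \<in> X" "e \<noteq> f" by blast
  obtain a where a: "a \<in> e" "a \<in> f" using int[OF ef(1,2)] by blast
  obtain b where b: "e = {a, b}" "a \<noteq> b" using ef(1) X(1) a(1) by (blast elim: complete_edgesE)
  obtain c where c: "f = {a, c}" "a \<noteq> c" using ef(2) X(1) a(2) by (blast elim: complete_edgesE)
  have bc: "b \<noteq> c" using ef b c by auto
  show ?thesis
  proof (cases "\<forall>e\<in>X. a \<in> e")
    case False
    then obtain g where g: "g \<in> X" "a \<notin> g" by blast
    have "b \<in> g" "c \<in> g" using int[OF g(1) ef(1)] int[OF g(1) ef(2)] g b c by auto
    then have g': "g = {b, c}" using complete_edges_eqI[of g V b c] g X(1) bc by blast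
    have "h \<in> {{a, b}, {a, c}, {b, c}}" if h: "h \<in> X" for h
    proof -
      have "a \<in> h \<or> b \<in> h" "a \<in> h \<or> c \<in> h" "b \<in> h \<or> c \<in> h"
        using int[OF h ef(1)] int[OF h ef(2)] int[OF h g(1)] b c g' by auto
      then show ?thesis
        using complete_edges_eqI[of h V] h X(1) b(2) c(2) bc by blast
    qed
    then have "X = {{a, b}, {a, c}, {b, c}}" using ef g b c g' by blast
    then show ?thesis using b(2) c(2) bc by blast
  qed blast
qed

section \<open>Affine circuits\<close>

definition affine_relation :: "nat set \<Rightarrow> 'd::finite configuration \<Rightarrow> (nat \<Rightarrow> real) \<Rightarrow> bool" where
  "affine_relation S p c \<longleftrightarrow> (\<Sum>i\<in>S. c i *\<^sub>R p i) = 0 \<and> (\<Sum>i\<in>S. c i) = 0"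

text \<open>
  A minimal affinely dependent set, with its relation \<open>l\<close>, which is unique up to a factor.
\<close>

definition affine_circuit :: "nat set \<Rightarrow> 'd::finite configuration \<Rightarrow> (nat \<Rightarrow> real) \<Rightarrow> bool" where
  "affine_circuit S p l \<longleftrightarrow> finite S \<and> affine_relation S p l \<and> (\<forall>i\<in>S. l i \<noteq> 0) \<and>
     (\<forall>c. affine_relation S p c \<longrightarrow> (\<exists>r. \<forall>i\<in>S. c i = r * l i))"

lemma affine_relation_restrict:
  assumes "finite S" "affine_relation S p c" "k \<in> S" "c k = 0"
  shows "affine_relation (S - {k}) p c"
  using assms by (simp add: affine_relation_def sum.remove[of S k])

lemma affine_circuit_exists:
  fixes p :: "'d::finite configuration"
  assumes S: "finite S" "card S = CARD('d) + 2"
    and free: "\<And>k. k \<in> S \<Longrightarrow> affinely_free (S - {k}) p"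
  shows "\<exists>l. affine_circuit S p l"
proof -
  have zero: "\<forall>i\<in>S. c i = 0" if "affine_relation S p c" "k \<in> S" "c k = 0" for c k
  proof -
    have "c i = 0" if "i \<in> S - {k}" for i
      using affine_relation_restrict[OF S(1) \<open>affine_relation S p c\<close> \<open>k \<in> S\<close> \<open>c k = 0\<close>]
        affinely_freeD[OF free[OF \<open>k \<in> S\<close>] _ _ that]
      unfolding affine_relation_def by blast
    then show ?thesis using that by auto
  qed
  obtain l where l: "\<exists>i\<in>S. l i \<noteq> 0" "affine_relation S p l"
    using affine_relation_exists[OF S(1), of p] S(2) unfolding affine_relation_def by auto
  have nz: "\<forall>i\<in>S. l i \<noteq> 0" using zero[OF l(2)] l(1) by blast
  have "\<exists>r. \<forall>i\<in>S. c i = r * l i" if c: "affine_relation S p c" for c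
  proof -
    obtain k where k: "k \<in> S" using l by blast
    define r where "r = c k / l k"
    have "affine_relation S p (\<lambda>i. c i - r * l i)"
    proof -
      have "(\<Sum>i\<in>S. (c i - r * l i) *\<^sub>R p i) = (\<Sum>i\<in>S. c i *\<^sub>R p i) - r *\<^sub>R (\<Sum>i\<in>S. l i *\<^sub>R p i)"
        by (simp add: scaleR_diff_left sum_subtractf scaleR_sum_right)
      moreover have "(\<Sum>i\<in>S. c i - r * l i) = (\<Sum>i\<in>S. c i) - r * (\<Sum>i\<in>S. l i)"
        by (simp add: sum_subtractf sum_distrib_left)
      ultimately show ?thesis using c l(2) by (simp add: affine_relation_def)
    qed
    moreover have "c k - r * l k = 0" using nz k by (simp add: r_def)
    ultimately have "\<forall>i\<in>S. c i - r * l i = 0" using zero[OF _ k] by blast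
    then have "\<forall>i\<in>S. c i = r * l i" by (simp only: right_minus_eq)
    then show ?thesis by (rule exI)
  qed
  then show ?thesis using l nz S(1) unfolding affine_circuit_def by blast
qed

text \<open>
  The products \<open>l i * l j\<close> are an equilibrium stress of the complete graph on \<open>S\<close>: the forces at \<open>i\<close> sum
  to \<open>l i\<close> times \<open>\<Sum>j. l j *\<^sub>R (p i - p j) = (\<Sum>j. l j) *\<^sub>R p i - (\<Sum>j. l j *\<^sub>R p j)\<close>, which vanishes.
\<close>

lemma affine_relation_stress:
  assumes S: "finite S" and l: "affine_relation S p l" and \<delta>: "derivation \<delta>"
  shows "(\<Sum>e\<in>complete_edges S. prod l e * \<delta> (edge_sqlength p e)) = 0"
proof -
  define w where "w = (\<lambda>i. dvec \<delta> (p i))"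
  have half: "(\<Sum>i\<in>S. \<Sum>j\<in>S. (l i * l j) * ((p i - p j) \<bullet> w i)) = 0"
  proof -
    have "(\<Sum>j\<in>S. (l i * l j) * ((p i - p j) \<bullet> w i)) = 0" for i
    proof -
      have "(\<Sum>j\<in>S. (l i * l j) * ((p i - p j) \<bullet> w i)) = l i * ((\<Sum>j\<in>S. l j *\<^sub>R (p i - p j)) \<bullet> w i)"
        by (simp add: inner_sum_left sum_distrib_left mult.assoc)
      also have "(\<Sum>j\<in>S. l j *\<^sub>R (p i - p j)) = (\<Sum>j\<in>S. l j) *\<^sub>R p i - (\<Sum>j\<in>S. l j *\<^sub>R p j)"
        by (simp add: scaleR_diff_right sum_subtractf scaleR_sum_left)
      also have "\<dots> = 0" using l by (simp add: affine_relation_def)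
      finally show ?thesis by simp
    qed
    then show ?thesis by simp
  qed
  have "2 * (\<Sum>e\<in>complete_edges S. prod l e * \<delta> (edge_sqlength p e))
      = (\<Sum>i\<in>S. \<Sum>j\<in>S - {i}. prod l {i, j} * \<delta> (edge_sqlength p {i, j}))"
    by (rule sum_complete_edges[OF S, symmetric])
  also have "\<dots> = (\<Sum>i\<in>S. \<Sum>j\<in>S. 2 * ((l i * l j) * ((p i - p j) \<bullet> (w i - w j))))"
  proof (rule sum.cong[OF refl])
    fix i assume i: "i \<in> S"
    have "(\<Sum>j\<in>S - {i}. prod l {i, j} * \<delta> (edge_sqlength p {i, j}))
       = (\<Sum>j\<in>S - {i}. 2 * ((l i * l j) * ((p i - p j) \<bullet> (w i - w j))))"
      by (rule sum.cong) (auto simp: edge_sqlength_derivation[OF \<delta>] w_def)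
    also have "\<dots> = (\<Sum>j\<in>S. 2 * ((l i * l j) * ((p i - p j) \<bullet> (w i - w j))))"
      using i S by (simp add: sum.remove[of S i])
    finally show "(\<Sum>j\<in>S - {i}. prod l {i, j} * \<delta> (edge_sqlength p {i, j}))
       = (\<Sum>j\<in>S. 2 * ((l i * l j) * ((p i - p j) \<bullet> (w i - w j))))" .
  qed
  also have "\<dots> = 2 * ((\<Sum>i\<in>S. \<Sum>j\<in>S. (l i * l j) * ((p i - p j) \<bullet> w i))
      + (\<Sum>i\<in>S. \<Sum>j\<in>S. (l i * l j) * ((p j - p i) \<bullet> w j)))"
  proof -
    have "2 * ((l i * l j) * ((p i - p j) \<bullet> (w i - w j)))
        = 2 * ((l i * l j) * ((p i - p j) \<bullet> w i)) + 2 * ((l i * l j) * ((p j - p i) \<bullet> w j))" for i j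
      by (simp add: inner_diff_left inner_diff_right algebra_simps)
    then show ?thesis by (simp only: sum.distrib distrib_left sum_distrib_left)
  qed
  also have "(\<Sum>i\<in>S. \<Sum>j\<in>S. (l i * l j) * ((p j - p i) \<bullet> w j))
      = (\<Sum>i\<in>S. \<Sum>j\<in>S. (l i * l j) * ((p i - p j) \<bullet> w i))"
    by (subst sum.swap) (simp add: mult.commute)
  finally show ?thesis using half by simp
qed

lemma derivation_Rats:
  assumes \<delta>: "derivation \<delta>" and "x \<in> \<rat>"
  shows "\<delta> x = 0"
proof -
  have nat: "\<delta> (of_nat k) = 0" for k
    by (induction k) (simp_all add: derivation_0[OF \<delta>] derivation_1[OF \<delta>] derivation_add[OF \<delta>])
  have int: "\<delta> (of_int k) = 0" for k
    by (cases k rule: int_cases2) (simp_all add: nat derivation_minus[OF \<delta>])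
  obtain a b :: int where ab: "b > 0" "x = of_int a / of_int b"
    using Rats_cases'[OF assms(2)] by metis
  then have "of_int a = x * of_int b" by simp
  then have "\<delta> (of_int a) = x * \<delta> (of_int b) + of_int b * \<delta> x" using derivation_mult[OF \<delta>] by simp
  then show ?thesis using int ab by simp
qed

lemma derivation_inverse:
  assumes \<delta>: "derivation \<delta>" and "x \<noteq> 0"
  shows "\<delta> (1 / x) = - \<delta> x / x\<^sup>2"
proof -
  have "0 = \<delta> (x * (1 / x))" using derivation_1[OF \<delta>] assms by simp
  also have "\<dots> = x * \<delta> (1 / x) + (1 / x) * \<delta> x" by (rule derivation_mult[OF \<delta>])
  finally show ?thesis using assms(2) by (simp add: field_simps power2_eq_square)
qed

text \<open>
  The logarithmic derivatives of the \<open>l i\<close> can be prescribed, up to the common summand \<open>r\<close> that a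
  rescaling of \<open>l\<close> produces, subject only to the derivative of \<open>\<Sum>i. l i = 0\<close>.  It suffices to move one
  point \<open>k\<close>: the velocity \<open>z\<close> is chosen such that the differentiated affine relation has the wanted
  derivatives as a solution, and the solution is unique up to \<open>r\<close>.
\<close>

lemma circuit_log_derivation:
  assumes p: "freely_movable n p" and S: "S \<subseteq> {1..n}" "S \<noteq> {}" and l: "affine_circuit S p l"
    and x: "(\<Sum>i\<in>S. l i * x i) = 0"
  shows "\<exists>\<delta> r. derivation \<delta> \<and> (\<forall>i\<in>S. \<delta> (l i) = l i * (x i + r))"
proof -
  have fin: "finite S" and rel: "affine_relation S p l" and nz: "\<forall>i\<in>S. l i \<noteq> 0"
    using l by (auto simp: affine_circuit_def)
  obtain k where k: "k \<in> S" using S(2) by blast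
  define z where "z = (- 1 / l k) *\<^sub>R (\<Sum>i\<in>S. (l i * x i) *\<^sub>R p i)"
  obtain \<delta> where \<delta>: "derivation \<delta>" "\<And>i. i \<in> {1..n} \<Longrightarrow> dvec \<delta> (p i) = (if i = k then z else 0)"
    using freely_movable_obtain[OF p, of "\<lambda>i. if i = k then z else 0"] by metis
  have "0 = dvec \<delta> (\<Sum>i\<in>S. l i *\<^sub>R p i)" using rel \<delta>(1) by (simp add: affine_relation_def dvec_0)
  also have "\<dots> = (\<Sum>i\<in>S. l i *\<^sub>R dvec \<delta> (p i)) + (\<Sum>i\<in>S. \<delta> (l i) *\<^sub>R p i)"
    using \<delta>(1) by (simp add: dvec_sum dvec_scaleR sum.distrib)
  also have "(\<Sum>i\<in>S. l i *\<^sub>R dvec \<delta> (p i)) = (\<Sum>i\<in>S. if i = k then l i *\<^sub>R z else 0)"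
    using S(1) \<delta>(2) by (intro sum.cong) auto
  also have "\<dots> = - (\<Sum>i\<in>S. (l i * x i) *\<^sub>R p i)" using k fin nz by (simp add: z_def)
  finally have 1: "(\<Sum>i\<in>S. (\<delta> (l i) - l i * x i) *\<^sub>R p i) = 0"
    by (simp add: scaleR_diff_left sum_subtractf)
  have "(\<Sum>i\<in>S. \<delta> (l i)) = \<delta> (\<Sum>i\<in>S. l i)" by (rule derivation_sum[OF \<delta>(1), symmetric])
  also have "\<dots> = 0" using rel derivation_0[OF \<delta>(1)] by (simp add: affine_relation_def)
  finally have "(\<Sum>i\<in>S. \<delta> (l i) - l i * x i) = 0" using x by (simp add: sum_subtractf)
  with 1 have "affine_relation S p (\<lambda>i. \<delta> (l i) - l i * x i)" by (simp add: affine_relation_def)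
  then obtain r where "\<forall>i\<in>S. \<delta> (l i) - l i * x i = r * l i"
    using l unfolding affine_circuit_def by blast
  then have "\<forall>i\<in>S. \<delta> (l i) = l i * (x i + r)" by (simp add: algebra_simps)
  then show ?thesis using \<delta>(1) by blast
qed

text \<open>
  A third vertex \<open>k\<close> makes room to change \<open>l i\<close> without changing \<open>l j\<close>.
\<close>

lemma circuit_ratio_irrational:
  assumes p: "freely_movable n p" and S: "S \<subseteq> {1..n}" "card S \<ge> 3" and l: "affine_circuit S p l"
    and ij: "i \<in> S" "j \<in> S" "i \<noteq> j" and g: "g \<in> \<rat>"
  shows "l i \<noteq> g * l j"
proof
  assume eq: "l i = g * l j"
  have fin: "finite S" and nz: "\<forall>i\<in>S. l i \<noteq> 0" using l by (auto simp: affine_circuit_def)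
  have "\<not> S \<subseteq> {i, j}"
  proof
    assume "S \<subseteq> {i, j}"
    then have "card S \<le> card {i, j}" by (intro card_mono) auto
    then show False using S(2) ij(3) by simp
  qed
  then obtain k where k: "k \<in> S" "k \<noteq> i" "k \<noteq> j" by blast
  define x where "x = (\<lambda>a. if a = i then 1 / l i else if a = k then - 1 / l k else 0)"
  have "(\<Sum>a\<in>S. l a * x a) = (\<Sum>a\<in>{i, k}. l a * x a)"
    using ij k fin by (intro sum.mono_neutral_right) (auto simp: x_def)
  also have "\<dots> = 0" using ij k nz by (simp add: x_def)
  finally obtain \<delta> r where \<delta>: "derivation \<delta>" and d: "\<forall>i\<in>S. \<delta> (l i) = l i * (x i + r)"
    using circuit_log_derivation[OF p S(1) _ l] ij by blast
  have "\<delta> (l i) = g * \<delta> (l j)"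
    using derivation_mult[OF \<delta>, of g "l j"] derivation_Rats[OF \<delta> g] eq by simp
  then have "l i * (x i + r) = g * (l j * (x j + r))" using d ij by simp
  then have "l i * (x i + r) = l i * (x j + r)" using eq by simp
  then have "x i = x j" using nz ij by simp
  then show False using ij k nz by (auto simp: x_def)
qed

lemma two_elements:
  fixes S :: "nat set"
  assumes "card S \<ge> 3"
  obtains i j where "i \<in> S" "j \<in> S" "i \<noteq> j"
proof -
  have "finite S" using assms by (metis card.infinite not_numeral_le_zero)
  then have "\<not> (\<forall>i\<in>S. \<forall>j\<in>S. i = j)" using assms card_le_Suc0_iff_eq[of S] by auto
  then show ?thesis using that by blast
qed

lemma proportional_if_kernel_subset:
  fixes l \<gamma> :: "nat \<Rightarrow> real"
  assumes S: "finite S" and nz: "\<forall>i\<in>S. l i \<noteq> 0"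
    and ker: "\<And>x. (\<Sum>i\<in>S. l i * x i) = 0 \<Longrightarrow> (\<Sum>i\<in>S. \<gamma> i * x i) = 0"
  shows "\<exists>t. \<forall>i\<in>S. \<gamma> i = t * l i"
proof (cases "S = {}")
  case False
  then obtain k where k: "k \<in> S" by blast
  have "\<gamma> i = (\<gamma> k / l k) * l i" if i: "i \<in> S" for i
  proof (cases "i = k")
    case False
    define x where "x = (\<lambda>a. if a = i then 1 / l i else if a = k then - 1 / l k else 0)"
    have "(\<Sum>a\<in>S. h a * x a) = (\<Sum>a\<in>{i, k}. h a * x a)" for h
      using i k S by (intro sum.mono_neutral_right) (auto simp: x_def)
    then have *: "(\<Sum>a\<in>S. h a * x a) = h i / l i - h k / l k" for h
      using False by (simp add: x_def)
    have "(\<Sum>a\<in>S. l a * x a) = 0" using * i k nz by simp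
    from ker[OF this] have "\<gamma> i / l i = \<gamma> k / l k" using * by simp
    then show ?thesis using nz i by (simp add: field_simps)
  qed (use nz k in simp)
  then show ?thesis by blast
qed simp

text \<open>
  Otherwise the logarithmic derivative of \<open>\<Sum>i. 1 / l i = 0\<close> is a consequence of that of \<open>\<Sum>i. l i = 0\<close>.
  Then \<open>1 / l i\<close> is proportional to \<open>l i\<close>, and any two of the \<open>l i\<close> agree up to sign.
\<close>

lemma circuit_sum_inverse_nonzero:
  assumes p: "freely_movable n p" and S: "S \<subseteq> {1..n}" "card S \<ge> 3" and l: "affine_circuit S p l"
  shows "(\<Sum>i\<in>S. 1 / l i) \<noteq> 0"
proof
  assume sum: "(\<Sum>i\<in>S. 1 / l i) = 0"
  have fin: "finite S" and nz: "\<forall>i\<in>S. l i \<noteq> 0" using l by (auto simp: affine_circuit_def)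
  have "(\<Sum>i\<in>S. (1 / l i) * x i) = 0" if x: "(\<Sum>i\<in>S. l i * x i) = 0" for x
  proof -
    obtain \<delta> r where \<delta>: "derivation \<delta>" and d: "\<forall>i\<in>S. \<delta> (l i) = l i * (x i + r)"
      using circuit_log_derivation[OF p S(1) _ l x] S(2) by fastforce
    have "0 = (\<Sum>i\<in>S. \<delta> (1 / l i))"
      using sum derivation_sum[OF \<delta>, of "\<lambda>i. 1 / l i" S] derivation_0[OF \<delta>] by simp
    also have "\<dots> = (\<Sum>i\<in>S. - ((1 / l i) * x i) - r * (1 / l i))"
    proof (rule sum.cong[OF refl])
      fix i assume i: "i \<in> S"
      then have "\<delta> (1 / l i) = - (l i * (x i + r)) / (l i)\<^sup>2"
        using derivation_inverse[OF \<delta>, of "l i"] d nz by simp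
      also have "\<dots> = - ((1 / l i) * x i) - r * (1 / l i)"
        using nz i by (simp add: field_simps power2_eq_square)
      finally show "\<delta> (1 / l i) = - ((1 / l i) * x i) - r * (1 / l i)" .
    qed
    also have "\<dots> = - (\<Sum>i\<in>S. (1 / l i) * x i) - r * (\<Sum>i\<in>S. 1 / l i)"
      by (simp add: sum_subtractf sum_negf sum_distrib_left)
    finally show ?thesis using sum by simp
  qed
  from proportional_if_kernel_subset[OF fin nz this]
  obtain t where t: "\<forall>i\<in>S. 1 / l i = t * l i" by blast
  obtain i j where ij: "i \<in> S" "j \<in> S" "i \<noteq> j" using S(2) by (rule two_elements)
  have "t \<noteq> 0" using t nz ij by fastforce
  moreover have "t * (l i * l i) = 1" "t * (l j * l j) = 1"
    using t nz ij by (auto simp: field_simps)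
  ultimately have "l i * l i = l j * l j" by (metis mult_cancel_left)
  then have "l i = 1 * l j \<or> l i = (- 1) * l j" by (simp add: square_eq_iff)
  moreover have "(- 1 :: real) \<in> \<rat>" by simp
  ultimately show False using circuit_ratio_irrational[OF p S l ij] by (metis Rats_1)
qed

text \<open>
  An equation between two monomials of degree four in the \<open>l i\<close> holds only if the exponents agree.  Its
  logarithmic derivative is linear, with the differences \<open>\<gamma> i\<close> of exponents as coefficients (the summands
  \<open>r\<close> cancel because the degrees are equal), and must be a multiple \<open>t\<close> of that of \<open>\<Sum>i. l i = 0\<close>.  Unless
  \<open>t = 0\<close>, the \<open>l i\<close> would be proportional to the integers \<open>\<gamma> i\<close>.
\<close>

lemma circuit_edge_products:
  assumes p: "freely_movable n p" and S: "S \<subseteq> {1..n}" "card S \<ge> 3" and l: "affine_circuit S p l"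
    and e: "e1 \<in> complete_edges S" "e2 \<in> complete_edges S" "e3 \<in> complete_edges S" "e4 \<in> complete_edges S"
    and eq: "prod l e1 * prod l e2 = prod l e3 * prod l e4"
    and i: "i \<in> S"
  shows "of_bool (i \<in> e1) + of_bool (i \<in> e2) = (of_bool (i \<in> e3) + of_bool (i \<in> e4) :: int)"
proof -
  have fin: "finite S" and nz: "\<forall>i\<in>S. l i \<noteq> 0" using l by (auto simp: affine_circuit_def)
  define G where "G = (\<lambda>i. of_bool (i \<in> e1) + of_bool (i \<in> e2) - of_bool (i \<in> e3) - of_bool (i \<in> e4) :: int)"
  define \<gamma> where "\<gamma> = (\<lambda>i. real_of_int (G i))"
  have "(\<Sum>i\<in>S. \<gamma> i * x i) = 0" if x: "(\<Sum>i\<in>S. l i * x i) = 0" for x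
  proof -
    obtain \<delta> r where \<delta>: "derivation \<delta>" and d: "\<forall>i\<in>S. \<delta> (l i) = l i * (x i + r)"
      using circuit_log_derivation[OF p S(1) _ l x] i by blast
    have P: "\<delta> (prod l e) = prod l e * ((\<Sum>i\<in>S. of_bool (i \<in> e) * x i) + 2 * r)"
      and Pnz: "prod l e \<noteq> 0" if e_in: "e \<in> complete_edges S" for e
    proof -
      obtain a b where ab: "e = {a, b}" "a \<in> S" "b \<in> S" "a \<noteq> b" using e_in by (rule complete_edgesE)
      have "(\<Sum>i\<in>S. of_bool (i \<in> e) * x i) = (\<Sum>i\<in>{a, b}. of_bool (i \<in> e) * x i)"
        using ab fin by (intro sum.mono_neutral_right) auto
      then have "(\<Sum>i\<in>S. of_bool (i \<in> e) * x i) = x a + x b" using ab by simp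
      moreover have "\<delta> (prod l e) = l a * (l b * (x b + r)) + l b * (l a * (x a + r))"
        using ab d by (simp add: derivation_mult[OF \<delta>])
      ultimately show "\<delta> (prod l e) = prod l e * ((\<Sum>i\<in>S. of_bool (i \<in> e) * x i) + 2 * r)"
        using ab by (simp add: algebra_simps)
      show "prod l e \<noteq> 0" using ab nz by simp
    qed
    define X where "X = (\<lambda>e. \<Sum>i\<in>S. of_bool (i \<in> e) * x i)"
    have "\<delta> (prod l e1 * prod l e2) = (prod l e1 * prod l e2) * (X e1 + X e2 + 4 * r)"
      unfolding derivation_mult[OF \<delta>] P[OF e(1)] P[OF e(2)] X_def by (simp add: algebra_simps)
    moreover have "\<delta> (prod l e3 * prod l e4) = (prod l e3 * prod l e4) * (X e3 + X e4 + 4 * r)"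
      unfolding derivation_mult[OF \<delta>] P[OF e(3)] P[OF e(4)] X_def by (simp add: algebra_simps)
    ultimately have "X e1 + X e2 = X e3 + X e4"
      using eq Pnz[OF e(3)] Pnz[OF e(4)] by simp
    moreover have "(\<Sum>i\<in>S. \<gamma> i * x i) = X e1 + X e2 - X e3 - X e4"
      unfolding X_def sum.distrib[symmetric] sum_subtractf[symmetric]
      by (rule sum.cong) (auto simp: \<gamma>_def G_def algebra_simps)
    ultimately show ?thesis by simp
  qed
  from proportional_if_kernel_subset[OF fin nz this]
  obtain t where t: "\<forall>i\<in>S. \<gamma> i = t * l i" by blast
  have "t = 0"
  proof (rule ccontr)
    assume t0: "t \<noteq> 0"
    obtain a b where ab: "a \<in> S" "b \<in> S" "a \<noteq> b" using S(2) by (rule two_elements)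
    have "\<gamma> b \<noteq> 0" using t t0 ab nz by simp
    then have "l a = (\<gamma> a / \<gamma> b) * l b" using t t0 ab by (simp add: field_simps)
    moreover have "\<gamma> a / \<gamma> b \<in> \<rat>" by (simp add: \<gamma>_def)
    ultimately show False using circuit_ratio_irrational[OF p S l ab] by blast
  qed
  then have "G i = 0" using t i by (simp add: \<gamma>_def)
  then show ?thesis by (simp add: G_def)
qed

section \<open>Recognising a simplex from its edge lengths\<close>

text \<open>
  At most \<open>d\<close> edge vectors at \<open>x\<close> are linearly independent, so they cannot be in equilibrium with
  nonzero weights.
\<close>

lemma free_modulo_congruence_degree:
  fixes q :: "'d::finite configuration"
  assumes q: "free_modulo_congruence n q" and n: "n \<ge> CARD('d) + 1"
    and F: "F \<subseteq> edges_on n" and \<omega>: "\<And>f. f \<in> F \<Longrightarrow> \<omega> f \<noteq> 0"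
    and x: "{y. {x, y} \<in> F} \<noteq> {}"
    and eq: "(\<Sum>y | {x, y} \<in> F. \<omega> {x, y} *\<^sub>R (q x - q y)) = 0"
  shows "card {y. {x, y} \<in> F} \<ge> CARD('d) + 1"
proof (rule ccontr)
  let ?Y = "{y. {x, y} \<in> F}"
  assume "\<not> card ?Y \<ge> CARD('d) + 1"
  then have small: "card ?Y \<le> CARD('d)" by simp
  have Y: "y \<in> {1..n} \<and> x \<in> {1..n} \<and> x \<noteq> y" if "y \<in> ?Y" for y
  proof -
    have "{x, y} \<in> complete_edges {1..n}" using that F unfolding edges_on_eq_complete by blast
    then show ?thesis by simp
  qed
  have finY: "finite ?Y" using Y by (meson finite_atLeastAtMost finite_subset subsetI)
  have xY: "insert x ?Y \<subseteq> {1..n}" using Y x by auto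
  have "card (insert x ?Y) \<le> CARD('d) + 1" using small finY by (simp add: card_insert_if)
  then obtain I where I: "insert x ?Y \<subseteq> I" "I \<subseteq> {1..n}" "card I = CARD('d) + 1"
    using exists_subset_between[of "insert x ?Y" "CARD('d) + 1" "{1..n}"] xY n by auto
  have finI: "finite I" using I(2) finite_subset by blast
  have free: "affinely_free I q" by (rule free_modulo_congruence_affinely_free[OF q I(2,3)])
  define t where "t = (\<Sum>y\<in>?Y. \<omega> {x, y})"
  define c where "c = (\<lambda>y. if y = x then - t else if y \<in> ?Y then \<omega> {x, y} else 0)"
  have xnY: "x \<notin> ?Y" using Y by blast
  have split: "(\<Sum>y\<in>I. h y) = h x + (\<Sum>y\<in>?Y. h y)" if "\<And>y. y \<notin> insert x ?Y \<Longrightarrow> h y = 0"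
    for h :: "nat \<Rightarrow> 'z::comm_monoid_add"
  proof -
    have "(\<Sum>y\<in>I. h y) = (\<Sum>y\<in>insert x ?Y. h y)"
      using I(1) finI that by (intro sum.mono_neutral_right) auto
    then show ?thesis using finY xnY by simp
  qed
  have cY: "c y = \<omega> {x, y}" if "y \<in> ?Y" for y using that xnY by (auto simp: c_def)
  have cY': "(\<Sum>y\<in>?Y. c y) = t" unfolding t_def by (rule sum.cong[OF refl cY])
  have cY'': "(\<Sum>y\<in>?Y. c y *\<^sub>R q y) = (\<Sum>y\<in>?Y. \<omega> {x, y} *\<^sub>R q y)"
    by (rule sum.cong[OF refl]) (simp add: cY)
  have "(\<Sum>y\<in>I. c y) = 0"
    using split[of c] cY' by (simp add: c_def)
  moreover have "(\<Sum>y\<in>I. c y *\<^sub>R q y) = 0"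
  proof -
    have "(\<Sum>y\<in>I. c y *\<^sub>R q y) = c x *\<^sub>R q x + (\<Sum>y\<in>?Y. c y *\<^sub>R q y)"
      by (rule split) (auto simp: c_def)
    also have "\<dots> = - (\<Sum>y\<in>?Y. \<omega> {x, y} *\<^sub>R (q x - q y))"
      unfolding cY'' by (simp add: c_def t_def scaleR_diff_right sum_subtractf scaleR_sum_left)
    finally show ?thesis using eq by simp
  qed
  ultimately have zero: "c y = 0" if "y \<in> I" for y using affinely_freeD[OF free _ _ that] by blast
  obtain y where y: "y \<in> ?Y" using x by blast
  then have "c y = \<omega> {x, y}" "y \<in> I" using cY I(1) by auto
  then show False using zero[of y] \<omega>[of "{x, y}"] y by simp
qed

lemma degree_eq_card_neighbours:
  assumes "F \<subseteq> complete_edges S"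
  shows "card {f \<in> F. x \<in> f} = card {y. {x, y} \<in> F}"
proof -
  have "{f \<in> F. x \<in> f} = (\<lambda>y. {x, y}) ` {y. {x, y} \<in> F}"
  proof
    show "{f \<in> F. x \<in> f} \<subseteq> (\<lambda>y. {x, y}) ` {y. {x, y} \<in> F}"
    proof
      fix f assume f: "f \<in> {f \<in> F. x \<in> f}"
      then have "f \<in> complete_edges S" using assms by blast
      then obtain i j where "f = {i, j}" by (rule complete_edgesE)
      then have "\<exists>y. f = {x, y}" using f by auto
      then show "f \<in> (\<lambda>y. {x, y}) ` {y. {x, y} \<in> F}" using f by auto
    qed
  qed auto
  moreover have "inj_on (\<lambda>y. {x, y}) {y. {x, y} \<in> F}"
    by (auto simp: inj_on_def doubleton_eq_iff)
  ultimately show ?thesis by (simp add: card_image)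
qed

text \<open>
  The stress of the simplex on \<open>S\<close> is transported by \<open>\<phi>\<close>, since \<open>\<phi>\<close> preserves lengths and therefore their
  derivatives.  It does not vanish on any edge, so every vertex of the image has
  degree at least \<open>d + 1\<close> by \<open>free_modulo_congruence_degree\<close>, which leaves only a complete graph on a vertex set \<open>V\<close> with \<open>d + 2\<close> elements.
  In equilibrium at \<open>x\<close>, the stresses of the edges at \<open>x\<close> extend to an affine relation on \<open>V\<close>, hence are
  proportional to \<open>\<mu>\<close>.
\<close>

lemma simplex_image:
  fixes p q :: "'d::finite configuration"
  assumes p: "freely_movable n p" and q: "free_modulo_congruence n q" and n: "n \<ge> CARD('d) + 1"
    and S: "S \<subseteq> {1..n}" "card S = CARD('d) + 2" and l: "affine_circuit S p l"
    and \<phi>: "\<And>e. e \<in> complete_edges S \<Longrightarrow> \<phi> e \<in> edges_on n \<and> edge_sqlength p e = edge_sqlength q (\<phi> e)"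
  shows "\<exists>V \<mu> c. V \<subseteq> {1..n} \<and> card V = CARD('d) + 2 \<and>
      bij_betw \<phi> (complete_edges S) (complete_edges V) \<and>
      (\<forall>x\<in>V. \<mu> x \<noteq> 0) \<and> (\<Sum>x\<in>V. \<mu> x) = 0 \<and>
      (\<forall>x\<in>V. \<forall>y\<in>V. x \<noteq> y \<longrightarrow> (\<forall>e\<in>complete_edges S. \<phi> e = {x, y} \<longrightarrow> prod l e = c x * \<mu> y))"
proof -
  have finS: "finite S" and rel: "affine_relation S p l" and nz: "\<forall>i\<in>S. l i \<noteq> 0"
    using l by (auto simp: affine_circuit_def)
  have SE: "complete_edges S \<subseteq> edges_on n"
    unfolding edges_on_eq_complete by (rule complete_edges_mono[OF S(1)])
  have inj: "inj_on \<phi> (complete_edges S)"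
    by (rule inj_onI, rule edge_sqlength_inj[OF p]) (use \<phi> SE in \<open>auto\<close>)
  define F where "F = \<phi> ` complete_edges S"
  define \<omega> where "\<omega> = (\<lambda>f. prod l (the_inv_into (complete_edges S) \<phi> f))"
  have \<omega>\<phi>: "\<omega> (\<phi> e) = prod l e" if "e \<in> complete_edges S" for e
    using the_inv_into_f_f[OF inj that] by (simp add: \<omega>_def)
  have FE: "F \<subseteq> edges_on n" using \<phi> by (auto simp: F_def)
  have \<omega>nz: "\<omega> f \<noteq> 0" if f: "f \<in> F" for f
  proof -
    obtain e where e: "e \<in> complete_edges S" "f = \<phi> e" using f by (auto simp: F_def)
    from e(1) obtain i j where "e = {i, j}" "i \<in> S" "j \<in> S" "i \<noteq> j" by (rule complete_edgesE)
    then show ?thesis using e \<omega>\<phi> nz by simp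
  qed
  have stress: "(\<Sum>f\<in>F. \<omega> f * \<delta> (edge_sqlength q f)) = 0" if "derivation \<delta>" for \<delta>
  proof -
    have "(\<Sum>f\<in>F. \<omega> f * \<delta> (edge_sqlength q f))
        = (\<Sum>e\<in>complete_edges S. \<omega> (\<phi> e) * \<delta> (edge_sqlength q (\<phi> e)))"
      unfolding F_def using inj by (simp add: sum.reindex)
    also have "\<dots> = (\<Sum>e\<in>complete_edges S. prod l e * \<delta> (edge_sqlength p e))"
      using \<phi> \<omega>\<phi> by (intro sum.cong) auto
    finally show ?thesis using affine_relation_stress[OF finS rel that] by simp
  qed
  have equil: "(\<Sum>y | {x, y} \<in> F. \<omega> {x, y} *\<^sub>R (q x - q y)) = 0" if "x \<in> {1..n}" for x
    by (rule free_modulo_congruence_equilibrium[OF q n FE stress that])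
  define V where "V = \<Union>F"
  have V: "V \<subseteq> {1..n}" using FE by (auto simp: V_def edges_on_eq_complete complete_edges_def)
  have finF: "finite F" using FE edges_on_finite finite_subset by blast
  have "card (\<Union>F) = (CARD('d) + 1) + 1 \<and> F = complete_edges (\<Union>F)"
  proof (rule complete_graph_if_large_degree[OF finF])
    show "card f = 2" if "f \<in> F" for f
      using that FE by (auto simp: edges_on_eq_complete complete_edges_alt)
    show "card F = (CARD('d) + 1 + 1) choose 2"
      using card_image[OF inj] card_complete_edges[OF finS] S(2) by (simp add: F_def)
    show "CARD('d) + 1 \<le> card {f \<in> F. x \<in> f}" if "x \<in> \<Union>F" for x
    proof -
      have x: "x \<in> {1..n}" using that V by (auto simp: V_def)
      have "{y. {x, y} \<in> F} \<noteq> {}"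
      proof -
        obtain f where f: "f \<in> F" "x \<in> f" using \<open>x \<in> \<Union>F\<close> by blast
        then have "f \<in> complete_edges {1..n}" using FE edges_on_eq_complete by blast
        then obtain i j where "f = {i, j}" by (rule complete_edgesE)
        then have "f = {x, i} \<or> f = {x, j}" using f(2) by auto
        then show ?thesis using f(1) by auto
      qed
      from free_modulo_congruence_degree[OF q n FE \<omega>nz this equil[OF x]]
      show ?thesis using degree_eq_card_neighbours[of F "{1..n}" x] FE by (simp add: edges_on_eq_complete)
    qed
  qed simp
  then have cardV: "card V = CARD('d) + 2" and FV: "F = complete_edges V" by (auto simp: V_def)
  have finV: "finite V" using V finite_subset by blast
  have freeV: "affinely_free (V - {k}) q" if "k \<in> V" for k
    using V cardV that finV by (intro free_modulo_congruence_affinely_free[OF q]) auto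
  obtain \<mu> where \<mu>: "affine_circuit V q \<mu>" using affine_circuit_exists[OF finV cardV freeV] by blast
  have "\<exists>r. \<forall>y\<in>V. x \<noteq> y \<longrightarrow> \<omega> {x, y} = r * \<mu> y" if x: "x \<in> V" for x
  proof -
    have Y: "{y. {x, y} \<in> F} = V - {x}" using x by (auto simp: FV)
    define t where "t = (\<Sum>y\<in>V - {x}. \<omega> {x, y})"
    \<comment> \<open>The coefficient at \<open>x\<close> turns the equilibrium condition into an affine relation.\<close>
    define c where "c = (\<lambda>y. if y = x then - t else \<omega> {x, y})"
    have c': "(\<Sum>y\<in>V - {x}. c y) = t" unfolding t_def by (rule sum.cong) (auto simp: c_def)
    have c'': "(\<Sum>y\<in>V - {x}. c y *\<^sub>R q y) = (\<Sum>y\<in>V - {x}. \<omega> {x, y} *\<^sub>R q y)"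
      by (rule sum.cong) (auto simp: c_def)
    have "(\<Sum>y\<in>V. c y) = c x + (\<Sum>y\<in>V - {x}. c y)" by (rule sum.remove[OF finV x])
    moreover have cx: "c x = - t" by (simp add: c_def)
    ultimately have "(\<Sum>y\<in>V. c y) = 0" using c' by simp
    moreover have "(\<Sum>y\<in>V. c y *\<^sub>R q y) = 0"
    proof -
      have "(\<Sum>y\<in>V. c y *\<^sub>R q y) = c x *\<^sub>R q x + (\<Sum>y\<in>V - {x}. c y *\<^sub>R q y)"
        by (rule sum.remove[OF finV x])
      also have "\<dots> = - (\<Sum>y\<in>V - {x}. \<omega> {x, y} *\<^sub>R (q x - q y))"
        unfolding c'' cx by (simp add: t_def scaleR_diff_right sum_subtractf scaleR_sum_left)
      also have "\<dots> = 0" using equil[of x] x V unfolding Y by auto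
      finally show ?thesis .
    qed
    ultimately have "affine_relation V q c" by (simp add: affine_relation_def)
    then obtain r where "\<forall>i\<in>V. c i = r * \<mu> i" using \<mu> unfolding affine_circuit_def by blast
    then have "\<forall>y\<in>V. x \<noteq> y \<longrightarrow> \<omega> {x, y} = r * \<mu> y" unfolding c_def by metis
    then show ?thesis by blast
  qed
  then obtain c where c: "\<And>x y. x \<in> V \<Longrightarrow> y \<in> V \<Longrightarrow> x \<noteq> y \<Longrightarrow> \<omega> {x, y} = c x * \<mu> y" by metis
  have "bij_betw \<phi> (complete_edges S) (complete_edges V)"
    using inj FV by (simp add: bij_betw_def F_def)
  moreover have "\<forall>x\<in>V. \<forall>y\<in>V. x \<noteq> y \<longrightarrow> (\<forall>e\<in>complete_edges S. \<phi> e = {x, y} \<longrightarrow> prod l e = c x * \<mu> y)"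
    using c \<omega>\<phi> by metis
  moreover have "(\<forall>x\<in>V. \<mu> x \<noteq> 0) \<and> (\<Sum>x\<in>V. \<mu> x) = 0"
    using \<mu> by (simp add: affine_circuit_def affine_relation_def)
  ultimately show ?thesis using V cardV by blast
qed

text \<open>
  Two edges with a common vertex \<open>i\<close> are determined by their degree sequence, as both must contain \<open>i\<close>.
\<close>

lemma common_vertex_imp_common_edge:
  assumes e: "e1 \<in> complete_edges S" "e2 \<in> complete_edges S" "e3 \<in> complete_edges S" "e4 \<in> complete_edges S"
    and i: "i \<in> e1" "i \<in> e2"
    and count: "\<And>i. i \<in> S \<Longrightarrow>
        of_bool (i \<in> e1) + of_bool (i \<in> e2) = (of_bool (i \<in> e3) + of_bool (i \<in> e4) :: int)"
  shows "e3 = e1 \<or> e4 = e1"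
proof -
  obtain u v where uv: "e1 = {u, v}" "u \<in> S" "v \<in> S" "u \<noteq> v" using e(1) by (rule complete_edgesE)
  define j where "j = (if i = u then v else u)"
  have j: "e1 = {i, j}" "i \<in> S" "j \<in> S" "i \<noteq> j" using uv i(1) by (auto simp: j_def)
  have i': "i \<in> e3" "i \<in> e4"
    using count[OF j(2)] i by (cases "i \<in> e3"; cases "i \<in> e4"; simp)+
  have "j \<in> e3 \<or> j \<in> e4"
    using count[OF j(3)] j(1) by (cases "j \<in> e2"; cases "j \<in> e3"; cases "j \<in> e4"; simp)
  then show ?thesis
    using complete_edges_eqI[OF e(3) i'(1) _ j(4)] complete_edges_eqI[OF e(4) i'(2) _ j(4)] j(1) by blast
qed

text \<open>
  The products are those that arise when the star of a vertex with coefficient \<open>L0\<close> is mapped to a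
  triangle with coefficients \<open>ma\<close>, \<open>mb\<close>, \<open>mb'\<close>.  They force the coefficients of the second relation to
  be proportional to the reciprocals of those of the first.
\<close>

lemma inverse_sum_zero:
  fixes L0 L1 L2 L3 ca cb :: real
  assumes nz: "L0 \<noteq> 0" "L1 \<noteq> 0" "L2 \<noteq> 0" "L3 \<noteq> 0"
    and s: "ca * mb = L0 * L3" "cb * ma = L0 * L3" "ca * mb' = L0 * L2" "cb * mb' = L0 * L1" "ca * me = L2 * L3"
    and sum: "ma + mb + mb' + me = 0"
  shows "1 / L0 + 1 / L1 + 1 / L2 + 1 / L3 = 0"
proof -
  have "L0 * ((ca * ma) * L1) = (ca * ma) * (cb * mb')" using s(4) by (simp only: mult_ac)
  also have "\<dots> = (ca * mb') * (cb * ma)" by (simp only: mult_ac)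
  also have "\<dots> = L0 * (L0 * L2 * L3)" unfolding s(2,3) by (simp only: mult_ac)
  finally have s5: "(ca * ma) * L1 = L0 * L2 * L3" using nz(1) by simp
  have "ca * ma + ca * mb + ca * mb' + ca * me = ca * (ma + mb + mb' + me)"
    by (simp only: distrib_left)
  then have "(ca * ma + L0 * L3 + L0 * L2 + L2 * L3) * L1 = 0" unfolding s sum by simp
  then have "L0 * L2 * L3 + L0 * L3 * L1 + L0 * L2 * L1 + L2 * L3 * L1 = 0"
    unfolding distrib_right s5 .
  moreover have "1 / L0 + 1 / L1 + 1 / L2 + 1 / L3
      = (L0 * L2 * L3 + L0 * L3 * L1 + L0 * L2 * L1 + L2 * L3 * L1) / (L0 * L1 * L2 * L3)"
    using nz by (simp add: field_simps)
  ultimately show ?thesis by simp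
qed

text \<open>
  By \<open>simplex_image\<close> the stress over two opposite edges of a quadrangle \<open>x y w z\<close> has the same product
  \<open>c x * c w * \<mu> y * \<mu> z\<close> for \<open>{x, y}\<close>, \<open>{z, w}\<close> and for \<open>{x, z}\<close>, \<open>{y, w}\<close>.  In terms of \<open>l\<close> this is an
  identity of monomials, and it shows that the preimages of disjoint edges are disjoint.  Hence the edges
  at a vertex of \<open>S\<close> have pairwise intersecting images, which form a star or a triangle, and in the case
  of stars the centres define the vertex map.
\<close>

lemma simplex_vertex_map:
  fixes p q :: "'d::finite configuration"
  assumes d: "CARD('d) \<ge> 2" and p: "freely_movable n p" and q: "free_modulo_congruence n q"
    and n: "n \<ge> CARD('d) + 1"
    and S: "S \<subseteq> {1..n}" "card S = CARD('d) + 2"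
    and \<phi>: "\<And>e. e \<in> complete_edges S \<Longrightarrow> \<phi> e \<in> edges_on n \<and> edge_sqlength p e = edge_sqlength q (\<phi> e)"
  shows "\<exists>\<rho>. \<rho> ` S \<subseteq> {1..n} \<and> (\<forall>i\<in>S. \<forall>j\<in>S. i \<noteq> j \<longrightarrow> \<phi> {i, j} = {\<rho> i, \<rho> j})"
proof -
  have finS: "finite S" using S(1) finite_subset by blast
  have S3: "card S \<ge> 3" using S d by simp
  have "affinely_free (S - {k}) p" if "k \<in> S" for k
    using S that finS by (intro freely_movable_affinely_free[OF p]) auto
  then obtain l where l: "affine_circuit S p l" using affine_circuit_exists[OF finS S(2)] by blast
  then have lnz: "\<forall>i\<in>S. l i \<noteq> 0" by (simp add: affine_circuit_def)
  obtain V \<mu> c where V: "V \<subseteq> {1..n}" "card V = CARD('d) + 2"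
    and bij: "bij_betw \<phi> (complete_edges S) (complete_edges V)"
    and \<mu>: "\<forall>x\<in>V. \<mu> x \<noteq> 0" "(\<Sum>x\<in>V. \<mu> x) = 0"
    and c: "\<forall>x\<in>V. \<forall>y\<in>V. x \<noteq> y \<longrightarrow> (\<forall>e\<in>complete_edges S. \<phi> e = {x, y} \<longrightarrow> prod l e = c x * \<mu> y)"
    by (rule exE[OF simplex_image[OF p q n S l \<phi>]], assumption, elim exE conjE) (rule that)
  have finV: "finite V" using V(1) finite_subset by blast
  define \<psi> where "\<psi> = the_inv_into (complete_edges S) \<phi>"
  have \<psi>S: "\<psi> f \<in> complete_edges S" and \<phi>\<psi>: "\<phi> (\<psi> f) = f" if "f \<in> complete_edges V" for f
    using bij that unfolding bij_betw_def \<psi>_def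
    by (auto intro!: the_inv_into_into f_the_inv_into_f)
  have \<psi>\<phi>: "\<psi> (\<phi> e) = e" if "e \<in> complete_edges S" for e
    using bij that unfolding bij_betw_def \<psi>_def by (auto intro!: the_inv_into_f_f)
  have \<psi>eq: "\<psi> f = \<psi> g \<Longrightarrow> f = g" if "f \<in> complete_edges V" "g \<in> complete_edges V" for f g
    using \<phi>\<psi> that by metis
  have \<psi>c: "prod l (\<psi> {x, y}) = c x * \<mu> y" if "x \<in> V" "y \<in> V" "x \<noteq> y" for x y
  proof -
    have "{x, y} \<in> complete_edges V" using that by simp
    then show ?thesis using c[rule_format, OF that \<psi>S \<phi>\<psi>] by blast
  qed
  have disj: "\<psi> {x, y} \<inter> \<psi> {z, w} = {}"
    if xyzw: "x \<in> V" "y \<in> V" "z \<in> V" "w \<in> V" "x \<noteq> y" "x \<noteq> z" "x \<noteq> w" "y \<noteq> z" "y \<noteq> w" "z \<noteq> w" for x y z w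
  proof (rule ccontr)
    assume "\<psi> {x, y} \<inter> \<psi> {z, w} \<noteq> {}"
    then obtain i where i: "i \<in> \<psi> {x, y}" "i \<in> \<psi> {z, w}" by blast
    have mem: "\<psi> {x, y} \<in> complete_edges S" "\<psi> {z, w} \<in> complete_edges S"
      "\<psi> {x, z} \<in> complete_edges S" "\<psi> {y, w} \<in> complete_edges S"
      using xyzw \<psi>S by auto
    have sw: "{w, z} = {z, w}" "{w, y} = {y, w}" by auto
    have "prod l (\<psi> {x, y}) = c x * \<mu> y" "prod l (\<psi> {z, w}) = c w * \<mu> z"
      "prod l (\<psi> {x, z}) = c x * \<mu> z" "prod l (\<psi> {y, w}) = c w * \<mu> y"
      using \<psi>c[of x y] \<psi>c[of w z, unfolded sw] \<psi>c[of x z] \<psi>c[of w y, unfolded sw] xyzw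
      by simp_all
    then have eq: "prod l (\<psi> {x, y}) * prod l (\<psi> {z, w}) = prod l (\<psi> {x, z}) * prod l (\<psi> {y, w})"
      by (simp only: mult_ac)
    have "\<psi> {x, z} = \<psi> {x, y} \<or> \<psi> {y, w} = \<psi> {x, y}"
      by (rule common_vertex_imp_common_edge[OF mem i]) (rule circuit_edge_products[OF p S(1) S3 l mem eq])
    then have "{x, z} = {x, y} \<or> {y, w} = {x, y}"
    proof (rule disj_forward)
      assume same: "\<psi> {x, z} = \<psi> {x, y}"
      show "{x, z} = {x, y}" by (rule \<psi>eq[OF _ _ same]) (use xyzw in simp_all)
    next
      assume same: "\<psi> {y, w} = \<psi> {x, y}"
      show "{y, w} = {x, y}" by (rule \<psi>eq[OF _ _ same]) (use xyzw in simp_all)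
    qed
    then show False using xyzw by (auto simp: doubleton_eq_iff)
  qed
  have meet: "\<phi> e \<inter> \<phi> f \<noteq> {}" if "e \<in> complete_edges S" "f \<in> complete_edges S" "e \<inter> f \<noteq> {}" for e f
  proof
    assume empty: "\<phi> e \<inter> \<phi> f = {}"
    have "\<phi> e \<in> complete_edges V" "\<phi> f \<in> complete_edges V"
      using bij that by (auto simp: bij_betw_def)
    then obtain x y z w where xy: "\<phi> e = {x, y}" "x \<in> V" "y \<in> V" "x \<noteq> y"
      and zw: "\<phi> f = {z, w}" "z \<in> V" "w \<in> V" "z \<noteq> w" by (auto elim!: complete_edgesE)
    have "\<psi> {x, y} \<inter> \<psi> {z, w} = {}" by (rule disj) (use xy zw empty in auto)
    then show False using \<psi>\<phi> that xy zw by metis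
  qed
  define star where "star = (\<lambda>i. (\<lambda>j. {i, j}) ` (S - {i}))"
  have star_sub: "star i \<subseteq> complete_edges S" if "i \<in> S" for i using that by (auto simp: star_def)
  have card_star: "card (\<phi> ` star i) = CARD('d) + 1" if i: "i \<in> S" for i
  proof -
    have "inj_on \<phi> (star i)" using bij star_sub[OF i] by (auto simp: bij_betw_def intro: inj_on_subset)
    moreover have "inj_on (\<lambda>j. {i, j}) (S - {i})" by (auto simp: inj_on_def doubleton_eq_iff)
    ultimately show ?thesis using S(2) i finS by (simp add: card_image star_def)
  qed
  have \<phi>star: "\<phi> ` star i \<subseteq> complete_edges V" if "i \<in> S" for i
    using star_sub[OF that] bij by (auto simp: bij_betw_def)
  \<comment> \<open>For \<open>d = 2\<close> the bijection that exchanges stars and triangles of a complete graph on four vertices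
    also respects disjointness, so that the affine relations have to be consulted.\<close>
  have no_triangle: False
    if i: "i \<in> S" and abc: "a \<noteq> b" "a \<noteq> b'" "b \<noteq> b'" and tri: "\<phi> ` star i = {{a, b}, {a, b'}, {b, b'}}"
    for i a b b'
  proof -
    have "card {{a, b}, {a, b'}, {b, b'}} \<le> 3" using card_length[of "[{a, b}, {a, b'}, {b, b'}]"] by simp
    then have d2: "CARD('d) = 2" using card_star[OF i] tri d by simp
    have abV: "a \<in> V" "b \<in> V" "b' \<in> V" using \<phi>star[OF i] tri by auto
    have "card (V - {a, b, b'}) = 1" using V(2) d2 abV abc finV by (simp add: card_Diff_subset)
    then obtain e where "V - {a, b, b'} = {e}" by (auto simp: card_1_singleton_iff)
    then have Ve: "V = {a, b, b', e}" and e: "e \<notin> {a, b, b'}" using abV by auto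
    have pre: "\<exists>j. j \<in> S \<and> j \<noteq> i \<and> \<psi> f = {i, j}" if f: "f \<in> \<phi> ` star i" for f
    proof -
      obtain j where j: "j \<in> S - {i}" "f = \<phi> {i, j}" using f unfolding star_def by (elim imageE) simp
      then show ?thesis using \<psi>\<phi>[of "{i, j}"] i by auto
    qed
    obtain j3 where j3: "j3 \<in> S" "j3 \<noteq> i" "\<psi> {a, b} = {i, j3}"
      using pre[of "{a, b}"] tri by auto
    obtain j2 where j2: "j2 \<in> S" "j2 \<noteq> i" "\<psi> {a, b'} = {i, j2}"
      using pre[of "{a, b'}"] tri by auto
    obtain j1 where j1: "j1 \<in> S" "j1 \<noteq> i" "\<psi> {b, b'} = {i, j1}"
      using pre[of "{b, b'}"] tri by auto
    note j = j1(1) j2(1) j3(1) j1(2) j2(2) j3(2) and \<psi>j = j3(3) j2(3) j1(3)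
    have jj: "j1 \<noteq> j2" "j1 \<noteq> j3" "j2 \<noteq> j3"
      using \<psi>eq[of "{a, b}" "{a, b'}"] \<psi>eq[of "{a, b}" "{b, b'}"] \<psi>eq[of "{a, b'}" "{b, b'}"] \<psi>j abV abc
      by (auto simp: doubleton_eq_iff)
    have S': "S = {i, j1, j2, j3}"
    proof (rule card_subset_eq[OF finS, symmetric])
      show "{i, j1, j2, j3} \<subseteq> S" using i j by auto
      show "card {i, j1, j2, j3} = card S" using S(2) d2 j jj by auto
    qed
    have "\<psi> {a, e} \<inter> \<psi> {b, b'} = {}" by (rule disj) (use abV Ve e abc in auto)
    then have ae: "\<psi> {a, e} = {j2, j3}"
      using \<psi>S[of "{a, e}"] abV Ve e \<psi>j(3) unfolding S' by (auto elim!: complete_edgesE)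
    define L0 L1 L2 L3 where "L0 = l i" and "L1 = l j1" and "L2 = l j2" and "L3 = l j3"
    have nz: "L0 \<noteq> 0" "L1 \<noteq> 0" "L2 \<noteq> 0" "L3 \<noteq> 0"
      unfolding L0_def L1_def L2_def L3_def
      by (rule lnz[rule_format, OF i], rule lnz[rule_format, OF j(1)],
          rule lnz[rule_format, OF j(2)], rule lnz[rule_format, OF j(3)])
    have pair: "prod l {u, v} = l u * l v" if "u \<noteq> v" for u v :: nat using that by simp
    have ba: "\<psi> {b, a} = {i, j3}" using \<psi>j(1) by (simp only: insert_commute[of b a])
    have s1: "c a * \<mu> b = L0 * L3" "c b * \<mu> a = L0 * L3"
      unfolding L0_def L3_def pair[OF j(6)[symmetric], symmetric]
      by (rule \<psi>c[OF abV(1,2) abc(1), unfolded \<psi>j(1), symmetric],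
          rule \<psi>c[OF abV(2,1) abc(1)[symmetric], unfolded ba, symmetric])
    have s2: "c a * \<mu> b' = L0 * L2"
      unfolding L0_def L2_def pair[OF j(5)[symmetric], symmetric]
      by (rule \<psi>c[OF abV(1,3) abc(2), unfolded \<psi>j(2), symmetric])
    have s3: "c b * \<mu> b' = L0 * L1"
      unfolding L0_def L1_def pair[OF j(4)[symmetric], symmetric]
      by (rule \<psi>c[OF abV(2,3) abc(3), unfolded \<psi>j(3), symmetric])
    have eV: "e \<in> V" "a \<noteq> e" using Ve e by auto
    have s4: "c a * \<mu> e = L2 * L3"
      unfolding L2_def L3_def pair[OF jj(3), symmetric]
      by (rule \<psi>c[OF abV(1) eV, unfolded ae, symmetric])
    have "\<mu> a + \<mu> b + \<mu> b' + \<mu> e = 0" using \<mu>(2) e abc unfolding Ve by (simp add: add.assoc)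
    from inverse_sum_zero[OF nz s1 s2 s3 s4 this]
    have "1 / L0 + 1 / L1 + 1 / L2 + 1 / L3 = 0" .
    then have "(\<Sum>i\<in>S. 1 / l i) = 0"
      using j jj unfolding S' by (simp add: L0_def L1_def L2_def L3_def add.assoc)
    then show False using circuit_sum_inverse_nonzero[OF p S(1) S3 l] by simp
  qed
  have "\<exists>r. \<forall>f\<in>\<phi> ` star i. r \<in> f" if i: "i \<in> S" for i
  proof -
    have ge: "card (\<phi> ` star i) \<ge> 3" using card_star[OF i] d by simp
    have int: "e \<inter> f \<noteq> {}" if ef: "e \<in> \<phi> ` star i" "f \<in> \<phi> ` star i" for e f
    proof -
      obtain e' f' where "e = \<phi> e'" "f = \<phi> f'" "e' \<in> star i" "f' \<in> star i" using ef by blast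
      then show ?thesis using meet[of e' f'] star_sub[OF i] by (auto simp: star_def)
    qed
    have "(\<exists>r. \<forall>f\<in>\<phi> ` star i. r \<in> f) \<or>
        (\<exists>a b b'. a \<noteq> b \<and> a \<noteq> b' \<and> b \<noteq> b' \<and> \<phi> ` star i = {{a, b}, {a, b'}, {b, b'}})"
      by (rule intersecting_pairs[OF \<phi>star[OF i] ge]) (rule int)
    then show ?thesis
    proof (rule disjE)
      assume "\<exists>a b b'. a \<noteq> b \<and> a \<noteq> b' \<and> b \<noteq> b' \<and> \<phi> ` star i = {{a, b}, {a, b'}, {b, b'}}"
      then show ?thesis by (elim exE conjE) (drule (3) no_triangle[OF i], erule FalseE)
    qed
  qed
  then obtain \<rho> where \<rho>: "\<And>i f. i \<in> S \<Longrightarrow> f \<in> \<phi> ` star i \<Longrightarrow> \<rho> i \<in> f" by metis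
  have \<rho>V: "\<rho> i \<in> V" if i: "i \<in> S" for i
  proof -
    obtain f where f: "f \<in> \<phi> ` star i" using card_star[OF i] by fastforce
    then have "f \<subseteq> V" using \<phi>star[OF i] by (auto simp: complete_edges_alt)
    then show ?thesis using \<rho>[OF i f] by blast
  qed
  have \<rho>mem: "\<rho> i \<in> \<phi> {i, j}" "\<rho> j \<in> \<phi> {i, j}" if "i \<in> S" "j \<in> S" "i \<noteq> j" for i j
  proof -
    have "{i, j} \<in> star i" "{i, j} \<in> star j" using that by (auto simp: star_def insert_commute)
    then show "\<rho> i \<in> \<phi> {i, j}" "\<rho> j \<in> \<phi> {i, j}" using \<rho> that by blast+
  qed
  have \<rho>inj: "\<rho> i \<noteq> \<rho> j" if ij: "i \<in> S" "j \<in> S" "i \<noteq> j" for i j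
  proof
    assume same: "\<rho> i = \<rho> j"
    have "\<not> S \<subseteq> {i, j}"
    proof
      assume "S \<subseteq> {i, j}"
      then have "card S \<le> card {i, j}" by (intro card_mono) auto
      then show False using S3 ij(3) by simp
    qed
    then obtain k where k: "k \<in> S" "k \<noteq> i" "k \<noteq> j" by blast
    \<comment> \<open>The star of \<open>i\<close> already exhausts the edges at its centre; an edge \<open>{j, k}\<close> would be one too many.\<close>
    let ?T = "insert {j, k} (star i)"
    have T: "?T \<subseteq> complete_edges S" using star_sub ij k by auto
    have "{j, k} \<notin> star i" using ij k by (auto simp: star_def doubleton_eq_iff)
    moreover have "card (star i) = CARD('d) + 1"
    proof -
      have "inj_on (\<lambda>j. {i, j}) (S - {i})" by (auto simp: inj_on_def doubleton_eq_iff)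
      then show ?thesis using S(2) ij finS by (simp add: card_image star_def)
    qed
    moreover have "finite (star i)" using finS by (simp add: star_def)
    ultimately have "card ?T = CARD('d) + 2" by simp
    moreover have "inj_on \<phi> ?T" by (rule inj_on_subset[OF bij_betw_imp_inj_on[OF bij] T])
    ultimately have card: "card (\<phi> ` ?T) = CARD('d) + 2" by (metis card_image)
    have "\<phi> ` ?T \<subseteq> (\<lambda>y. {\<rho> i, y}) ` (V - {\<rho> i})"
    proof
      fix f assume f: "f \<in> \<phi> ` ?T"
      have "\<phi> ` ?T \<subseteq> complete_edges V"
        unfolding bij_betw_imp_surj_on[OF bij, symmetric] by (rule image_mono[OF T])
      with f have fV: "f \<in> complete_edges V" by blast
      have "\<rho> i \<in> f"
        using f \<rho>[OF ij(1)] \<rho>mem(1)[OF ij(2) k(1)] k same by auto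
      then show "f \<in> (\<lambda>y. {\<rho> i, y}) ` (V - {\<rho> i})"
        using fV by (auto elim!: complete_edgesE)
    qed
    then have "card (\<phi> ` ?T) \<le> card ((\<lambda>y. {\<rho> i, y}) ` (V - {\<rho> i}))"
      using finV by (intro card_mono) auto
    also have "\<dots> \<le> card (V - {\<rho> i})" using finV by (intro card_image_le) auto
    also have "\<dots> = CARD('d) + 1" using \<rho>V[OF ij(1)] V(2) finV by simp
    finally show False using card by simp
  qed
  have "\<phi> {i, j} = {\<rho> i, \<rho> j}" if ij: "i \<in> S" "j \<in> S" "i \<noteq> j" for i j
  proof (rule complete_edges_eqI[OF _ \<rho>mem[OF ij] \<rho>inj[OF ij]])
    show "\<phi> {i, j} \<in> complete_edges V" using bij ij by (auto simp: bij_betw_def)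
  qed
  moreover have "\<rho> ` S \<subseteq> {1..n}" using \<rho>V V(1) by blast
  ultimately show ?thesis by blast
qed

section \<open>Trilateration\<close>

text \<open>
  By induction on the number \<open>m\<close> of placed vertices, an isometry carries \<open>q (\<sigma> i)\<close> to \<open>p i\<close> for all placed
  vertices.  At the end the distances within \<open>q \<circ> \<sigma>\<close> are those within \<open>p\<close>; as these are pairwise
  different, \<open>\<sigma>\<close> is injective and each edge of \<open>H\<close> can be identified by its length.
\<close>

theorem theorem5p21:
  fixes p q :: "'d::finite configuration"
    and n k :: nat
    and G H :: "nat set list"
    and v :: "real list"
  assumes "CARD('d) \<ge> 2"
    and "n \<ge> CARD('d) + 2"
    and "generic n p"
    and "edge_ensemble n G" and "length G = k"
    and "allows_trilateration CARD('d) n G"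
    and "v = sq_measurements G p"
    and "edge_ensemble n H" and "length H = k"
    and "v = sq_measurements H q"
  shows "\<exists>\<sigma>. \<sigma> permutes {1..n} \<and>
           congruent_configurations n (\<lambda>i. q (\<sigma> i)) p \<and>
           (\<forall>t < k. \<forall>i j. G ! t = {i, j} \<longrightarrow> H ! t = {\<sigma> i, \<sigma> j})"
proof -
  note d = assms(1) and n = assms(2)
  have p: "freely_movable n p" using assms(3) by (rule generic_imp_freely_movable)
  have Gn: "set G \<subseteq> edges_on n" and Hn: "set H \<subseteq> edges_on n"
    using assms(4,8) by (auto simp: edge_ensemble_def)
  have len: "edge_sqlength p (G ! t) = edge_sqlength q (H ! t)" if "t < k" for t
    using assms(5,7,9,10) that by (simp add: sq_measurements_def list_eq_iff_nth_eq)
  \<comment> \<open>An edge may be measured several times; any one of its positions serves.\<close>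
  define \<phi> where "\<phi> = (\<lambda>e. H ! (SOME t. t < k \<and> G ! t = e))"
  have \<phi>: "\<phi> e \<in> edges_on n \<and> edge_sqlength p e = edge_sqlength q (\<phi> e)" if "e \<in> set G" for e
  proof -
    have "\<exists>t. t < k \<and> G ! t = e" using that assms(5) by (simp add: in_set_conv_nth)
    moreover define t where "t = (SOME t. t < k \<and> G ! t = e)"
    ultimately have "t < k \<and> G ! t = e" using someI_ex[of "\<lambda>t. t < k \<and> G ! t = e"] by simp
    then have t: "t < k" "G ! t = e" "\<phi> e = H ! t" by (simp_all add: \<phi>_def t_def)
    then have "\<phi> e \<in> set H" using assms(9) by simp
    then show ?thesis using len[OF t(1)] t Hn by auto
  qed
  have q: "free_modulo_congruence n q"
    by (rule freedom_transfers[OF p Gn trilateration_infinitesimally_rigid[OF p n assms(6)]]) (rule \<phi>)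
  have n1: "n \<ge> CARD('d) + 1" using n by simp
  obtain \<pi> where \<pi>: "\<pi> permutes {1..n}"
    and simplex: "\<And>i j. i \<in> {1..CARD('d) + 2} \<Longrightarrow> j \<in> {1..CARD('d) + 2} \<Longrightarrow> i \<noteq> j \<Longrightarrow> {\<pi> i, \<pi> j} \<in> set G"
    and attached: "\<And>j. j \<in> {CARD('d) + 2<..n} \<Longrightarrow>
        \<exists>I\<subseteq>{1..<j}. card I = CARD('d) + 1 \<and> (\<forall>i\<in>I. {\<pi> i, \<pi> j} \<in> set G)"
    using assms(6) unfolding allows_trilateration_def by blast
  have inj\<pi>: "inj \<pi>" using \<pi> by (rule permutes_inj)
  have \<pi>n: "\<pi> ` A \<subseteq> {1..n}" if "A \<subseteq> {1..n}" for A using that permutes_image[OF \<pi>] by blast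
  have card\<pi>: "card (\<pi> ` A) = card A" for A using inj\<pi> by (meson card_image inj_on_subset subset_UNIV)
  have "\<exists>\<sigma> f. (\<forall>x y. dist (f x) (f y) = dist x y) \<and> (\<forall>i\<in>\<pi> ` {1..m}. \<sigma> i \<in> {1..n} \<and> f (q (\<sigma> i)) = p i)"
    if "CARD('d) + 2 \<le> m" "m \<le> n" for m
    using that
  proof (induction m rule: dec_induct)
    case base
    let ?S = "\<pi> ` {1..CARD('d) + 2}"
    have S: "?S \<subseteq> {1..n}" "card ?S = CARD('d) + 2" using \<pi>n n card\<pi> by auto
    have measured: "e \<in> set G" if e: "e \<in> complete_edges ?S" for e
    proof -
      obtain i j where ij: "e = {i, j}" "i \<in> ?S" "j \<in> ?S" "i \<noteq> j" using e by (rule complete_edgesE)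
      from ij(2) obtain a where a: "i = \<pi> a" "a \<in> {1..CARD('d) + 2}" by (rule imageE)
      from ij(3) obtain b where b: "j = \<pi> b" "b \<in> {1..CARD('d) + 2}" by (rule imageE)
      have "a \<noteq> b" using ij(4) a(1) b(1) by auto
      then show ?thesis using simplex[OF a(2) b(2)] unfolding ij(1) a(1) b(1) by blast
    qed
    then have "\<exists>\<rho>. \<rho> ` ?S \<subseteq> {1..n} \<and> (\<forall>i\<in>?S. \<forall>j\<in>?S. i \<noteq> j \<longrightarrow> \<phi> {i, j} = {\<rho> i, \<rho> j})"
      by (intro simplex_vertex_map[OF d p q n1 S] \<phi>)
    then obtain \<rho> where \<rho>: "\<rho> ` ?S \<subseteq> {1..n}"
        "\<forall>i\<in>?S. \<forall>j\<in>?S. i \<noteq> j \<longrightarrow> \<phi> {i, j} = {\<rho> i, \<rho> j}"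
      by (elim exE conjE)
    have "dist (q (\<rho> i)) (q (\<rho> j)) = dist (p i) (p j)" if ij: "i \<in> ?S" "j \<in> ?S" for i j
    proof (cases "i = j")
      case False
      then have "{i, j} \<in> set G" by (intro measured complete_edgesI ij)
      then have "(norm (p i - p j))\<^sup>2 = (norm (q (\<rho> i) - q (\<rho> j)))\<^sup>2"
        using \<phi>[of "{i, j}"] \<rho>(2)[rule_format, OF ij False] by (simp add: edge_sqlength_doubleton)
      then show ?thesis by (simp add: dist_norm)
    qed simp
    from equal_distances_isometry[of ?S "\<lambda>i. q (\<rho> i)" p, OF _ this]
    obtain f :: "real ^ 'd \<Rightarrow> real ^ 'd" where f: "\<forall>x y. dist (f x) (f y) = dist x y" "\<forall>i\<in>?S. f (q (\<rho> i)) = p i" by auto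
    moreover have "\<forall>i\<in>?S. \<rho> i \<in> {1..n}" using \<rho>(1) by (simp only: image_subset_iff)
    ultimately show ?case by blast
  next
    case (step m)
    then have "\<exists>\<sigma> f. (\<forall>x y. dist (f x) (f y) = dist x y) \<and>
        (\<forall>i\<in>\<pi> ` {1..m}. \<sigma> i \<in> {1..n} \<and> f (q (\<sigma> i)) = p i)"
      by simp
    then obtain \<sigma> and f :: "real ^ 'd \<Rightarrow> real ^ 'd" where f0: "\<forall>x y. dist (f x) (f y) = dist x y"
      and \<sigma>0: "\<forall>i\<in>\<pi> ` {1..m}. \<sigma> i \<in> {1..n} \<and> f (q (\<sigma> i)) = p i"
      by (elim exE conjE)
    have f: "dist (f x) (f y) = dist x y" for x y using f0 by blast
    have \<sigma>: "\<sigma> i \<in> {1..n}" "f (q (\<sigma> i)) = p i" if "i \<in> \<pi> ` {1..m}" for i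
      using \<sigma>0[rule_format, OF that] by blast+
    obtain I0 where I0: "I0 \<subseteq> {1..<Suc m}" "card I0 = CARD('d) + 1" "\<forall>i\<in>I0. {\<pi> i, \<pi> (Suc m)} \<in> set G"
      using attached[of "Suc m"] step by auto
    define I where "I = \<pi> ` I0"
    define x where "x = \<pi> (Suc m)"
    have I: "I \<subseteq> \<pi> ` {1..m}" "card I = CARD('d) + 1" "\<And>i. i \<in> I \<Longrightarrow> {i, x} \<in> set G"
      using I0 card\<pi> by (auto simp: I_def x_def)
    have In: "I \<subseteq> {1..n}" using I(1) \<pi>n[of "{1..m}"] step by auto
    have finI: "finite I" using In finite_subset by blast
    have xm: "x \<notin> \<pi> ` {1..m}" unfolding x_def by (simp add: inj_image_mem_iff[OF inj\<pi>])
    then have xI: "x \<notin> I" using I(1) by blast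
    have xn: "x \<in> {1..n}" using \<pi>n[of "{Suc m}"] step by (auto simp: x_def)
    have dist\<sigma>: "dist (q (\<sigma> i)) (q (\<sigma> j)) = dist (p i) (p j)" if "i \<in> I" "j \<in> I" for i j
    proof -
      have "f (q (\<sigma> i)) = p i" "f (q (\<sigma> j)) = p j" using \<sigma>(2) that I(1) by blast+
      then show ?thesis using f[of "q (\<sigma> i)" "q (\<sigma> j)"] by simp
    qed
    have \<sigma>inj: "\<sigma> i \<noteq> \<sigma> j" if "i \<in> I" "j \<in> I" "i \<noteq> j" for i j
    proof -
      have "p i \<noteq> p j" using freely_movable_distinct[OF p _ _ that(3)] that In by blast
      then show ?thesis using dist\<sigma>[OF that(1,2)] by auto
    qed
    \<comment> \<open>The distances within the placed vertices are known, whether or not they are measured.\<close>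
    define \<phi>' where "\<phi>' = (\<lambda>e. if x \<in> e then \<phi> e else \<sigma> ` e)"
    let ?S = "insert x I"
    have S: "?S \<subseteq> {1..n}" "card ?S = CARD('d) + 2" using In xn xI finI I(2) by auto
    have \<phi>': "\<phi>' e \<in> edges_on n \<and> edge_sqlength p e = edge_sqlength q (\<phi>' e)"
      if e: "e \<in> complete_edges ?S" for e
    proof (cases "x \<in> e")
      case True
      then obtain i where "e = {i, x}" "i \<in> I" using e by (auto elim!: complete_edgesE)
      then have "e \<in> set G" using I(3) by simp
      then show ?thesis using \<phi> True by (simp add: \<phi>'_def)
    next
      case False
      then obtain i j where ij: "e = {i, j}" "i \<in> I" "j \<in> I" "i \<noteq> j" using e by (auto elim!: complete_edgesE)
      then have "\<phi>' e = {\<sigma> i, \<sigma> j}" using False by (simp add: \<phi>'_def)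
      moreover have "{\<sigma> i, \<sigma> j} \<in> edges_on n"
        using \<sigma>(1) \<sigma>inj ij I(1) by (auto simp: edges_on_eq_complete)
      ultimately show ?thesis
        using dist\<sigma>[OF ij(2,3)] ij(1) by (simp add: edge_sqlength_doubleton dist_norm)
    qed
    have "\<exists>\<rho>. \<rho> ` ?S \<subseteq> {1..n} \<and> (\<forall>i\<in>?S. \<forall>j\<in>?S. i \<noteq> j \<longrightarrow> \<phi>' {i, j} = {\<rho> i, \<rho> j})"
      by (rule simplex_vertex_map[OF d p q n1 S]) (rule \<phi>')
    then obtain \<rho> where \<rho>: "\<rho> ` ?S \<subseteq> {1..n}"
        and "\<forall>i\<in>?S. \<forall>j\<in>?S. i \<noteq> j \<longrightarrow> \<phi>' {i, j} = {\<rho> i, \<rho> j}"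
      by (elim exE conjE)
    then have \<rho>\<phi>: "\<phi>' {i, j} = {\<rho> i, \<rho> j}" if "i \<in> ?S" "j \<in> ?S" "i \<noteq> j" for i j
      using that by blast
    \<comment> \<open>Two edges at \<open>i\<close> determine the image of \<open>i\<close>; they exist within \<open>I\<close> because \<open>d + 1 \<ge> 3\<close>.\<close>
    have \<rho>\<sigma>: "\<rho> i = \<sigma> i" if i: "i \<in> I" for i
    proof -
      have "card (I - {i}) \<ge> 2" using I(2) d i finI by simp
      then obtain j l where jl: "j \<in> I - {i}" "l \<in> I - {i}" "j \<noteq> l"
        by (metis card_le_Suc0_iff_eq card.infinite not_less_eq_eq numeral_2_eq_2 zero_le)
      have "\<phi>' {i, y} = {\<sigma> i, \<sigma> y}" if "y \<in> I" for y
        using that i xI by (auto simp: \<phi>'_def)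
      then have "{\<rho> i, \<rho> j} = {\<sigma> i, \<sigma> j}" "{\<rho> i, \<rho> l} = {\<sigma> i, \<sigma> l}"
        using \<rho>\<phi>[of i j] \<rho>\<phi>[of i l] i jl by auto
      moreover have "\<sigma> i \<noteq> \<sigma> j" "\<sigma> i \<noteq> \<sigma> l" "\<sigma> j \<noteq> \<sigma> l" using \<sigma>inj i jl by auto
      ultimately show ?thesis by (metis doubleton_eq_iff)
    qed
    have "f (q (\<rho> x)) = p x"
    proof (rule equidistant_imp_eq[OF freely_movable_affinely_free[OF p In] finI I(2)])
      show "card I \<le> CARD('d) + 1" using I(2) by simp
      fix i assume i: "i \<in> I"
      have "\<phi> {x, i} = {\<rho> x, \<sigma> i}" using \<rho>\<phi>[of x i] \<rho>\<sigma>[OF i] i xI by (auto simp: \<phi>'_def)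
      then have "(norm (p x - p i))\<^sup>2 = (norm (q (\<rho> x) - q (\<sigma> i)))\<^sup>2"
        using \<phi>[of "{x, i}"] I(3)[OF i] by (simp add: edge_sqlength_doubleton insert_commute norm_minus_commute)
      then have "dist (q (\<rho> x)) (q (\<sigma> i)) = dist (p x) (p i)" by (simp add: dist_norm)
      then show "dist (f (q (\<rho> x))) (p i) = dist (p x) (p i)"
        using f[of "q (\<rho> x)" "q (\<sigma> i)"] \<sigma>(2)[of i] i I(1) by auto
    qed
    moreover have "\<pi> ` {1..Suc m} = insert x (\<pi> ` {1..m})"
      unfolding x_def image_insert[symmetric] by (rule arg_cong[where f = "image \<pi>"]) auto
    moreover have "\<rho> x \<in> {1..n}" using \<rho> by auto
    ultimately show ?case
      using f \<sigma> xm by (intro exI[of _ "\<sigma>(x := \<rho> x)"] exI[of _ f]) auto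
  qed
  from this[OF n order_refl]
  obtain \<sigma> and f :: "real ^ 'd \<Rightarrow> real ^ 'd" where f: "\<forall>x y. dist (f x) (f y) = dist x y"
    and \<sigma>n: "\<forall>i\<in>{1..n}. \<sigma> i \<in> {1..n} \<and> f (q (\<sigma> i)) = p i"
    unfolding permutes_image[OF \<pi>] by (elim exE conjE)
  have \<sigma>: "\<sigma> i \<in> {1..n}" "f (q (\<sigma> i)) = p i" if "i \<in> {1..n}" for i
    using \<sigma>n[rule_format, OF that] by blast+
  have dist\<sigma>: "dist (q (\<sigma> i)) (q (\<sigma> j)) = dist (p i) (p j)" if "i \<in> {1..n}" "j \<in> {1..n}" for i j
    using f \<sigma>(2) that by metis
  have inj: "inj_on \<sigma> {1..n}"
  proof (rule inj_onI, rule ccontr)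
    fix i j assume "i \<in> {1..n}" "j \<in> {1..n}" "\<sigma> i = \<sigma> j" "i \<noteq> j"
    then show False using dist\<sigma>[of i j] freely_movable_distinct[OF p, of i j] by simp
  qed
  have image: "\<sigma> ` {1..n} = {1..n}"
    by (rule card_subset_eq) (use \<sigma>(1) card_image[OF inj] in auto)
  define \<tau> where "\<tau> = (\<lambda>i. if i \<in> {1..n} then \<sigma> i else i)"
  have \<tau>\<sigma>: "\<tau> i = \<sigma> i" if "i \<in> {1..n}" for i using that by (simp add: \<tau>_def)
  show ?thesis
  proof (intro exI[of _ \<tau>] conjI allI impI)
    have "bij_betw \<tau> {1..n} {1..n}"
      using bij_betw_imageI[OF inj image] bij_betw_cong[of "{1..n}" \<tau> \<sigma>] \<tau>\<sigma> by blast
    then show "\<tau> permutes {1..n}" by (rule bij_imp_permutes) (simp only: \<tau>_def if_False)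
    show "congruent_configurations n (\<lambda>i. q (\<tau> i)) p"
      unfolding congruent_configurations_def using f \<sigma>(2) \<tau>\<sigma> by (intro exI[of _ f]) simp
  next
    fix t i j assume t: "t < k" and Gt: "G ! t = {i, j}"
    have "{i, j} \<in> edges_on n" using Gn t assms(5) Gt by (metis nth_mem subsetD)
    then have ij: "i \<in> {1..n}" "j \<in> {1..n}" by (auto simp: edges_on_eq_complete)
    have Ht: "H ! t \<in> edges_on n" using Hn t assms(9) by auto
    then obtain a b where ab: "H ! t = {a, b}" "a \<in> {1..n}" "b \<in> {1..n}" "a \<noteq> b" by (rule edges_onE)
    then obtain a' b' where ab': "a = \<sigma> a'" "b = \<sigma> b'" "a' \<in> {1..n}" "b' \<in> {1..n}"
      using image by (metis imageE)
    have "edge_sqlength p {a', b'} = edge_sqlength q (H ! t)"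
      using dist\<sigma>[OF ab'(3,4)] ab ab' by (simp add: edge_sqlength_doubleton dist_norm)
    also have "\<dots> = edge_sqlength p {i, j}" using len[OF t] Gt by simp
    finally have "{a', b'} = {i, j}"
    proof (rule edge_sqlength_inj[OF p, rotated 2])
      show "{a', b'} \<in> edges_on n" using ab' ab by (auto simp: edges_on_eq_complete)
    qed fact
    then have "\<sigma> ` {a', b'} = \<sigma> ` {i, j}" by simp
    then show "H ! t = {\<tau> i, \<tau> j}" using ab ab' ij \<tau>\<sigma> by simp
  qed
qed

end
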